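(* ${\mathrm{LK}}$ quasipolynomially simulates ${\mathrm{eLNDT}}$, and hence also ${\mathrm{eLDT}}$. That is, there is a procedure running in time $2^{(\log n)^{O(1)}}$ (with $n$ the input size) which, given an ${\mathrm{eLNDT}}$ proof (or an ${\mathrm{eLDT}}$ proof) of a sequent $A_0,\dots,A_{m-1}\to B_0,\dots,B_{n-1}$ of DT formulas, outputs an ${\mathrm{LK}}$ proof of ${\mathrm{Cls}}(A_0),\dots,{\mathrm{Cls}}(A_{m-1})\to{\mathrm{Tms}}(B_0),\dots,{\mathrm{Tms}}(B_{n-1})$.
   Context: A literal is a propositional variable $x$ or its negation $\overline x$. DT formulas: literals, and $(ApB)$ for DT formulas $A,B$ and literal $p$ ("if $p$ is false then $A$, else $B$"). ${\mathrm{LK}}$ is the usual sequent calculus for Boolean formulas built from literals by binary $\land,\lor$ (initial sequents $p\to p$, $p,\overline p\to$, $\to p,\overline p$; contraction, weakening, cut, standard left/right rules for $\land,\lor$). Extension variables are new variables distinct from propositional variables. eDT formulas: literals, extension variables, and $(ApB)$ with $A,B$ eDT formulas and $p$ a literal (never an extension variable). eNDT formulas: same plus $(A\lor B)$. Extension axioms $\{e_i\leftrightarrow A_i\}_{i<n}$ require $A_i$ to contain only extension variables among $e_0,\dots,e_{i-1}$, and contribute initial sequents $e_i\to A_i$, $A_i\to e_i$. An ${\mathrm{eLDT}}$ proof is a set of extension axioms (with eDT $A_i$) together with a dag-like derivation of eDT sequents from initial sequents $p\to p$, $p,\overline p\to$, $\to p,\overline p$ and the extension axioms, using contraction, weakening,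 cut, dec-l (from $A,\Gamma\to\Delta,p$ and $p,B,\Gamma\to\Delta$ infer $ApB,\Gamma\to\Delta$) and dec-r (from $\Gamma\to\Delta,A,p$ and $p,\Gamma\to\Delta,B$ infer $\Gamma\to\Delta,ApB$). ${\mathrm{eLNDT}}$ is the same with eNDT formulas plus $\lor$-l (from $A,\Gamma\to\Delta$ and $B,\Gamma\to\Delta$ infer $A\lor B,\Gamma\to\Delta$) and $\lor$-r (from $\Gamma\to\Delta,A,B$ infer $\Gamma\to\Delta,A\lor B$). Size = total size of formulas. For a DT formula $A$: ${\mathrm{Tms}}(p)={\mathrm{Cls}}(p)=\{p\}$; ${\mathrm{Tms}}(BpC)=\{\overline p\land D:D\in{\mathrm{Tms}}(B)\}\cup\{p\land D:D\in{\mathrm{Tms}}(C)\}$; ${\mathrm{Cls}}(BpC)=\{p\lor D:D\in{\mathrm{Cls}}(B)\}\cup\{\overline p\lor D:D\in{\mathrm{Cls}}(C)\}$ (associated right to left); in sequents these multisets are used as cedents. *)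

theory Defs
  imports Complex_Main "HOL-Library.Multiset"
begin

section \<open>Formulas\<close>

datatype literal = Pos nat | Neg nat

fun dual :: "literal \<Rightarrow> literal" where
  "dual (Pos x) = Neg x"
| "dual (Neg x) = Pos x"

text \<open>Boolean formulas, the formulas of LK.\<close>

datatype form = FLit literal | FAnd form form | FOr form form

datatype dt = DLit literal | DDec dt literal dt

text \<open>eNDT formulas. \<open>Dec A p B\<close> is \<open>(ApB)\<close>, i.e. ``if \<open>p\<close> is false then \<open>A\<close>, else \<open>B\<close>'', and
  \<open>Ext i\<close> is the extension variable \<open>e\<^sub>i\<close>.\<close>

datatype endt = Lit literal | Ext nat | Dec endt literal endt | Or endt endt

text \<open>The eDT formulas among the eNDT formulas.\<close>

fun edt :: "endt \<Rightarrow> bool" where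
  "edt (Lit p) \<longleftrightarrow> True"
| "edt (Ext i) \<longleftrightarrow> True"
| "edt (Dec A p B) \<longleftrightarrow> edt A \<and> edt B"
| "edt (Or A B) \<longleftrightarrow> False"

fun exts :: "endt \<Rightarrow> nat set" where
  "exts (Lit p) = {}"
| "exts (Ext i) = {i}"
| "exts (Dec A p B) = exts A \<union> exts B"
| "exts (Or A B) = exts A \<union> exts B"

fun endt_of_dt :: "dt \<Rightarrow> endt" where
  "endt_of_dt (DLit p) = Lit p"
| "endt_of_dt (DDec A p B) = Dec (endt_of_dt A) p (endt_of_dt B)"

fun Tms :: "dt \<Rightarrow> form multiset" where
  "Tms (DLit p) = {# FLit p #}"
| "Tms (DDec B p C) =
     {# FAnd (FLit (dual p)) D. D \<in># Tms B #} + {# FAnd (FLit p) D. D \<in># Tms C #}"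

fun Cls :: "dt \<Rightarrow> form multiset" where
  "Cls (DLit p) = {# FLit p #}"
| "Cls (DDec B p C) =
     {# FOr (FLit p) D. D \<in># Cls B #} + {# FOr (FLit (dual p)) D. D \<in># Cls C #}"

section \<open>Sequent calculi\<close>

text \<open>Cedents are multisets, so there is no exchange rule. A rule relates a list of premises to a
  conclusion; initial sequents are rules without premises.\<close>

type_synonym 'f sequent = "'f multiset \<times> 'f multiset"

inductive base_rule :: "(literal \<Rightarrow> 'f) \<Rightarrow> 'f sequent list \<Rightarrow> 'f sequent \<Rightarrow> bool"
  for L :: "literal \<Rightarrow> 'f" where
  init_id: "base_rule L [] ({# L p #}, {# L p #})"
| init_l: "base_rule L [] ({# L p, L (dual p) #}, {#})"
| init_r: "base_rule L [] ({#}, {# L p, L (dual p) #})"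
| weak_l: "base_rule L [(\<Gamma>, \<Delta>)] (add_mset A \<Gamma>, \<Delta>)"
| weak_r: "base_rule L [(\<Gamma>, \<Delta>)] (\<Gamma>, add_mset A \<Delta>)"
| contr_l: "base_rule L [(add_mset A (add_mset A \<Gamma>), \<Delta>)] (add_mset A \<Gamma>, \<Delta>)"
| contr_r: "base_rule L [(\<Gamma>, add_mset A (add_mset A \<Delta>))] (\<Gamma>, add_mset A \<Delta>)"
| cut: "base_rule L [(\<Gamma>, add_mset A \<Delta>), (add_mset A \<Gamma>, \<Delta>)] (\<Gamma>, \<Delta>)"

inductive lk_rule :: "form sequent list \<Rightarrow> form sequent \<Rightarrow> bool" where
  base: "base_rule FLit ps S \<Longrightarrow> lk_rule ps S"
| and_l: "lk_rule [(add_mset A (add_mset B \<Gamma>), \<Delta>)] (add_mset (FAnd A B) \<Gamma>, \<Delta>)"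
| and_r: "lk_rule [(\<Gamma>, add_mset A \<Delta>), (\<Gamma>, add_mset B \<Delta>)] (\<Gamma>, add_mset (FAnd A B) \<Delta>)"
| or_l: "lk_rule [(add_mset A \<Gamma>, \<Delta>), (add_mset B \<Gamma>, \<Delta>)] (add_mset (FOr A B) \<Gamma>, \<Delta>)"
| or_r: "lk_rule [(\<Gamma>, add_mset A (add_mset B \<Delta>))] (\<Gamma>, add_mset (FOr A B) \<Delta>)"

text \<open>The list \<open>E\<close> holds the right-hand sides of the extension axioms \<open>Ext i \<leftrightarrow> E ! i\<close>.\<close>

definition extension_axioms :: "endt list \<Rightarrow> bool" where
  "extension_axioms E \<longleftrightarrow> (\<forall>i < length E. exts (E ! i) \<subseteq> {..<i})"

inductive eldt_rule :: "endt list \<Rightarrow> endt sequent list \<Rightarrow> endt sequent \<Rightarrow> bool"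
  for E :: "endt list" where
  base: "base_rule Lit ps S \<Longrightarrow> eldt_rule E ps S"
| ext_l: "i < length E \<Longrightarrow> eldt_rule E [] ({# Ext i #}, {# E ! i #})"
| ext_r: "i < length E \<Longrightarrow> eldt_rule E [] ({# E ! i #}, {# Ext i #})"
| dec_l: "eldt_rule E
     [(add_mset A \<Gamma>, add_mset (Lit p) \<Delta>), (add_mset (Lit p) (add_mset B \<Gamma>), \<Delta>)]
     (add_mset (Dec A p B) \<Gamma>, \<Delta>)"
| dec_r: "eldt_rule E
     [(\<Gamma>, add_mset A (add_mset (Lit p) \<Delta>)), (add_mset (Lit p) \<Gamma>, add_mset B \<Delta>)]
     (\<Gamma>, add_mset (Dec A p B) \<Delta>)"

inductive elndt_rule :: "endt list \<Rightarrow> endt sequent list \<Rightarrow> endt sequent \<Rightarrow> bool"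
  for E :: "endt list" where
  eldt: "eldt_rule E ps S \<Longrightarrow> elndt_rule E ps S"
| or_l: "elndt_rule E [(add_mset A \<Gamma>, \<Delta>), (add_mset B \<Gamma>, \<Delta>)] (add_mset (Or A B) \<Gamma>, \<Delta>)"
| or_r: "elndt_rule E [(\<Gamma>, add_mset A (add_mset B \<Delta>))] (\<Gamma>, add_mset (Or A B) \<Delta>)"

text \<open>A dag-like derivation is a sequence of lines, each following by a rule from earlier ones.
  So that a procedure can read and write derivations, the cedents of a line are written down as
  lists; the order of such a list is irrelevant for the rules.\<close>

type_synonym 'f line = "'f list \<times> 'f list"

fun sequent_of :: "'f line \<Rightarrow> 'f sequent" where
  "sequent_of (xs, ys) = (mset xs, mset ys)"

definition derivation ::
    "('f sequent list \<Rightarrow> 'f sequent \<Rightarrow> bool) \<Rightarrow> 'f line list \<Rightarrow> 'f sequent \<Rightarrow> bool" where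
  "derivation rule ls S \<longleftrightarrow>
     (\<forall>i < length ls. \<exists>ps. set ps \<subseteq> sequent_of ` set (take i ls) \<and> rule ps (sequent_of (ls ! i))) \<and>
     ls \<noteq> [] \<and> sequent_of (last ls) = S"

type_synonym lk_proof = "form line list"
type_synonym ext_proof = "endt list \<times> endt line list"

definition is_lk_proof :: "lk_proof \<Rightarrow> form sequent \<Rightarrow> bool" where
  "is_lk_proof \<rho> S \<longleftrightarrow> derivation lk_rule \<rho> S"

fun is_elndt_proof :: "ext_proof \<Rightarrow> endt sequent \<Rightarrow> bool" where
  "is_elndt_proof (E, ls) S \<longleftrightarrow> extension_axioms E \<and> derivation (elndt_rule E) ls S"

fun is_eldt_proof :: "ext_proof \<Rightarrow> endt sequent \<Rightarrow> bool" where
  "is_eldt_proof (E, ls) S \<longleftrightarrow>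
     extension_axioms E \<and> (\<forall>A \<in> set E. edt A) \<and>
     (\<forall>(xs, ys) \<in> set ls. \<forall>A \<in> set xs \<union> set ys. edt A) \<and>
     derivation (eldt_rule E) ls S"

section \<open>Procedures and their running time\<close>

text \<open>Procedures are programs of a call-by-value first-order functional language (a core Lisp)
  over binary trees. A program is a list of function bodies, the first of which is the main
  function; a body is evaluated in the environment of the values of its arguments, which
  \<open>LetIn\<close> extends at the front. Every evaluation step costs one time unit, and reading a
  variable moreover costs the size of the value copied. As a consequence values never become larger
  than the time spent (see \<open>eval_size\<close> below), and the running time agrees with that of
  Turing machines up to polynomials; the notion of quasipolynomial time is therefore the usual
  one.\<close>

datatype tree = Leaf | Node tree tree

fun lft :: "tree \<Rightarrow> tree" where
  "lft Leaf = Leaf"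
| "lft (Node x y) = x"

fun rgt :: "tree \<Rightarrow> tree" where
  "rgt Leaf = Leaf"
| "rgt (Node x y) = y"

datatype expr =
    Var nat
  | MkLeaf
  | MkNode expr expr
  | Lft expr
  | Rgt expr
  | IfLeaf expr expr expr
  | LetIn expr expr
  | Call nat "expr list"

type_synonym prog = "expr list"

inductive eval :: "prog \<Rightarrow> tree list \<Rightarrow> expr \<Rightarrow> tree \<Rightarrow> nat \<Rightarrow> bool"
  and evals :: "prog \<Rightarrow> tree list \<Rightarrow> expr list \<Rightarrow> tree list \<Rightarrow> nat \<Rightarrow> bool"
  for P :: prog where
  var: "i < length env \<Longrightarrow> eval P env (Var i) (env ! i) (1 + size (env ! i))"
| mkleaf: "eval P env MkLeaf Leaf 1"
| mknode: "eval P env a x s \<Longrightarrow> eval P env b y t \<Longrightarrow>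
    eval P env (MkNode a b) (Node x y) (1 + s + t)"
| lft: "eval P env a x s \<Longrightarrow> eval P env (Lft a) (lft x) (1 + s)"
| rgt: "eval P env a x s \<Longrightarrow> eval P env (Rgt a) (rgt x) (1 + s)"
| if_leaf: "eval P env c Leaf s \<Longrightarrow> eval P env a x t \<Longrightarrow>
    eval P env (IfLeaf c a b) x (1 + s + t)"
| if_node: "eval P env c (Node y z) s \<Longrightarrow> eval P env b x t \<Longrightarrow>
    eval P env (IfLeaf c a b) x (1 + s + t)"
| letin: "eval P env a y s \<Longrightarrow> eval P (y # env) b x t \<Longrightarrow>
    eval P env (LetIn a b) x (1 + s + t)"
| call: "evals P env as ys s \<Longrightarrow> f < length P \<Longrightarrow> eval P ys (P ! f) x t \<Longrightarrow>
    eval P env (Call f as) x (1 + s + t)"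
| nil: "evals P env [] [] 0"
| cons: "eval P env a y s \<Longrightarrow> evals P env as ys t \<Longrightarrow> evals P env (a # as) (y # ys) (s + t)"

text \<open>On input \<open>x\<close>, the program \<open>P\<close> halts with output \<open>y\<close> after \<open>t\<close> time units.\<close>

definition runs :: "prog \<Rightarrow> tree \<Rightarrow> tree \<Rightarrow> nat \<Rightarrow> bool" where
  "runs P x y t \<longleftrightarrow> P \<noteq> [] \<and> eval P [x] (hd P) y t"

lemma eval_size:
  "eval P env e x t \<Longrightarrow> size x < t"
  "evals P env es xs t \<Longrightarrow> (\<Sum>x\<leftarrow>xs. size x) \<le> t"
proof (induction rule: eval_evals.inducts)
  case (lft env a x s) then show ?case by (cases x) auto
next
  case (rgt env a x s) then show ?case by (cases x) auto
qed auto

lemma eval_deterministic: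
  "eval P env e x t \<Longrightarrow> eval P env e x' t' \<Longrightarrow> x' = x \<and> t' = t"
  "evals P env es xs t \<Longrightarrow> evals P env es xs' t' \<Longrightarrow> xs' = xs \<and> t' = t"
proof (induction arbitrary: x' t' and xs' t' rule: eval_evals.inducts)
  case var then show ?case by (auto elim: eval.cases)
next
  case mkleaf then show ?case by (auto elim: eval.cases)
next
  case mknode from mknode.prems show ?case by cases (use mknode.IH in blast)
next
  case lft from lft.prems show ?case by cases (use lft.IH in blast)
next
  case rgt from rgt.prems show ?case by cases (use rgt.IH in blast)
next
  case if_leaf from if_leaf.prems show ?case by cases (use if_leaf.IH in blast)+
next
  case if_node from if_node.prems show ?case by cases (use if_node.IH in blast)+
next
  case letin from letin.prems show ?case by cases (use letin.IH in blast)
next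
  case call from call.prems show ?case by cases (use call.IH in blast)
next
  case nil then show ?case by (auto elim: evals.cases)
next
  case cons from cons.prems show ?case by cases (use cons.IH in blast)
qed

text \<open>The functions of growth \<open>2\<^bsup>(log n)\<^bsup>O(1)\<^esup>\<^esup>\<close>.\<close>

definition quasipolynomial :: "(nat \<Rightarrow> nat) \<Rightarrow> bool" where
  "quasipolynomial T \<longleftrightarrow>
     (\<exists>c :: nat. eventually (\<lambda>n. real (T n) \<le> 2 powr (log 2 (real n) ^ c)) sequentially)"

section \<open>Proofs as inputs and outputs\<close>

text \<open>Indices of variables are written in binary, least significant bit first.\<close>

fun enc_nat :: "nat \<Rightarrow> tree" where
  "enc_nat n = (if n = 0 then Leaf
     else Node (if even n then Leaf else Node Leaf Leaf) (enc_nat (n div 2)))"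

declare enc_nat.simps [simp del]

fun enc_list :: "('a \<Rightarrow> tree) \<Rightarrow> 'a list \<Rightarrow> tree" where
  "enc_list enc [] = Leaf"
| "enc_list enc (x # xs) = Node (enc x) (enc_list enc xs)"

fun enc_prod :: "('a \<Rightarrow> tree) \<Rightarrow> ('b \<Rightarrow> tree) \<Rightarrow> 'a \<times> 'b \<Rightarrow> tree" where
  "enc_prod enc1 enc2 (x, y) = Node (enc1 x) (enc2 y)"

fun enc_literal :: "literal \<Rightarrow> tree" where
  "enc_literal (Pos x) = Node (enc_nat 0) (enc_nat x)"
| "enc_literal (Neg x) = Node (enc_nat 1) (enc_nat x)"

fun enc_form :: "form \<Rightarrow> tree" where
  "enc_form (FLit p) = Node (enc_nat 0) (enc_literal p)"
| "enc_form (FAnd A B) = Node (enc_nat 1) (Node (enc_form A) (enc_form B))"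
| "enc_form (FOr A B) = Node (enc_nat 2) (Node (enc_form A) (enc_form B))"

fun enc_endt :: "endt \<Rightarrow> tree" where
  "enc_endt (Lit p) = Node (enc_nat 0) (enc_literal p)"
| "enc_endt (Ext i) = Node (enc_nat 1) (enc_nat i)"
| "enc_endt (Dec A p B) =
     Node (enc_nat 2) (Node (enc_endt A) (Node (enc_literal p) (enc_endt B)))"
| "enc_endt (Or A B) = Node (enc_nat 3) (Node (enc_endt A) (enc_endt B))"

definition enc_lines :: "('f \<Rightarrow> tree) \<Rightarrow> 'f line list \<Rightarrow> tree" where
  "enc_lines enc = enc_list (enc_prod (enc_list enc) (enc_list enc))"

definition enc_lk_proof :: "lk_proof \<Rightarrow> tree" where
  "enc_lk_proof = enc_lines enc_form"

definition enc_ext_proof :: "ext_proof \<Rightarrow> tree" where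
  "enc_ext_proof = enc_prod (enc_list enc_endt) (enc_lines enc_endt)"

lemma enc_nat_inject: "enc_nat m = enc_nat n \<Longrightarrow> m = n"
proof (induction m arbitrary: n rule: less_induct)
  case (less m)
  show ?case
  proof (cases "m = 0 \<or> n = 0")
    case True
    with less.prems show ?thesis
      by (auto simp: enc_nat.simps[of m] enc_nat.simps[of n] split: if_splits)
  next
    case False
    with less.prems have "even m = even n" "enc_nat (m div 2) = enc_nat (n div 2)"
      by (auto simp: enc_nat.simps[of m] enc_nat.simps[of n] split: if_splits)
    with less.IH[of "m div 2"] False have "m div 2 = n div 2" "even m = even n" by auto
    then show ?thesis by (metis dvd_mult_div_cancel odd_two_times_div_two_succ)
  qed
qed

lemma inj_enc_nat: "inj enc_nat"
  by (auto intro: injI enc_nat_inject)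

lemma inj_enc_list: "inj f \<Longrightarrow> inj (enc_list f)"
proof (rule injI)
  fix xs ys assume "inj f" "enc_list f xs = enc_list f ys"
  then show "xs = ys"
  proof (induction xs arbitrary: ys)
    case Nil then show ?case by (cases ys) auto
  next
    case (Cons x xs) then show ?case by (cases ys) (auto dest: injD)
  qed
qed

lemma inj_enc_prod: "inj f \<Longrightarrow> inj g \<Longrightarrow> inj (enc_prod f g)"
  by (rule injI) (auto dest: injD)

lemma inj_enc_literal: "inj enc_literal"
proof (rule injI)
  fix p q :: literal assume "enc_literal p = enc_literal q"
  then show "p = q" by (cases p; cases q) (auto dest: enc_nat_inject)
qed

lemma inj_enc_form: "inj enc_form"
proof (rule injI)
  fix A B :: form assume "enc_form A = enc_form B"
  then show "A = B"
  proof (induction A arbitrary: B)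
    case (FLit p) then show ?case
      by (cases B) (auto dest: enc_nat_inject injD[OF inj_enc_literal])
  next
    case (FAnd A1 A2) then show ?case by (cases B) (auto dest: enc_nat_inject)
  next
    case (FOr A1 A2) then show ?case by (cases B) (auto dest: enc_nat_inject)
  qed
qed

lemma inj_enc_endt: "inj enc_endt"
proof (rule injI)
  fix A B :: endt assume "enc_endt A = enc_endt B"
  then show "A = B"
  proof (induction A arbitrary: B)
    case (Lit p) then show ?case
      by (cases B) (auto dest: enc_nat_inject injD[OF inj_enc_literal])
  next
    case (Ext i) then show ?case by (cases B) (auto dest: enc_nat_inject)
  next
    case (Dec A1 p A2) then show ?case
      by (cases B) (auto dest: enc_nat_inject injD[OF inj_enc_literal])
  next
    case (Or A1 A2) then show ?case by (cases B) (auto dest: enc_nat_inject)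
  qed
qed

lemma inj_enc_lk_proof: "inj enc_lk_proof"
  and inj_enc_ext_proof: "inj enc_ext_proof"
  unfolding enc_lk_proof_def enc_ext_proof_def enc_lines_def
  by (intro inj_enc_list inj_enc_prod inj_enc_form inj_enc_endt)+

text \<open>LK quasipolynomially simulates a system with extension variables, whose proofs are given by
  the predicate \<open>is_proof\<close>.\<close>

definition lk_quasipolynomially_simulates :: "(ext_proof \<Rightarrow> endt sequent \<Rightarrow> bool) \<Rightarrow> bool" where
  "lk_quasipolynomially_simulates is_proof \<longleftrightarrow>
     (\<exists>(P :: prog) (T :: nat \<Rightarrow> nat). quasipolynomial T \<and>
       (\<forall>(\<pi> :: ext_proof) (As :: dt list) (Bs :: dt list).
          is_proof \<pi> (mset (map endt_of_dt As), mset (map endt_of_dt Bs)) \<longrightarrow>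
          (\<exists>(\<rho> :: lk_proof) (t :: nat).
             runs P (enc_ext_proof \<pi>) (enc_lk_proof \<rho>) t \<and>
             t \<le> T (size (enc_ext_proof \<pi>)) \<and>
             is_lk_proof \<rho> (sum_list (map Cls As), sum_list (map Tms Bs)))))"

end

theory Submission
  imports Defs
begin

text \<open>An eNDT formula with extension axioms is a nondeterministic branching program: its nodes are
  the formulas, topologically ordered by the axioms. Reachability between two nodes of an interval
  of this order is expressed by halving the interval and guessing the edge at which a path passes
  from one half to the other; the recursion depth is logarithmic, so these formulas have
  quasipolynomial size. Short LK derivations, in which every sequent has boundedly many formulas
  besides a fixed context, show that they satisfy the defining equivalences of decisions,
  disjunctions and extension variables, and every inference then becomes a few cuts. A program need
  not know these derivations: it closes the set of all such narrow sequents (in the contexts given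
  by the translated lines) under cut, by brute force.\<close>

section \<open>Quasipolynomial bounds and programs\<close>

text \<open>The conclusion demands a program with a time bound, so each function on the way from
  input to output must itself be shown computable. This is why derivations are found by search:
  their construction stays an argument about the saturated set, and the program consists of list
  operations, structural recursions and a loop over possible cuts. The search is affordable because
  the width is constant: with \<open>N\<close> formulas and \<open>c\<close> contexts there are at
  most \<open>c * (N + 1) ^ 16\<close> candidate sequents. The halving is Savitch's, but it splits
  an interval of the topological order instead of the length of a path; edges never lead back, so a
  path crosses the middle at most once. Of the resulting formulas the simulation uses only
  reflexivity and the two directions of the expansion by the first edge. The direction from paths to
  first edges is stated by clauses, because the conjunctions of its disjunctive form need not be
  among the \<open>N\<close> formulas, to which cuts are confined.\<close>

definition qlog :: "nat \<Rightarrow> real" where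
  "qlog n = log 2 (real n + 4)"

text \<open>The shift by 4 makes \<open>qlog n\<close> at least 2 for every \<open>n\<close>. A
  constant factor in the exponent then costs one more power of \<open>qlog n\<close>, and this gives
  all closure properties without exceptions for small \<open>n\<close>.\<close>

definition qbound :: "nat \<Rightarrow> nat \<Rightarrow> real" where
  "qbound k n = 2 powr (qlog n ^ k)"

lemma powr_qlog: "2 powr qlog n = real n + 4"
  by (simp add: qlog_def)

lemma qlog_le: "real n + 4 \<le> 2 powr x \<Longrightarrow> qlog n \<le> x"
  by (simp add: qlog_def log_le_iff)

lemma qlog_mono: "m \<le> n \<Longrightarrow> qlog m \<le> qlog n"
  by (rule qlog_le) (simp add: powr_qlog)

lemma two_le_qlog: "2 \<le> qlog n"
  unfolding qlog_def by (subst le_log_iff) auto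

lemma qlog_power_mono: "j \<le> k \<Longrightarrow> qlog n ^ j \<le> qlog n ^ k"
  using two_le_qlog[of n] by (intro power_increasing) auto

lemma two_qlog_power_le: "2 * qlog n ^ k \<le> qlog n ^ (k + 1)"
  using two_le_qlog[of n] by (simp add: mult_right_mono)

lemma qbound_mono: "j \<le> k \<Longrightarrow> m \<le> n \<Longrightarrow> qbound j m \<le> qbound k n"
proof -
  assume "j \<le> k" "m \<le> n"
  have "qlog m ^ j \<le> qlog n ^ j"
    using \<open>m \<le> n\<close> two_le_qlog[of m] by (intro power_mono qlog_mono) auto
  also have "\<dots> \<le> qlog n ^ k" using \<open>j \<le> k\<close> by (rule qlog_power_mono)
  finally show ?thesis unfolding qbound_def by (intro powr_mono) auto
qed

lemma two_le_qbound: "2 \<le> qbound k n"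
proof -
  have "(2::real) powr 1 \<le> 2 powr (qlog n ^ k)"
    using qlog_power_mono[of 0 k n] by (intro powr_mono) auto
  then show ?thesis by (simp add: qbound_def)
qed

lemma qbound_mult: "qbound j n * qbound k n \<le> qbound (j + k + 1) n"
proof -
  have "qlog n ^ j + qlog n ^ k \<le> 2 * qlog n ^ (j + k)"
    using qlog_power_mono[of j "j + k" n] qlog_power_mono[of k "j + k" n] by linarith
  also have "\<dots> \<le> qlog n ^ (j + k + 1)" by (rule two_qlog_power_le)
  finally show ?thesis
    unfolding qbound_def powr_add[symmetric] by (intro powr_mono) auto
qed

text \<open>Both summands are at least 2, so their sum is at most their product.\<close>

lemma qbound_add: "qbound j n + qbound k n \<le> qbound (j + k + 1) n"
proof -
  have "0 \<le> (qbound j n - 1) * (qbound k n - 1) - 1"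
    using mult_mono[of 1 "qbound j n - 1" 1 "qbound k n - 1"]
      two_le_qbound[of j n] two_le_qbound[of k n] by simp
  then have "qbound j n + qbound k n \<le> qbound j n * qbound k n" by (simp add: algebra_simps)
  with qbound_mult[of j n k] show ?thesis by simp
qed

text \<open>The exponents essentially multiply: \<open>qlog y\<close> is at most
  \<open>2 + qlog n ^ j\<close>, and raising \<open>j\<close> by two absorbs the 2 together with the
  resulting factor.\<close>

lemma qbound_comp:
  assumes "real y \<le> qbound j n"
  shows "qbound k y \<le> qbound ((j + 2) * k) n"
proof -
  have "real y + 4 \<le> 4 * qbound j n" using assms two_le_qbound[of j n] by simp
  also have "\<dots> = 2 powr (2 + qlog n ^ j)" by (simp add: qbound_def powr_add)
  finally have "qlog y \<le> 2 + qlog n ^ j" by (rule qlog_le)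
  also have "\<dots> \<le> 2 * qlog n ^ (j + 1)"
    using two_le_qlog[of n] qlog_power_mono[of j "j + 1" n] qlog_power_mono[of 1 "j + 1" n]
    by (simp only: power_one_right) linarith
  also have "\<dots> \<le> qlog n ^ (j + 2)" using two_qlog_power_le[of n "j + 1"] by simp
  finally have "qlog y ^ k \<le> (qlog n ^ (j + 2)) ^ k"
    using two_le_qlog[of y] by (intro power_mono) auto
  then show ?thesis unfolding qbound_def power_mult by (intro powr_mono) auto
qed

lemma qbound_const: "real c \<le> qbound c n"
proof -
  have "real c \<le> 2 ^ c" by (simp add: less_imp_le)
  also have "\<dots> = 2 powr real c" by (simp add: powr_realpow)
  also have "real c \<le> 2 ^ c" by (simp add: less_imp_le)
  then have "2 powr real c \<le> 2 powr (2 ^ c)" by (intro powr_mono) auto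
  also have "(2::real) ^ c \<le> qlog n ^ c" using two_le_qlog[of n] by (intro power_mono) auto
  then have "2 powr (2 ^ c) \<le> qbound c n" unfolding qbound_def by (intro powr_mono) auto
  finally show ?thesis .
qed

text \<open>For bounds that are functions of the input size; \<open>qpb\<close> is the same notion
  for functions of the input itself.\<close>

definition quasi :: "(nat \<Rightarrow> real) \<Rightarrow> bool" where
  "quasi F \<longleftrightarrow> (\<exists>k. \<forall>n. F n \<le> qbound k n)"

lemma quasi_const: "quasi (\<lambda>n. c)"
proof -
  have "c \<le> real (nat \<lceil>c\<rceil>)" by linarith
  then show ?thesis unfolding quasi_def using qbound_const order_trans by blast
qed

lemma quasi_qbound: "quasi (qbound k)"
  unfolding quasi_def by blast

lemma quasi_add: assumes "quasi F" "quasi G" shows "quasi (\<lambda>n. F n + G n)"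
proof -
  obtain j k where "\<And>n. F n \<le> qbound j n" "\<And>n. G n \<le> qbound k n"
    using assms unfolding quasi_def by blast
  then have "F n + G n \<le> qbound (j + k + 1) n" for n
    using qbound_add[of j n k] by (meson add_mono order_trans)
  then show ?thesis unfolding quasi_def by blast
qed

lemma quasi_mult:
  assumes "quasi F" "quasi G" "\<And>n. 0 \<le> G n" shows "quasi (\<lambda>n. F n * G n)"
proof -
  obtain j k where *: "\<And>n. F n \<le> qbound j n" "\<And>n. G n \<le> qbound k n"
    using assms unfolding quasi_def by blast
  have "F n * G n \<le> qbound (j + k + 1) n" for n
    using qbound_mult[of j n k] mult_mono[OF *(1)[of n] *(2)[of n]] assms(3) two_le_qbound[of j n]
    by auto
  then show ?thesis unfolding quasi_def by blast
qed

lemma quasi_comp: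
  assumes "quasi F"
  shows "quasi (\<lambda>n. qbound k (nat \<lfloor>F n\<rfloor>))"
proof -
  obtain j where j: "\<And>n. F n \<le> qbound j n" using assms unfolding quasi_def by blast
  have "real (nat \<lfloor>F n\<rfloor>) \<le> qbound j n" for n
    using j[of n] two_le_qbound[of j n] by (smt (verit) of_nat_nat of_int_floor_le zero_le_floor nat_eq_iff2 of_nat_0)
  then show ?thesis unfolding quasi_def using qbound_comp by blast
qed

lemma qbound_ident: "real n \<le> qbound 1 n"
  by (simp add: qbound_def powr_qlog)

lemma quasi_ident: "quasi real"
  unfolding quasi_def using qbound_ident by blast

section \<open>Data types as trees\<close>

class encodable =
  fixes enc :: "'a \<Rightarrow> tree"
  assumes inj_enc: "inj enc"

lemma enc_eq_iff [simp]: "enc x = enc y \<longleftrightarrow> x = y"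
  using inj_enc by (auto dest: injD)

abbreviation sz :: "'a :: encodable \<Rightarrow> nat" where "sz x \<equiv> size (enc x)"

instantiation tree :: encodable
begin
definition enc_tree_def [simp]: "enc (x :: tree) = x"
instance by standard (auto intro: injI)
end

instantiation bool :: encodable
begin
definition enc_bool_def: "enc b = (if b then Node Leaf Leaf else Leaf)"
instance by standard (auto intro: injI simp: enc_bool_def split: if_splits)
end

instantiation nat :: encodable
begin
definition enc_nat_class_def: "enc (n :: nat) = enc_nat n"
instance by standard (auto simp: enc_nat_class_def inj_enc_nat[unfolded inj_def] intro: injI enc_nat_inject)
end

instantiation list :: (encodable) encodable
begin
definition enc_list_class_def: "enc = enc_list (enc :: 'a \<Rightarrow> tree)"
instance by standard (simp add: enc_list_class_def inj_enc_list inj_enc)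
end

instantiation prod :: (encodable, encodable) encodable
begin
definition enc_prod_class_def: "enc = enc_prod (enc :: 'a \<Rightarrow> tree) (enc :: 'b \<Rightarrow> tree)"
instance by standard (simp add: enc_prod_class_def inj_enc_prod inj_enc)
end

instantiation option :: (encodable) encodable
begin
definition enc_option_def: "enc x = (case x of None \<Rightarrow> Leaf | Some y \<Rightarrow> Node (enc y) Leaf)"
instance by standard (auto intro: injI simp: enc_option_def split: option.splits)
end

instantiation literal :: encodable
begin
definition enc_literal_class_def: "enc = enc_literal"
instance by standard (simp add: enc_literal_class_def inj_enc_literal)
end

instantiation form :: encodable
begin
definition enc_form_class_def: "enc = enc_form"
instance by standard (simp add: enc_form_class_def inj_enc_form)
end

instantiation endt :: encodable
begin
definition enc_endt_class_def: "enc = enc_endt"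
instance by standard (simp add: enc_endt_class_def inj_enc_endt)
end

lemma enc_simps [simp]:
  "enc [] = Leaf" "enc (x # xs) = Node (enc x) (enc xs)"
  "enc (a, b) = Node (enc a) (enc b)"
  "enc True = Node Leaf Leaf" "enc False = Leaf"
  "enc None = Leaf" "enc (Some x) = Node (enc x) Leaf"
  "enc (Pos n) = Node Leaf (enc n)" "enc (Neg n) = Node (Node (Node Leaf Leaf) Leaf) (enc n)"
  "enc (FLit p) = Node Leaf (enc p)"
  "enc (FAnd A B) = Node (Node (Node Leaf Leaf) Leaf) (Node (enc A) (enc B))"
  "enc (FOr A B) = Node (Node Leaf (Node (Node Leaf Leaf) Leaf)) (Node (enc A) (enc B))"
  "enc (Lit p) = Node Leaf (enc p)"
  "enc (Ext n) = Node (Node (Node Leaf Leaf) Leaf) (enc n)"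
  "enc (Dec C p D) = Node (Node Leaf (Node (Node Leaf Leaf) Leaf))
     (Node (enc C) (Node (enc p) (enc D)))"
  "enc (Or C D) = Node (Node (Node Leaf Leaf) (Node (Node Leaf Leaf) Leaf)) (Node (enc C) (enc D))"
  by (simp_all add: enc_list_class_def enc_prod_class_def enc_bool_def enc_option_def
      enc_literal_class_def enc_form_class_def enc_endt_class_def enc_nat_class_def enc_nat.simps)

text \<open>A program part \<open>R\<close> may be placed at position \<open>n\<close> of any program, so that parts can be
  combined by concatenation without renumbering calls.\<close>

definition impl :: "nat \<Rightarrow> nat \<Rightarrow> prog \<Rightarrow> expr \<Rightarrow> ('a :: encodable \<Rightarrow> 'b :: encodable) \<Rightarrow> bool" where
  "impl k n R e f \<longleftrightarrow> (\<forall>Q S x env. length Q = n \<longrightarrow>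
     (\<exists>t. eval (Q @ R @ S) (enc x # env) e (enc (f x)) t \<and> real t \<le> qbound k (sz x)))"

text \<open>The exponent \<open>k\<close> is uniform in the position \<open>n\<close>, so parts can
  be moved behind one another without a change of the bound.\<close>

definition qp :: "('a :: encodable \<Rightarrow> 'b :: encodable) \<Rightarrow> bool" where
  "qp f \<longleftrightarrow> (\<exists>k. \<forall>n. \<exists>R e. impl k n R e f)"

definition qpb :: "('a :: encodable \<Rightarrow> nat) \<Rightarrow> bool" where
  "qpb f \<longleftrightarrow> (\<exists>k. \<forall>x. real (f x) \<le> qbound k (sz x))"

lemma impl_mono: "impl k n R e f \<Longrightarrow> k \<le> k' \<Longrightarrow> impl k' n R e f"
  unfolding impl_def using qbound_mono[OF _ order_refl, of k k'] order_trans by metis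

lemma impl_ext_r: "impl k n R e f \<Longrightarrow> impl k n (R @ R') e f"
  unfolding impl_def by simp

lemma impl_ext_l:
  assumes "impl k (n + length R) R' e f"
  shows "impl k n (R @ R') e f"
  unfolding impl_def
proof (intro allI impI)
  fix Q S :: prog and x env assume "length Q = n"
  with assms[unfolded impl_def, rule_format, of "Q @ R" S x env]
  show "\<exists>t. eval (Q @ (R @ R') @ S) (enc x # env) e (enc (f x)) t \<and> real t \<le> qbound k (sz x)"
    by simp
qed

lemma qpI: "(\<And>n. \<exists>R e. impl k n R e f) \<Longrightarrow> qp f"
  unfolding qp_def by blast

lemma qpb_const: "qpb (\<lambda>x. c)"
  unfolding qpb_def using qbound_const by blast

lemma qpb_add: assumes "qpb f" "qpb g" shows "qpb (\<lambda>x. f x + g x)"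
proof -
  obtain j k where "\<And>x. real (f x) \<le> qbound j (sz x)" "\<And>x. real (g x) \<le> qbound k (sz x)"
    using assms unfolding qpb_def by blast
  then have "real (f x + g x) \<le> qbound (j + k + 1) (sz x)" for x
    using qbound_add[of j "sz x" k]
    by (smt (verit) of_nat_add)
  then show ?thesis unfolding qpb_def by blast
qed

lemma qpb_mult: assumes "qpb f" "qpb g" shows "qpb (\<lambda>x. f x * g x)"
proof -
  obtain j k where *: "\<And>x. real (f x) \<le> qbound j (sz x)" "\<And>x. real (g x) \<le> qbound k (sz x)"
    using assms unfolding qpb_def by blast
  have "real (f x * g x) \<le> qbound (j + k + 1) (sz x)" for x
    using qbound_mult[of j "sz x" k] mult_mono[OF *(1)[of x] *(2)[of x]]
      two_le_qbound[of j "sz x"] by simp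
  then show ?thesis unfolding qpb_def by blast
qed

lemma qpb_le: "qpb g \<Longrightarrow> (\<And>x. f x \<le> g x) \<Longrightarrow> qpb f"
  unfolding qpb_def by (meson of_nat_mono order_trans)

lemma qpb_size: "qpb (\<lambda>x. sz x)"
  unfolding qpb_def using qbound_ident by blast

text \<open>A value is smaller than the time spent on it (\<open>eval_size\<close>), so time bounds
  are size bounds.\<close>

lemma qp_size:
  assumes "qp f"
  shows "qpb (\<lambda>x. sz (f x))"
proof -
  obtain k where k: "\<And>n. \<exists>R e. impl k n R e f" using assms unfolding qp_def by blast
  obtain R e where R: "impl k 0 R e f" using k by blast
  have "real (sz (f x)) \<le> qbound k (sz x)" for x
  proof -
    obtain t where "eval ([] @ R @ []) (enc x # []) e (enc (f x)) t" "real t \<le> qbound k (sz x)"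
      using R unfolding impl_def by (metis list.size(3))
    then show ?thesis using eval_size(1) by fastforce
  qed
  then show ?thesis unfolding qpb_def by blast
qed

lemma qpb_comp:
  assumes "qpb b" "qp f"
  shows "qpb (\<lambda>x. b (f x))"
proof -
  obtain j where j: "\<And>y. real (b y) \<le> qbound j (sz y)" using assms(1) unfolding qpb_def by blast
  obtain k where k: "\<And>x. real (sz (f x)) \<le> qbound k (sz x)"
    using qp_size[OF assms(2)] unfolding qpb_def by blast
  have "real (b (f x)) \<le> qbound ((k + 2) * j) (sz x)" for x
    using j[of "f x"] qbound_comp[OF k[of x], of j] by linarith
  then show ?thesis unfolding qpb_def by blast
qed

text \<open>\<open>LetIn\<close> makes the intermediate value the first variable. Since
  \<open>impl\<close> allows an arbitrary rest of the environment, \<open>e'\<close> is used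
  unchanged.\<close>

lemma impl_comp:
  assumes f: "impl j n R e f" and g: "impl k n R e' g"
  shows "impl (j + (j + 2) * k + 3) n R (LetIn e e') (\<lambda>x. g (f x))"
  unfolding impl_def
proof (intro allI impI)
  fix Q S :: prog and x env assume Q: "length Q = n"
  obtain s where s: "eval (Q @ R @ S) (enc x # env) e (enc (f x)) s" "real s \<le> qbound j (sz x)"
    using f Q unfolding impl_def by blast
  obtain t where t: "eval (Q @ R @ S) (enc (f x) # enc x # env) e' (enc (g (f x))) t"
    "real t \<le> qbound k (sz (f x))"
    using g Q unfolding impl_def by blast
  have "real (sz (f x)) \<le> qbound j (sz x)"
    using eval_size(1)[OF s(1)] s(2) by simp
  from qbound_comp[OF this, of k] t(2)
  have "real t \<le> qbound ((j + 2) * k) (sz x)" by linarith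
  moreover have "1 \<le> qbound 1 (sz x)" using two_le_qbound[of 1 "sz x"] by simp
  ultimately have "real (1 + s + t) \<le> qbound (j + (j + 2) * k + 3) (sz x)"
    using s(2) qbound_add[of "j + (j + 2) * k + 1" "sz x" 1]
      qbound_add[of j "sz x" "(j + 2) * k"] by (simp add: eval_nat_numeral)
  with eval_evals.letin[OF s(1) t(1)] show "\<exists>t. eval (Q @ R @ S) (enc x # env) (LetIn e e') (enc (g (f x))) t \<and>
      real t \<le> qbound (j + (j + 2) * k + 3) (sz x)" by blast
qed

lemma impl_pair:
  assumes f: "impl j n R e f" and g: "impl k n R e' g"
  shows "impl (j + k + 3) n R (MkNode e e') (\<lambda>x. (f x, g x))"
  unfolding impl_def
proof (intro allI impI)
  fix Q S :: prog and x env assume Q: "length Q = n"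
  obtain s where s: "eval (Q @ R @ S) (enc x # env) e (enc (f x)) s" "real s \<le> qbound j (sz x)"
    using f Q unfolding impl_def by blast
  obtain t where t: "eval (Q @ R @ S) (enc x # env) e' (enc (g x)) t" "real t \<le> qbound k (sz x)"
    using g Q unfolding impl_def by blast
  have "1 \<le> qbound 1 (sz x)" using two_le_qbound[of 1 "sz x"] by simp
  then have "real (1 + s + t) \<le> qbound (j + k + 3) (sz x)"
    using s(2) t(2) qbound_add[of "j + k + 1" "sz x" 1]
      qbound_add[of j "sz x" k] by (simp add: eval_nat_numeral)
  with eval_evals.mknode[OF s(1) t(1)] show "\<exists>t. eval (Q @ R @ S) (enc x # env) (MkNode e e') (enc (f x, g x)) t \<and>
      real t \<le> qbound (j + k + 3) (sz x)" by auto
qed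

lemma impl_if:
  assumes c: "impl i n R c' (c :: 'a :: encodable \<Rightarrow> tree)" and f: "impl j n R e f" and g: "impl k n R e' g"
  shows "impl (i + j + k + 3) n R (IfLeaf c' e' e) (\<lambda>x. if c x = Leaf then g x else f x)"
  unfolding impl_def
proof (intro allI impI)
  fix Q S :: prog and x env assume Q: "length Q = n"
  obtain r where r: "eval (Q @ R @ S) (enc x # env) c' (c x) r" "real r \<le> qbound i (sz x)"
    using c Q unfolding impl_def by (metis enc_tree_def)
  obtain s where s: "eval (Q @ R @ S) (enc x # env) e (enc (f x)) s" "real s \<le> qbound j (sz x)"
    using f Q unfolding impl_def by blast
  obtain t where t: "eval (Q @ R @ S) (enc x # env) e' (enc (g x)) t" "real t \<le> qbound k (sz x)"
    using g Q unfolding impl_def by blast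
  let ?n = "sz x"
  have 1: "1 \<le> qbound 1 ?n" using two_le_qbound[of 1 ?n] by simp
  show "\<exists>t. eval (Q @ R @ S) (enc x # env) (IfLeaf c' e' e) (enc (if c x = Leaf then g x else f x)) t \<and>
      real t \<le> qbound (i + j + k + 3) ?n"
  proof (cases "c x")
    case (Node y z)
    with r(1) have "eval (Q @ R @ S) (enc x # env) (IfLeaf c' e' e) (enc (if c x = Leaf then g x else f x)) (1 + r + s)"
      using eval_evals.if_node[OF _ s(1)] by simp
    moreover have "real (1 + r + s) \<le> qbound (i + j + k + 3) ?n"
      using 1 r(2) s(2) qbound_add[of i ?n j] qbound_add[of "i + j + 1" ?n 1]
        qbound_mono[of "i + j + 3" "i + j + k + 3" ?n ?n] by (simp add: eval_nat_numeral)
    ultimately show ?thesis by blast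
  next
    case Leaf
    with r(1) have "eval (Q @ R @ S) (enc x # env) (IfLeaf c' e' e) (enc (if c x = Leaf then g x else f x)) (1 + r + t)"
      using eval_evals.if_leaf[OF _ t(1)] by simp
    moreover have "real (1 + r + t) \<le> qbound (i + j + k + 3) ?n"
      using 1 r(2) t(2) qbound_add[of i ?n k] qbound_add[of "i + k + 1" ?n 1]
        qbound_mono[of "i + k + 3" "i + j + k + 3" ?n ?n] by (simp add: eval_nat_numeral)
    ultimately show ?thesis by blast
  qed
qed

text \<open>The part for \<open>g\<close> is placed directly behind the part for \<open>f\<close>,
  so that both expressions run in one program with a common exponent.\<close>

lemma impl2:
  assumes "qp f" "qp g"
  obtains k where "\<And>n. \<exists>R e e'. impl k n R e f \<and> impl k n R e' g"
proof -
  obtain i j where i: "\<And>n. \<exists>R e. impl i n R e f" and j: "\<And>n. \<exists>R e. impl j n R e g"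
    using assms unfolding qp_def by blast
  have "\<exists>R e e'. impl (max i j) n R e f \<and> impl (max i j) n R e' g" for n
  proof -
    obtain R e where R: "impl i n R e f" using i by blast
    obtain R' e' where R': "impl j (n + length R) R' e' g" using j by blast
    have "impl (max i j) n (R @ R') e f" "impl (max i j) n (R @ R') e' g"
      using impl_mono[OF impl_ext_r[OF R]] impl_mono[OF impl_ext_l[OF R']] by simp_all
    then show ?thesis by blast
  qed
  then show thesis by (rule that)
qed

lemma impl3:
  assumes "qp f" "qp g" "qp h"
  obtains k where "\<And>n. \<exists>R e e' e''. impl k n R e f \<and> impl k n R e' g \<and> impl k n R e'' h"
proof -
  obtain i where i: "\<And>n. \<exists>R e e'. impl i n R e f \<and> impl i n R e' g" using impl2[OF assms(1,2)] by blast
  obtain j where j: "\<And>n. \<exists>R e. impl j n R e h" using assms(3) unfolding qp_def by blast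
  have "\<exists>R e e' e''. impl (max i j) n R e f \<and> impl (max i j) n R e' g \<and> impl (max i j) n R e'' h" for n
  proof -
    obtain R e e' where R: "impl i n R e f" "impl i n R e' g" using i by blast
    obtain R' e'' where R': "impl j (n + length R) R' e'' h" using j by blast
    have "impl (max i j) n (R @ R') e f" "impl (max i j) n (R @ R') e' g" "impl (max i j) n (R @ R') e'' h"
      using impl_mono[OF impl_ext_r[OF R(1)]] impl_mono[OF impl_ext_r[OF R(2)]]
        impl_mono[OF impl_ext_l[OF R']] by simp_all
    then show ?thesis by blast
  qed
  then show thesis by (rule that)
qed

section \<open>Closure properties of quasipolynomial time functions\<close>

named_theorems qp_intros

lemma qp_comp: assumes "qp g" "qp f" shows "qp (\<lambda>x. g (f x))"
proof -
  obtain k where "\<And>n. \<exists>R e e'. impl k n R e f \<and> impl k n R e' g" using impl2[OF assms(2,1)] by blast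
  then show ?thesis by (intro qpI) (use impl_comp in blast)
qed

lemma qp_pair [qp_intros]: assumes "qp f" "qp g" shows "qp (\<lambda>x. (f x, g x))"
proof -
  obtain k where "\<And>n. \<exists>R e e'. impl k n R e f \<and> impl k n R e' g" using impl2[OF assms] by blast
  then show ?thesis by (intro qpI) (use impl_pair in blast)
qed

lemma qp_if_Leaf:
  assumes "qp c" "qp f" "qp g"
  shows "qp (\<lambda>x. if c x = Leaf then g x else f x)"
proof -
  obtain k where "\<And>n. \<exists>R e e' e''. impl k n R e c \<and> impl k n R e' f \<and> impl k n R e'' g"
    using impl3[OF assms] by blast
  then show ?thesis by (intro qpI) (use impl_if in blast)
qed

text \<open>Programs see only encodings: one program serves all functions with the same encoded
  inputs and outputs. Constructors and selectors of the data types are obtained from tree operations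
  in this way.\<close>

lemma qp_via:
  assumes "qp F" and "\<And>x. enc (F (r x)) = enc (f x)" and "\<And>x. enc (r x) = enc x"
  shows "qp f"
  using assms(1) unfolding qp_def impl_def by (metis assms(2,3))

lemma qp_tree: "qp (F :: tree \<Rightarrow> tree) \<Longrightarrow> (\<And>x. F (enc x) = enc (f x)) \<Longrightarrow> qp f"
  using qp_via[of F enc f] by simp

lemma qp_id [qp_intros]: "qp (\<lambda>x. x)"
proof -
  have "impl 2 n [] (Var 0) (\<lambda>x :: 'a. x)" for n
    unfolding impl_def
  proof (intro allI impI)
    fix Q S :: prog and x :: 'a and env
    have "real (1 + sz x) \<le> qbound 2 (sz x)"
      using qbound_ident[of "sz x"] qbound_mono[of 1 2 "sz x" "sz x"]
        qbound_add[of 0 "sz x" 1] two_le_qbound[of 0 "sz x"]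
      by (simp add: eval_nat_numeral)
    then show "\<exists>t. eval (Q @ [] @ S) (enc x # env) (Var 0) (enc x) t \<and> real t \<le> qbound 2 (sz x)"
      using eval_evals.var[of 0 "enc x # env"] by fastforce
  qed
  then show ?thesis unfolding qp_def by blast
qed

primrec texp :: "tree \<Rightarrow> expr" where
  "texp Leaf = MkLeaf"
| "texp (Node x y) = MkNode (texp x) (texp y)"

lemma eval_texp: "eval P env (texp c) c (2 * size c + 1)"
proof (induction c)
  case Leaf show ?case using eval_evals.mkleaf by simp
next
  case (Node x y) from eval_evals.mknode[OF Node] show ?case by (simp add: algebra_simps)
qed

lemma qp_const [qp_intros]: "qp (\<lambda>x. c)"
proof -
  have "impl (2 * sz c + 1) n [] (texp (enc c)) (\<lambda>x :: 'a. c)" for n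
    unfolding impl_def using eval_texp qbound_const by blast
  then show ?thesis unfolding qp_def by blast
qed

lemma qp_lft_rgt: "qp lft" "qp rgt"
proof -
  obtain k where k: "\<And>n. \<exists>R e. impl k n R e (\<lambda>x :: tree. x)" using qp_id unfolding qp_def by blast
  have "impl (k + 2) n R (Lft e) lft \<and> impl (k + 2) n R (Rgt e) rgt" if e: "impl k n R e (\<lambda>x :: tree. x)" for n R e
  proof -
    have "\<exists>s t. eval (Q @ R @ S) (x # env) (Lft e) (lft x) s \<and> real s \<le> qbound (k + 2) (size x) \<and>
       eval (Q @ R @ S) (x # env) (Rgt e) (rgt x) t \<and> real t \<le> qbound (k + 2) (size x)"
      if Q: "length Q = n" for Q S :: prog and x env
    proof -
      obtain t where t: "eval (Q @ R @ S) (x # env) e x t" "real t \<le> qbound k (size x)"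
        using e Q unfolding impl_def enc_tree_def by blast
      have "real (1 + t) \<le> qbound (k + 2) (size x)"
        using t(2) qbound_add[of k "size x" 1] two_le_qbound[of 1 "size x"]  by (simp add: eval_nat_numeral)
      then show ?thesis using eval_evals.lft[OF t(1)] eval_evals.rgt[OF t(1)] by blast
    qed
    then show ?thesis unfolding impl_def enc_tree_def by blast
  qed
  then show "qp lft" "qp rgt" by (intro qpI; use k in blast)+
qed

lemma qp_lft [qp_intros]: "qp f \<Longrightarrow> qp (\<lambda>x. lft (f x))"
  and qp_rgt [qp_intros]: "qp f \<Longrightarrow> qp (\<lambda>x. rgt (f x))"
  using qp_comp qp_lft_rgt by blast+

lemma qp_Node [qp_intros]: "qp f \<Longrightarrow> qp g \<Longrightarrow> qp (\<lambda>x. Node (f x) (g x))"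
  by (rule qp_via[OF qp_pair, of f g "\<lambda>x. x"]) auto

lemma qp_fst [qp_intros]: "qp f \<Longrightarrow> qp (\<lambda>x. fst (f x))"
  by (rule qp_comp[of fst, OF qp_tree[OF qp_lft[OF qp_id]]]) auto

lemma qp_snd [qp_intros]: "qp f \<Longrightarrow> qp (\<lambda>x. snd (f x))"
  by (rule qp_comp[of snd, OF qp_tree[OF qp_rgt[OF qp_id]]]) auto

lemma qp_enc [qp_intros]: "qp f \<Longrightarrow> qp (\<lambda>x. enc (f x))"
  by (rule qp_via[of f "\<lambda>x. x"]) auto

lemma qp_Cons [qp_intros]: "qp f \<Longrightarrow> qp g \<Longrightarrow> qp (\<lambda>x. f x # g x)"
  by (rule qp_via[OF qp_pair, of f g "\<lambda>x. x"]) auto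

lemma qp_Some [qp_intros]: "qp f \<Longrightarrow> qp (\<lambda>x. Some (f x))"
  by (rule qp_via[OF qp_Node[OF qp_enc qp_const], of f "\<lambda>x. x" Leaf]) auto

lemma qp_if [qp_intros]:
  assumes "qp c" "qp f" "qp g"
  shows "qp (\<lambda>x. if c x then f x else g x)"
proof -
  have "(if enc (c x) = Leaf then g x else f x) = (if c x then f x else g x)" for x
    by (cases "c x") auto
  with qp_if_Leaf[OF qp_enc[OF assms(1)] assms(2,3)] show ?thesis by simp
qed

lemma qp_cong: "qp f \<Longrightarrow> (\<And>x. f x = g x) \<Longrightarrow> qp g"
  using ext[of f g] by simp

lemma qp_is_Leaf [qp_intros]: "qp f \<Longrightarrow> qp (\<lambda>x. f x = Leaf)"
  by (rule qp_cong[OF qp_if_Leaf[OF _ qp_const qp_const], of f True False]) auto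

lemma qp_not [qp_intros]: "qp f \<Longrightarrow> qp (\<lambda>x. \<not> f x)"
  by (rule qp_cong[OF qp_if[OF _ qp_const qp_const], of f False True]) auto

lemma qp_conj [qp_intros]: "qp f \<Longrightarrow> qp g \<Longrightarrow> qp (\<lambda>x. f x \<and> g x)"
  by (rule qp_cong[OF qp_if[OF _ _ qp_const], of f g False]) auto

lemma qp_disj [qp_intros]: "qp f \<Longrightarrow> qp g \<Longrightarrow> qp (\<lambda>x. f x \<or> g x)"
  by (rule qp_cong[OF qp_if[OF _ qp_const], of f g True]) auto

lemma qp_is_Nil [qp_intros]: "qp f \<Longrightarrow> qp (\<lambda>x. f x = [])"
proof (rule qp_cong[OF qp_is_Leaf[OF qp_enc], of f])
  show "(enc (f x) = Leaf) = (f x = [])" for x by (cases "f x") auto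
qed

text \<open>The value of \<open>hd []\<close> is a constant that a program may contain.\<close>

lemma qp_hd [qp_intros]: assumes "qp f" shows "qp (\<lambda>x. hd (f x))"
proof (rule qp_comp[of hd, OF _ assms], rule qp_tree)
  show "qp (\<lambda>t. if t = Leaf then enc (hd [] :: 'b) else lft t)" by (intro qp_intros)
  show "(if enc x = Leaf then enc (hd [] :: 'b) else lft (enc x)) = enc (hd x)" for x :: "'b list"
    by (cases x) auto
qed

lemma qp_tl [qp_intros]: assumes "qp f" shows "qp (\<lambda>x. tl (f x))"
proof (rule qp_comp[of tl, OF _ assms], rule qp_tree)
  show "qp rgt" by (rule qp_lft_rgt)
  show "rgt (enc x) = enc (tl x)" for x :: "'b list" by (cases x) auto
qed

lemma qp_list_case:
  assumes "qp l" "qp f" "qp (\<lambda>p. g (fst p) (fst (snd p)) (snd (snd p)))"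
  shows "qp (\<lambda>x. case l x of [] \<Rightarrow> f x | h # t \<Rightarrow> g x h t)"
proof (rule qp_cong)
  show "qp (\<lambda>x. if l x = [] then f x else g x (hd (l x)) (tl (l x)))"
    using qp_comp[OF assms(3) qp_pair[OF qp_id qp_pair[OF qp_hd qp_tl]], OF assms(1,1)]
    by (intro qp_intros assms) simp
qed (auto split: list.split)

text \<open>The measure \<open>m\<close> bounds the number of calls.\<close>

lemma qp_rec:
  fixes h :: "'a :: encodable \<Rightarrow> 'b :: encodable"
  assumes lf: "qp lf" and a: "qp a" and l: "qp l" and r: "qp r"
    and g: "qp (\<lambda>p. g (fst p) (fst (snd p)) (snd (snd p)))"
    and h: "\<And>x. h x = (if lf x then a x else g x (h (l x)) (h (r x)))"
    and m: "qpb m" "\<And>x. 0 < m x" "\<And>x. \<not> lf x \<Longrightarrow> m (l x) + m (r x) \<le> m x"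
    and le: "\<And>x. \<not> lf x \<Longrightarrow> sz (l x) \<le> sz x"
      "\<And>x. \<not> lf x \<Longrightarrow> sz (r x) \<le> sz x"
    and b: "qpb (\<lambda>x. sz (h x))"
  shows "qp h"
proof -
  let ?g = "\<lambda>p. g (fst p) (fst (snd p)) (snd (snd p))"
  obtain k1 where k1: "\<And>n. \<exists>R e e' e''. impl k1 n R e lf \<and> impl k1 n R e' l \<and> impl k1 n R e'' r"
    using impl3[OF lf l r] by blast
  obtain k2 where k2: "\<And>n. \<exists>R e e'. impl k2 n R e a \<and> impl k2 n R e' ?g"
    using impl2[OF a g] by blast
  obtain kb where kb: "\<And>x. real (sz (h x)) \<le> qbound kb (sz x)"
    using b unfolding qpb_def by blast
  obtain km where km: "\<And>x. real (m x) \<le> qbound km (sz x)"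
    using m(1) unfolding qpb_def by blast
  \<comment> \<open>\<open>C N\<close> bounds the work of one call apart from its recursive calls.
    The test and the two arguments cost \<open>qbound k1 N\<close> each, a leaf
    \<open>qbound k2 N\<close>, reading the argument \<open>N\<close>; the last summand is the
    combining step, whose input consists of the argument and two values of size at most
    \<open>qbound kb N\<close>.\<close>
  define C where "C N = 10 + 10 * qbound k1 N + qbound k2 N + real N +
    qbound k2 (nat \<lfloor>2 + real N + 2 * qbound kb N\<rfloor>)" for N
  have pos: "0 \<le> qbound k N" for k N using two_le_qbound[of k N] by simp
  have C0: "0 \<le> C N" for N using pos by (simp add: C_def)
  have "quasi C" unfolding C_def
    by (intro quasi_add quasi_mult quasi_comp quasi_const quasi_qbound quasi_ident pos)
  then have "quasi (\<lambda>N. 2 + real N + 2 * qbound km N * C N)"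
    by (intro quasi_add quasi_mult quasi_const quasi_qbound quasi_ident pos C0)
  then obtain k where k: "\<And>N. 2 + real N + 2 * qbound km N * C N \<le> qbound k N"
    unfolding quasi_def by blast
  have "\<exists>R e. impl k n R e h" for n
  proof -
    obtain R1 e1 el er where R1: "impl k1 n R1 e1 lf" "impl k1 n R1 el l" "impl k1 n R1 er r"
      using k1 by blast
    obtain R2 ea eg where R2: "impl k2 (n + length R1) R2 ea a" "impl k2 (n + length R1) R2 eg ?g"
      using k2 by blast
    \<comment> \<open>The body \<open>B\<close> stands behind both auxiliary parts and calls itself
      by this absolute position.\<close>
    define f where "f = n + length R1 + length R2"
    define B where "B = IfLeaf e1
      (LetIn (MkNode (Var 0) (MkNode (Call f [el]) (Call f [er]))) eg) ea"
    have Bt: "eval P env B x (1 + s + t)"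
      if "eval P env e1 (Node Leaf Leaf) s" "eval P env ea x t" for P env x s t
      unfolding B_def using that by (rule eval_evals.if_node)
    have Bf: "eval P env B x (1 + s + t)"
      if "eval P env e1 Leaf s"
        "eval P env (LetIn (MkNode (Var 0) (MkNode (Call f [el]) (Call f [er]))) eg) x t" for P env x s t
      unfolding B_def using that by (rule eval_evals.if_leaf)
    let ?R = "(R1 @ R2) @ [B]"
    have i: "impl k1 n ?R e1 lf" "impl k1 n ?R el l" "impl k1 n ?R er r" "impl k2 n ?R ea a" "impl k2 n ?R eg ?g"
      using R1 R2 by (simp_all only: impl_ext_r impl_ext_l)
    have "\<exists>t. eval (Q @ ?R @ S) (enc x # env) (Call f [Var 0]) (enc (h x)) t \<and>
        real t \<le> qbound k (sz x)" if Q: "length Q = n" for Q S x env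
    proof -
      let ?P = "Q @ ?R @ S"
      have f: "f < length ?P" "?P ! f = B" using Q by (auto simp: f_def nth_append)
      define N where "N = sz x"
      \<comment> \<open>The call tree is binary with at most \<open>m y\<close> leaves, hence has at
        most \<open>2 * m y - 1\<close> nodes, and each of them costs at most
        \<open>C N\<close>.\<close>
      have "\<exists>t. eval ?P [enc y] B (enc (h y)) t \<and> real t \<le> (2 * real (m y) - 1) * C N"
        if "sz y \<le> N" for y
        using that
      proof (induction "m y" arbitrary: y rule: less_induct)
        case less
        obtain t1 where t1: "eval ?P [enc y] e1 (enc (lf y)) t1" "real t1 \<le> qbound k1 (sz y)"
          using i(1) Q unfolding impl_def by blast
        have t1': "real t1 \<le> qbound k1 N" using t1(2) qbound_mono[OF order_refl less.prems, of k1] by linarith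
        show ?case
        proof (cases "lf y")
          case True
          obtain t where t: "eval ?P [enc y] ea (enc (a y)) t" "real t \<le> qbound k2 (sz y)"
            using i(4) Q unfolding impl_def by blast
          have "eval ?P [enc y] B (enc (h y)) (1 + t1 + t)"
            using Bt[OF _ t(1)] True t1(1) h[of y] by simp
          moreover have "real (1 + t1 + t) \<le> C N"
            using t1' t(2) qbound_mono[OF order_refl less.prems, of k2] pos[of k1 N]
              pos[of k2 "nat \<lfloor>2 + real N + 2 * qbound kb N\<rfloor>"]
            by (simp add: C_def)
          moreover have "C N \<le> (2 * real (m y) - 1) * C N"
            using m(2)[of y] mult_right_mono[OF _ C0, of 1 "2 * real (m y) - 1"] by simp
          ultimately show ?thesis by (meson order_trans)
        next
          case False
          have lt: "m (l y) < m y" "m (r y) < m y" using m(3)[OF False] m(2)[of "l y"] m(2)[of "r y"] by auto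
          obtain t2 where t2: "eval ?P [enc y] el (enc (l y)) t2" "real t2 \<le> qbound k1 (sz y)"
            using i(2) Q unfolding impl_def by blast
          obtain t3 where t3: "eval ?P [enc y] er (enc (r y)) t3" "real t3 \<le> qbound k1 (sz y)"
            using i(3) Q unfolding impl_def by blast
          obtain t4 where t4: "eval ?P [enc (l y)] B (enc (h (l y))) t4" "real t4 \<le> (2 * real (m (l y)) - 1) * C N"
            using less.hyps[OF lt(1)] le(1)[OF False] less.prems by fastforce
          obtain t5 where t5: "eval ?P [enc (r y)] B (enc (h (r y))) t5" "real t5 \<le> (2 * real (m (r y)) - 1) * C N"
            using less.hyps[OF lt(2)] le(2)[OF False] less.prems by fastforce
          let ?p = "(y, h (l y), h (r y))"
          obtain t6 where t6: "eval ?P [enc ?p, enc y] eg (enc (g y (h (l y)) (h (r y)))) t6"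
            "real t6 \<le> qbound k2 (sz ?p)"
            using i(5)[unfolded impl_def, rule_format, OF Q, of S ?p "[enc y]"] by auto
          have call: "eval ?P [enc y] (Call f [e]) v (1 + (s + 0) + t)"
            if "eval ?P [enc y] e z s" "eval ?P [z] B v t" for e z v s t
            using eval_evals.call[OF eval_evals.cons[OF that(1) eval_evals.nil] f(1)] that(2) f(2) by simp
          have v: "eval ?P [enc y] (Var 0) (enc y) (1 + sz y)"
            using eval_evals.var[of 0 "[enc y]"] by simp
          have "eval ?P [enc y] B (enc (h y)) (1 + t1 + (1 + (1 + (1 + sz y) +
              (1 + (1 + (t2 + 0) + t4) + (1 + (t3 + 0) + t5))) + t6))"
            using Bf[OF _ eval_evals.letin[OF eval_evals.mknode[OF v
                  eval_evals.mknode[OF call[OF t2(1) t4(1)] call[OF t3(1) t5(1)]]]]] False t1(1) t6(1) h[of y]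
            by simp
          moreover have "real (1 + t1 + (1 + (1 + (1 + sz y) +
              (1 + (1 + (t2 + 0) + t4) + (1 + (t3 + 0) + t5))) + t6)) \<le> C N + real t4 + real t5"
          proof -
            have "real (sz (h z)) \<le> qbound kb N" if "sz z \<le> N" for z
              using kb[of z] qbound_mono[OF order_refl that, of kb] by linarith
            from this[of "l y"] this[of "r y"]
            have "real (sz ?p) \<le> 2 + real N + 2 * qbound kb N"
              using less.prems le[OF False] by simp
            then have "sz ?p \<le> nat \<lfloor>2 + real N + 2 * qbound kb N\<rfloor>" by linarith
            from qbound_mono[OF order_refl this, of k2] t6(2)
            have "real t6 \<le> qbound k2 (nat \<lfloor>2 + real N + 2 * qbound kb N\<rfloor>)" by linarith
            then show ?thesis
              using t1' t2(2) t3(2) qbound_mono[OF order_refl less.prems, of k1] less.prems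
                pos[of k2 N] pos[of k1 N] by (simp add: C_def)
          qed
          moreover have "C N + real t4 + real t5 \<le> (2 * real (m y) - 1) * C N"
          proof -
            have "C N + real t4 + real t5 \<le> (2 * real (m (l y) + m (r y)) - 1) * C N"
              using t4(2) t5(2) by (simp add: algebra_simps)
            also have "\<dots> \<le> (2 * real (m y) - 1) * C N"
              using m(3)[OF False] C0 by (intro mult_right_mono) auto
            finally show ?thesis .
          qed
          ultimately show ?thesis by (meson order_trans)
        qed
      qed
      from this[of x] obtain t where t: "eval ?P [enc x] B (enc (h x)) t" "real t \<le> (2 * real (m x) - 1) * C N"
        unfolding N_def by blast
      have "eval ?P (enc x # env) (Call f [Var 0]) (enc (h x)) (1 + ((1 + sz x) + 0) + t)"
        using eval_evals.call[OF eval_evals.cons[OF eval_evals.var eval_evals.nil] f(1), of 0 "enc x # env" "enc (h x)" t] t(1) f(2) by simp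
      moreover have "real (1 + ((1 + sz x) + 0) + t) \<le> qbound k (sz x)"
      proof -
        have "(2 * real (m x) - 1) * C N \<le> 2 * qbound km N * C N"
          using km[of x] C0[of N] unfolding N_def by (intro mult_right_mono) auto
        then show ?thesis using t(2) k[of N] unfolding N_def by simp
      qed
      ultimately show ?thesis by blast
    qed
    then show ?thesis unfolding impl_def by blast
  qed
  then show ?thesis by (rule qpI)
qed

section \<open>Lists\<close>

lemma qp_eq_tree: "qp (\<lambda>p :: tree \<times> tree. fst p = snd p)"
proof (rule qp_rec)
  show "(fst p = snd p) = (if fst p = Leaf \<or> snd p = Leaf then fst p = Leaf \<and> snd p = Leaf else
      fst (lft (fst p), lft (snd p)) = snd (lft (fst p), lft (snd p)) \<and>
      fst (rgt (fst p), rgt (snd p)) = snd (rgt (fst p), rgt (snd p)))" for p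
    by (cases "fst p"; cases "snd p") auto
  show "qpb (\<lambda>p :: tree \<times> tree. sz p)" by (rule qpb_size)
  show "qpb (\<lambda>p :: tree \<times> tree. sz (fst p = snd p))"
    by (rule qpb_le[OF qpb_const[of 1]]) (simp add: enc_bool_def)
  fix p :: "tree \<times> tree"
  show "0 < sz p" by (cases p) auto
  obtain a b where p: "p = (a, b)" by (cases p)
  assume "\<not> (fst p = Leaf \<or> snd p = Leaf)"
  then show "sz (lft (fst p), lft (snd p)) + sz (rgt (fst p), rgt (snd p)) \<le> sz p"
    "sz (lft (fst p), lft (snd p)) \<le> sz p"
    "sz (rgt (fst p), rgt (snd p)) \<le> sz p"
    by (cases a; cases b; simp add: p)+
qed (intro qp_intros)+

lemma qp_eq [qp_intros]: assumes "qp f" "qp g" shows "qp (\<lambda>x. f x = g x)"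
  using qp_comp[OF qp_eq_tree qp_pair[OF qp_enc[OF assms(1)] qp_enc[OF assms(2)]]] by simp

lemma qp_foldr_gen:
  fixes s :: "'c :: encodable \<Rightarrow> 'a :: encodable \<Rightarrow> 'b :: encodable \<Rightarrow> 'b"
  assumes s: "qp (\<lambda>p. s (fst p) (fst (snd p)) (snd (snd p)))" and l: "qp l" and i: "qp i"
    and b: "qpb (\<lambda>p. sz (foldr (s (fst p)) (snd p) (i (fst p))))"
  shows "qp (\<lambda>x. foldr (s x) (l x) (i x))"
proof -
  let ?h = "\<lambda>p. foldr (s (fst p)) (snd p) (i (fst p))"
  have "qp ?h"
  \<comment> \<open>A linear recursion fits the binary scheme with a second call on the empty list:
    its measure is 1, and its value is ignored.\<close>
  proof (rule qp_rec[of "\<lambda>p. snd p = []" "\<lambda>p. i (fst p)" "\<lambda>p. (fst p, tl (snd p))" "\<lambda>p. (fst p, [])"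
        "\<lambda>p u v. s (fst p) (hd (snd p)) u" _ "\<lambda>p. 1 + length (snd p)"])
    show "qp (\<lambda>p :: ('c \<times> 'a list) \<times> 'b \<times> 'b. s (fst (fst p)) (hd (snd (fst p))) (fst (snd p)))"
      using qp_comp[OF s qp_pair[OF qp_fst[OF qp_fst[OF qp_id]] qp_pair[OF qp_hd[OF qp_snd[OF qp_fst[OF qp_id]]] qp_fst[OF qp_snd[OF qp_id]]]]]
      by simp
    show "?h p = (if snd p = [] then i (fst p) else s (fst p) (hd (snd p)) (?h (fst p, tl (snd p))))" for p
      by (cases "snd p") auto
    have len: "length (xs :: 'a list) \<le> sz xs" for xs by (induction xs) auto
    show "qpb (\<lambda>p :: 'c \<times> 'a list. 1 + length (snd p))"
    proof (rule qpb_le[OF qpb_add[OF qpb_const qpb_size]])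
      show "1 + length (snd p) \<le> 1 + sz p" for p :: "'c \<times> 'a list"
        using len[of "snd p"] by (cases p) auto
    qed
    show "sz (fst p, tl (snd p)) \<le> sz p" for p :: "'c \<times> 'a list"
      by (cases p; cases "snd p") auto
    show "sz (fst p, [] :: 'a list) \<le> sz p" for p :: "'c \<times> 'a list"
      by (cases p) auto
    show "1 + length (snd (fst p, tl (snd p))) + (1 + length (snd (fst p, [] :: 'a list))) \<le> 1 + length (snd p)"
      if "snd p \<noteq> []" for p :: "'c \<times> 'a list"
      using that by (cases "snd p") auto
    show "qp (\<lambda>p. i (fst p))" by (intro qp_comp[OF i] qp_intros)
    show "qpb (\<lambda>p. sz (?h p))" by (rule b)
  qed (intro qp_intros | simp)+
  from qp_comp[OF this qp_pair[OF qp_id l]] show ?thesis by simp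
qed

lemma qpbI:
  assumes "quasi F" "\<And>x. real (f x) \<le> F (sz x)"
  shows "qpb f"
  using assms unfolding qpb_def quasi_def by (meson order_trans)

text \<open>The increase in one step depends on the element but not on the accumulator, so the
  increases add up. Otherwise, a repeated doubling of the accumulator would be possible.\<close>

lemma qp_foldr:
  fixes s :: "'c :: encodable \<Rightarrow> 'a :: encodable \<Rightarrow> 'b :: encodable \<Rightarrow> 'b"
  assumes s: "qp (\<lambda>p. s (fst p) (fst (snd p)) (snd (snd p)))" and l: "qp l" and i: "qp i"
    and b: "qpb b" "\<And>x y a. sz (s x y a) \<le> sz a + b (x, y)"
  shows "qp (\<lambda>x. foldr (s x) (l x) (i x))"
proof (rule qp_foldr_gen[OF s l i])
  obtain k where k: "\<And>p. real (b p) \<le> qbound k (sz p)" using b(1) unfolding qpb_def by blast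
  obtain j where j: "\<And>x. real (sz (i x)) \<le> qbound j (sz x)"
    using qp_size[OF i] unfolding qpb_def by blast
  have pos: "0 \<le> qbound k n" for k n using two_le_qbound[of k n] by simp
  show "qpb (\<lambda>p. sz (foldr (s (fst p)) (snd p) (i (fst p))))"
  proof (rule qpbI)
    show "quasi (\<lambda>n. qbound j n + real n * qbound k n)"
      by (intro quasi_add quasi_mult quasi_qbound quasi_ident pos)
    fix p :: "'c \<times> 'a list"
    obtain x ys where p: "p = (x, ys)" by (cases p)
    let ?n = "sz p"
    have "real (sz (foldr (s x) ys (i x))) \<le> qbound j ?n + real (length ys) * qbound k ?n"
      if "set ys \<subseteq> set (snd p)" for ys
      using that
    proof (induction ys)
      case Nil
      show ?case using j[of x] qbound_mono[of j j "sz x" ?n] by (simp add: p)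
    next
      case (Cons y ys)
      have elt: "sz y \<le> sz zs" if "y \<in> set zs" for zs using that by (induction zs) auto
      have "sz (x, y) \<le> ?n" 
        using elt[of ys] Cons.prems p by (cases "snd p") (auto dest: elt)
      then have "real (b (x, y)) \<le> qbound k ?n"
        using k[of "(x, y)"] qbound_mono[of k k "sz (x, y)" ?n] by linarith
      moreover have "real (sz (s x y (foldr (s x) ys (i x)))) \<le>
          real (sz (foldr (s x) ys (i x))) + real (b (x, y))"
        using b(2)[of x y "foldr (s x) ys (i x)"] by linarith
      ultimately show ?case using Cons by (simp add: algebra_simps)
    qed
    from this[of ys] have "real (sz (foldr (s x) ys (i x))) \<le> qbound j ?n + real (length ys) * qbound k ?n"
      by (simp add: p)
    moreover have "length (xs :: 'a list) \<le> sz xs" for xs by (induction xs) auto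
    from this[of ys] have "length ys \<le> ?n" by (simp add: p)
    then have "real (length ys) * qbound k ?n \<le> real ?n * qbound k ?n"
      using pos by (intro mult_right_mono) auto
    ultimately show "real (sz (foldr (s (fst p)) (snd p) (i (fst p)))) \<le> qbound j ?n + real ?n * qbound k ?n"
      by (simp add: p)
  qed
qed

lemma size_enc_append: "sz (xs @ ys) = sz xs + sz ys"
  by (induction xs) auto

lemma qp_append [qp_intros]:
  assumes "qp f" "qp g" shows "qp (\<lambda>x. f x @ g x)"
proof -
  have "qp (\<lambda>x. foldr (\<lambda>y a. y # a) (f x) (g x))"
    by (rule qp_foldr[where b = "\<lambda>p. 1 + sz p"])
      (intro qp_intros assms qpb_add qpb_const qpb_size | simp)+
  moreover have "foldr (\<lambda>y a. y # a) xs ys = xs @ ys" for xs ys :: "'b list" by (induction xs) auto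
  ultimately show ?thesis by simp
qed

lemma qp_concat_map [qp_intros]:
  assumes s: "qp (\<lambda>p. s (fst p) (snd p))" and l: "qp l"
  shows "qp (\<lambda>x. concat (map (s x) (l x)))"
proof -
  have "qp (\<lambda>x. foldr (\<lambda>y a. s x y @ a) (l x) [])"
  proof (rule qp_foldr[where b = "\<lambda>p. sz (s (fst p) (snd p))"])
    show "qp (\<lambda>p. s (fst p) (fst (snd p)) @ snd (snd p))"
      using qp_comp[OF s, of "\<lambda>p. (fst p, fst (snd p))"] by (intro qp_intros) (simp add: qp_intros)
  qed (auto intro!: qp_const l qp_size[OF s] simp: size_enc_append)
  moreover have "foldr (\<lambda>y a. s x y @ a) ys [] = concat (map (s x) ys)" for x ys by (induction ys) auto
  ultimately show ?thesis by simp
qed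

lemma qp_map [qp_intros]:
  assumes s: "qp (\<lambda>p. s (fst p) (snd p))" and l: "qp l"
  shows "qp (\<lambda>x. map (s x) (l x))"
  using qp_concat_map[of "\<lambda>x y. [s x y]" l] assms by (simp add: qp_Cons qp_const)

lemma qp_filter [qp_intros]:
  assumes s: "qp (\<lambda>p. s (fst p) (snd p))" and l: "qp l"
  shows "qp (\<lambda>x. filter (s x) (l x))"
proof -
  have "qp (\<lambda>x. concat (map (\<lambda>y. if s x y then [y] else []) (l x)))"
    by (intro qp_intros assms)
  moreover have "concat (map (\<lambda>y. if s x y then [y] else []) ys) = filter (s x) ys" for x ys
    by (induction ys) auto
  ultimately show ?thesis by simp
qed

lemma qp_Bex [qp_intros]:
  assumes s: "qp (\<lambda>p. s (fst p) (snd p))" and l: "qp l"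
  shows "qp (\<lambda>x. \<exists>y\<in>set (l x). s x y)"
  by (rule qp_cong[OF qp_not[OF qp_is_Nil[OF qp_filter[OF assms]]]]) (auto simp: filter_empty_conv)

lemma qp_Ball [qp_intros]:
  assumes s: "qp (\<lambda>p. s (fst p) (snd p))" and l: "qp l"
  shows "qp (\<lambda>x. \<forall>y\<in>set (l x). s x y)"
  by (rule qp_cong[OF qp_not[OF qp_Bex[OF qp_not[OF s] l]]]) auto

lemma qp_mem [qp_intros]: assumes "qp f" "qp l" shows "qp (\<lambda>x. f x \<in> set (l x))"
  by (rule qp_cong[OF qp_Bex[of "\<lambda>x y. f x = y" l]]) (intro qp_intros assms qp_comp[OF assms(1)] | blast)+

lemma qp_subset [qp_intros]: assumes "qp f" "qp g" shows "qp (\<lambda>x. set (f x) \<subseteq> set (g x))"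
  by (rule qp_cong[OF qp_Ball[of "\<lambda>x y. y \<in> set (g x)" f]]) (intro qp_intros assms qp_comp[OF assms(2)] | blast)+

lemma qp_rev [qp_intros]: assumes "qp f" shows "qp (\<lambda>x. rev (f x))"
proof -
  have "qp (\<lambda>x. foldr (\<lambda>y a. a @ [y]) (f x) [])"
    by (rule qp_foldr[where b = "\<lambda>p. 1 + sz p"])
      (intro qp_intros assms qpb_add qpb_const qpb_size | simp add: size_enc_append)+
  moreover have "foldr (\<lambda>y a. a @ [y]) xs [] = rev xs" for xs :: "'b list" by (induction xs) auto
  ultimately show ?thesis by simp
qed

lemma qp_remdups [qp_intros]: assumes "qp f" shows "qp (\<lambda>x. remdups (f x))"
proof -
  have "qp (\<lambda>x. foldr (\<lambda>y a. if y \<in> set a then a else y # a) (f x) [])"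
    by (rule qp_foldr[where b = "\<lambda>p. 1 + sz p"])
      (intro qp_intros assms qpb_add qpb_const qpb_size | simp)+
  moreover have "foldr (\<lambda>y a. if y \<in> set a then a else y # a) xs [] = remdups xs" for xs :: "'b list"
  proof (induction xs)
    case (Cons x xs)
    then show ?case by (simp only: foldr_Cons comp_apply remdups.simps set_remdups)
  qed simp
  ultimately show ?thesis by (simp only:)
qed

section \<open>Numbers and formulas\<close>

abbreviation "tag1 \<equiv> Node (Node Leaf Leaf) Leaf"
abbreviation "tag2 \<equiv> Node Leaf (Node (Node Leaf Leaf) Leaf)"
abbreviation "tag3 \<equiv> Node (Node Leaf Leaf) (Node (Node Leaf Leaf) Leaf)"

lemma qp_dual [qp_intros]: assumes "qp f" shows "qp (\<lambda>x. dual (f x))"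
proof (rule qp_comp[of dual, OF qp_tree assms])
  show "qp (\<lambda>t. Node (if lft t = Leaf then Node (Node Leaf Leaf) Leaf else Leaf) (rgt t))"
    by (intro qp_intros)
  show "Node (if lft (enc p) = Leaf then Node (Node Leaf Leaf) Leaf else Leaf) (rgt (enc p)) = enc (dual p)" for p
    by (cases p) auto
qed

lemma qp_same_enc:
  fixes f :: "'a :: encodable \<Rightarrow> 'b :: encodable" and F :: "'a \<Rightarrow> 'c :: encodable"
  shows "qp F \<Longrightarrow> (\<And>x. enc (F x) = enc (f x)) \<Longrightarrow> qp f"
  by (rule qp_via[of F "\<lambda>x. x"]) auto

lemma qp_Ext [qp_intros]: "qp f \<Longrightarrow> qp (\<lambda>x. Ext (f x))"
  by (rule qp_same_enc[OF qp_Node[OF qp_const[of "Node (Node Leaf Leaf) Leaf"] qp_enc]]) auto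

lemma qp_FLit [qp_intros]: "qp f \<Longrightarrow> qp (\<lambda>x. FLit (f x))"
  by (rule qp_same_enc[OF qp_Node[OF qp_const[of Leaf] qp_enc]]) auto

lemma qp_FAnd [qp_intros]: "qp f \<Longrightarrow> qp g \<Longrightarrow> qp (\<lambda>x. FAnd (f x) (g x))"
  by (rule qp_same_enc[OF qp_Node[OF qp_const[of "Node (Node Leaf Leaf) Leaf"] qp_Node[OF qp_enc qp_enc]]]) auto

lemma qp_FOr [qp_intros]: "qp f \<Longrightarrow> qp g \<Longrightarrow> qp (\<lambda>x. FOr (f x) (g x))"
  by (rule qp_same_enc[OF qp_Node[OF qp_const[of "Node Leaf (Node (Node Leaf Leaf) Leaf)"] qp_Node[OF qp_enc qp_enc]]]) auto

text \<open>Binary increment: the ones at the low end become zeros until a zero, or the end of the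
  list of bits, becomes a one.\<close>

lemma qp_Suc: "qp Suc"
proof -
  define inc where "inc = rec_tree (Node (Node Leaf Leaf) Leaf)
    (\<lambda>a b _ r. if a = Leaf then Node (Node Leaf Leaf) b else Node Leaf r)"
  have inc: "inc Leaf = Node (Node Leaf Leaf) Leaf"
    "inc (Node a b) = (if a = Leaf then Node (Node Leaf Leaf) b else Node Leaf (inc b))" for a b
    by (auto simp: inc_def)
  have le: "size (inc t) \<le> size t + 2" for t by (induction t) (auto simp: inc)
  have "qp inc"
  proof (rule qp_rec[where lf = "\<lambda>t. lft t = Leaf" and l = rgt and r = "\<lambda>t. Leaf" and
        a = "\<lambda>t. if t = Leaf then tag1 else Node (Node Leaf Leaf) (rgt t)" and
        g = "\<lambda>t u v. Node Leaf u" and m = "\<lambda>t. size t + 1"])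
    show "inc t = (if lft t = Leaf then if t = Leaf then tag1
        else Node (Node Leaf Leaf) (rgt t) else Node Leaf (inc (rgt t)))" for t
      by (cases t) (auto simp: inc)
    show "qpb (\<lambda>t :: tree. size t + 1)"
      using qpb_add[OF qpb_size[where ?'a = tree] qpb_const[of 1]] by simp
    show "qpb (\<lambda>t. sz (inc t))"
      by (rule qpb_le[OF qpb_add[OF qpb_size qpb_const[of 2]]]) (simp add: le[simplified])
    show "size (rgt t) + 1 + (size Leaf + 1) \<le> size t + 1" if "lft t \<noteq> Leaf" for t
      using that by (cases t) auto
    show "sz (rgt t) \<le> sz t" for t by (cases t) auto
  qed (intro qp_intros | simp)+
  then show ?thesis
  proof (rule qp_tree)
    show "inc (enc n) = enc (Suc n)" for n
    proof (induction n rule: less_induct)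
      case (less n)
      show ?case
      proof (cases "n = 0")
        case True
        then show ?thesis by (simp add: enc_nat_class_def enc_nat.simps inc)
      next
        case False
        then have "inc (enc_nat (n div 2)) = enc_nat (Suc (n div 2))"
          using less[of "n div 2"] by (simp add: enc_nat_class_def)
        with False show ?thesis
          by (auto simp: enc_nat_class_def enc_nat.simps[of n] enc_nat.simps[of "Suc n"] inc)
      qed
    qed
  qed
qed

lemma size_enc_Suc: "sz (Suc n) \<le> sz n + 2"
proof (induction n rule: less_induct)
  case (less n)
  show ?case
  proof (cases "n = 0")
    case True
    then show ?thesis by (simp add: enc_nat_class_def enc_nat.simps)
  next
    case False
    then show ?thesis
      using less[of "n div 2"]
      by (auto simp: enc_nat_class_def enc_nat.simps[of n] enc_nat.simps[of "Suc n"] elim!: oddE)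
  qed
qed

lemma qp_length [qp_intros]: assumes "qp f" shows "qp (\<lambda>x. length (f x))"
proof -
  have "qp (\<lambda>x. foldr (\<lambda>y a. Suc a) (f x) 0)"
    by (rule qp_foldr[where b = "\<lambda>p. 2"])
      (intro qp_intros qp_comp[OF qp_Suc] assms qpb_const | simp add: size_enc_Suc[simplified])+
  moreover have "foldr (\<lambda>y a. Suc a) xs 0 = length xs" for xs :: "'b list" by (induction xs) auto
  ultimately show ?thesis by simp
qed

text \<open>Serves two purposes: it numbers list elements by the length of what follows, and it
  yields chains of cedents that change by one formula at a time.\<close>

fun suffixes :: "'a list \<Rightarrow> 'a list list" where
  "suffixes [] = [[]]"
| "suffixes (x # xs) = (x # xs) # suffixes xs"

lemma length_le_enc: "length xs \<le> sz xs"
  by (induction xs) auto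

lemma elem_le_enc: "x \<in> set xs \<Longrightarrow> sz x < sz xs"
  by (induction xs) auto

lemma size_enc_le: "(\<And>x. x \<in> set xs \<Longrightarrow> sz x \<le> k) \<Longrightarrow> sz xs \<le> length xs * (k + 1)"
proof (induction xs)
  case (Cons x xs)
  from Cons.IH Cons.prems[of x] Cons.prems show ?case by fastforce
qed simp

lemma qp_suffixes [qp_intros]: assumes "qp f" shows "qp (\<lambda>x. suffixes (f x))"
proof (rule qp_comp[of suffixes, OF _ assms])
  show "qp (suffixes :: 'b list \<Rightarrow> 'b list list)"
  proof (rule qp_rec[where lf = "\<lambda>xs. xs = []" and a = "\<lambda>xs. [[]]" and l = tl and r = "\<lambda>xs. []" and
        g = "\<lambda>xs u v. xs # u" and m = "\<lambda>xs. length xs + 1"])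
    show "suffixes xs = (if xs = [] then [[]] else xs # suffixes (tl xs))" for xs :: "'b list"
      by (cases xs) auto
    show "qpb (\<lambda>xs :: 'b list. length xs + 1)"
      by (rule qpb_le[OF qpb_add[OF qpb_size qpb_const[of 1]]]) (auto simp: length_le_enc)
    show "qpb (\<lambda>xs. sz (suffixes xs :: 'b list list))"
    proof (rule qpb_le[OF qpb_mult[OF qpb_add[OF qpb_size qpb_const[of 1]] qpb_add[OF qpb_size qpb_const[of 1]]]])
      fix xs :: "'b list"
      have "length (suffixes xs) = length xs + 1" "\<And>ys. ys \<in> set (suffixes xs) \<Longrightarrow> sz ys \<le> sz xs"
        by (induction xs) (auto simp: le_SucI trans_le_add2)
      then show "sz (suffixes xs) \<le> (sz xs + 1) * (sz xs + 1)"
        using size_enc_le[of "suffixes xs" "sz xs"]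
          mult_le_mono1[of "length xs + 1" "sz xs + 1" "sz xs + 1"] length_le_enc[of xs]
        by simp
    qed
    show "length (tl xs) + 1 + (length [] + 1) \<le> length xs + 1" if "xs \<noteq> []" for xs :: "'b list"
      using that by (cases xs) auto
    show "sz (tl xs) \<le> sz xs" for xs :: "'b list" by (cases xs) auto
  qed (intro qp_intros | simp)+
qed

definition fhalf :: "'a list \<Rightarrow> 'a list" where "fhalf xs = take (length xs div 2) xs"
definition shalf :: "'a list \<Rightarrow> 'a list" where "shalf xs = drop (length xs div 2) xs"

text \<open>The second component is a counter that loses two elements for each element moved, so no
  arithmetic is involved. As the recursion is stated for arbitrary pairs, the counter may outlast
  the list; this is the case \<open>([], [])\<close>.\<close>

lemma qp_halves: "qp (\<lambda>xs :: 'a :: encodable list. (fhalf xs, shalf xs))"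
proof -
  let ?h = "\<lambda>p :: 'a list \<times> 'a list. (take (length (snd p) div 2) (fst p), drop (length (snd p) div 2) (fst p))"
  have "qp ?h"
  proof (rule qp_rec[where lf = "\<lambda>p. snd p = [] \<or> tl (snd p) = []" and a = "\<lambda>p. ([], fst p)" and
        l = "\<lambda>p. (tl (fst p), tl (tl (snd p)))" and r = "\<lambda>p. ([], [])" and
        g = "\<lambda>p u v. if fst p = [] then ([], []) else (hd (fst p) # fst u, snd u)" and
        m = "\<lambda>p. length (snd p) + 1"])
    show "?h p = (if snd p = [] \<or> tl (snd p) = [] then ([], fst p) else
        if fst p = [] then ([], []) else (hd (fst p) # fst (?h (tl (fst p), tl (tl (snd p)))), snd (?h (tl (fst p), tl (tl (snd p))))))" for p
      by (cases "snd p"; cases "tl (snd p)"; cases "fst p") auto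
    show "qpb (\<lambda>p :: 'a list \<times> 'a list. length (snd p) + 1)"
    proof (rule qpb_le[OF qpb_add[OF qpb_size qpb_const[of 1]]])
      show "length (snd p) + 1 \<le> sz p + 1" for p :: "'a list \<times> 'a list"
        using length_le_enc[of "snd p"] by (cases p) auto
    qed
    show "qpb (\<lambda>p. sz (?h p))"
    proof (rule qpb_le[OF qpb_size])
      fix p :: "'a list \<times> 'a list"
      show "sz (?h p) \<le> sz p"
        using size_enc_append[of "take (length (snd p) div 2) (fst p)" "drop (length (snd p) div 2) (fst p)"]
        by (cases p) simp
    qed
    show "length (snd (tl (fst p), tl (tl (snd p)))) + 1 + (length (snd ([], [])) + 1) \<le> length (snd p) + 1"
      if "\<not> (snd p = [] \<or> tl (snd p) = [])" for p :: "'a list \<times> 'a list"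
      using that by (cases "snd p"; cases "tl (snd p)") auto
    have tl: "sz (tl xs) \<le> sz xs" for xs :: "'a list" by (cases xs) auto
    show "sz (tl (fst p), tl (tl (snd p))) \<le> sz p" for p :: "'a list \<times> 'a list"
      using tl[of "fst p"] tl[of "tl (snd p)"] tl[of "snd p"] by (cases p) auto
    show "sz ([] :: 'a list, [] :: 'a list) \<le> sz p" for p :: "'a list \<times> 'a list"
      by (cases p) auto
  qed (intro qp_intros | simp)+
  from qp_comp[OF this qp_pair[OF qp_id qp_id]] show ?thesis by (simp add: fhalf_def shalf_def)
qed

lemma qp_fhalf [qp_intros]: "qp f \<Longrightarrow> qp (\<lambda>x. fhalf (f x))"
  and qp_shalf [qp_intros]: "qp f \<Longrightarrow> qp (\<lambda>x. shalf (f x))"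
  using qp_fst[OF qp_comp[OF qp_halves]] qp_snd[OF qp_comp[OF qp_halves]] by auto

section \<open>Selectors and case distinctions for formulas\<close>

fun sel1 :: "endt \<Rightarrow> endt" where
  "sel1 (Dec A p B) = A" | "sel1 (Or A B) = A" | "sel1 A = A"

fun sel2 :: "endt \<Rightarrow> endt" where
  "sel2 (Dec A p B) = B" | "sel2 (Or A B) = B" | "sel2 A = A"

fun sel_lit :: "endt \<Rightarrow> literal" where
  "sel_lit (Lit p) = p" | "sel_lit (Dec A p B) = p" | "sel_lit A = Pos 0"


lemma qp_sel1 [qp_intros]: assumes "qp f" shows "qp (\<lambda>x. sel1 (f x))"
proof (rule qp_comp[of sel1, OF qp_tree assms])
  show "qp (\<lambda>t. if lft t = tag2 \<or> lft t = tag3 then lft (rgt t) else t)"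
    by (intro qp_intros)
  show "(if lft (enc A) = tag2 \<or> lft (enc A) = tag3 then lft (rgt (enc A)) else enc A) = enc (sel1 A)" for A
    by (cases A) auto
qed

lemma qp_sel2 [qp_intros]: assumes "qp f" shows "qp (\<lambda>x. sel2 (f x))"
proof (rule qp_comp[of sel2, OF qp_tree assms])
  show "qp (\<lambda>t. if lft t = tag2 then rgt (rgt (rgt t)) else if lft t = tag3 then rgt (rgt t) else t)"
    by (intro qp_intros)
  show "(if lft (enc A) = tag2 then rgt (rgt (rgt (enc A))) else if lft (enc A) = tag3 then rgt (rgt (enc A)) else enc A) = enc (sel2 A)" for A
    by (cases A) auto
qed

lemma qp_sel_lit [qp_intros]: assumes "qp f" shows "qp (\<lambda>x. sel_lit (f x))"
proof (rule qp_comp[of sel_lit, OF qp_tree assms])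
  show "qp (\<lambda>t. if lft t = Leaf then rgt t else if lft t = tag2 then lft (rgt (rgt t)) else enc (Pos 0))"
    by (intro qp_intros)
  show "(if lft (enc A) = Leaf then rgt (enc A) else if lft (enc A) = tag2 then lft (rgt (rgt (enc A))) else enc (Pos 0)) = enc (sel_lit A)" for A
    by (cases A) auto
qed

lemma qp_endt_case:
  assumes A: "qp A" and f: "qp (\<lambda>p. f (fst p) (snd p))" and g: "qp g"
    and h: "qp (\<lambda>p. h (fst p) (fst (snd p)) (fst (snd (snd p))) (snd (snd (snd p))))"
    and k: "qp (\<lambda>p. k (fst p) (fst (snd p)) (snd (snd p)))"
  shows "qp (\<lambda>x. case A x of Lit p \<Rightarrow> f x p | Ext i \<Rightarrow> g x | Dec B p C \<Rightarrow> h x B p C | Or B C \<Rightarrow> k x B C)"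
proof (rule qp_cong)
  have 1: "qp (\<lambda>x. f x (sel_lit (A x)))"
    using qp_comp[OF f qp_pair[OF qp_id qp_sel_lit[OF A]]] by simp
  have 2: "qp (\<lambda>x. h x (sel1 (A x)) (sel_lit (A x)) (sel2 (A x)))"
    using qp_comp[OF h qp_pair[OF qp_id qp_pair[OF qp_sel1[OF A] qp_pair[OF qp_sel_lit[OF A] qp_sel2[OF A]]]]] by simp
  have 3: "qp (\<lambda>x. k x (sel1 (A x)) (sel2 (A x)))"
    using qp_comp[OF k qp_pair[OF qp_id qp_pair[OF qp_sel1[OF A] qp_sel2[OF A]]]] by simp
  show "qp (\<lambda>x. if lft (enc (A x)) = Leaf then f x (sel_lit (A x)) else if lft (enc (A x)) = tag1 then g x
      else if lft (enc (A x)) = tag2 then h x (sel1 (A x)) (sel_lit (A x)) (sel2 (A x))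
      else k x (sel1 (A x)) (sel2 (A x)))"
    by (intro qp_intros 1 2 3 A g)
qed (auto split: endt.split)

fun fsel1 :: "form \<Rightarrow> form" where
  "fsel1 (FAnd A B) = A" | "fsel1 (FOr A B) = A" | "fsel1 A = A"

fun fsel2 :: "form \<Rightarrow> form" where
  "fsel2 (FAnd A B) = B" | "fsel2 (FOr A B) = B" | "fsel2 A = A"

fun fsel_lit :: "form \<Rightarrow> literal" where
  "fsel_lit (FLit p) = p" | "fsel_lit A = Pos 0"

lemma qp_fsel1 [qp_intros]: assumes "qp f" shows "qp (\<lambda>x. fsel1 (f x))"
proof (rule qp_comp[of fsel1, OF qp_tree assms])
  show "qp (\<lambda>t. if lft t = Leaf then t else lft (rgt t))" by (intro qp_intros)
  show "(if lft (enc A) = Leaf then enc A else lft (rgt (enc A))) = enc (fsel1 A)" for A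
    by (cases A) auto
qed

lemma qp_fsel2 [qp_intros]: assumes "qp f" shows "qp (\<lambda>x. fsel2 (f x))"
proof (rule qp_comp[of fsel2, OF qp_tree assms])
  show "qp (\<lambda>t. if lft t = Leaf then t else rgt (rgt t))" by (intro qp_intros)
  show "(if lft (enc A) = Leaf then enc A else rgt (rgt (enc A))) = enc (fsel2 A)" for A
    by (cases A) auto
qed

lemma qp_fsel_lit [qp_intros]: assumes "qp f" shows "qp (\<lambda>x. fsel_lit (f x))"
proof (rule qp_comp[of fsel_lit, OF qp_tree assms])
  show "qp (\<lambda>t. if lft t = Leaf then rgt t else enc (Pos 0))" by (intro qp_intros)
  show "(if lft (enc A) = Leaf then rgt (enc A) else enc (Pos 0)) = enc (fsel_lit A)" for A
    by (cases A) auto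
qed

lemma qp_form_case:
  assumes A: "qp A" and f: "qp (\<lambda>p. f (fst p) (snd p))"
    and g: "qp (\<lambda>p. g (fst p) (fst (snd p)) (snd (snd p)))"
    and h: "qp (\<lambda>p. h (fst p) (fst (snd p)) (snd (snd p)))"
  shows "qp (\<lambda>x. case A x of FLit p \<Rightarrow> f x p | FAnd B C \<Rightarrow> g x B C | FOr B C \<Rightarrow> h x B C)"
proof (rule qp_cong)
  have 1: "qp (\<lambda>x. f x (fsel_lit (A x)))"
    using qp_comp[OF f qp_pair[OF qp_id qp_fsel_lit[OF A]]] by simp
  have 2: "qp (\<lambda>x. g x (fsel1 (A x)) (fsel2 (A x)))"
    using qp_comp[OF g qp_pair[OF qp_id qp_pair[OF qp_fsel1[OF A] qp_fsel2[OF A]]]] by simp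
  have 3: "qp (\<lambda>x. h x (fsel1 (A x)) (fsel2 (A x)))"
    using qp_comp[OF h qp_pair[OF qp_id qp_pair[OF qp_fsel1[OF A] qp_fsel2[OF A]]]] by simp
  show "qp (\<lambda>x. if lft (enc (A x)) = Leaf then f x (fsel_lit (A x))
      else if lft (enc (A x)) = tag1 then g x (fsel1 (A x)) (fsel2 (A x))
      else h x (fsel1 (A x)) (fsel2 (A x)))"
    by (intro qp_intros 1 2 3 A)
qed (auto split: form.split)

section \<open>Reachability formulas\<close>

lemma size_enc_list_le:
  "length xs \<le> m \<Longrightarrow> (\<And>x. x \<in> set xs \<Longrightarrow> sz x \<le> k) \<Longrightarrow> sz xs \<le> m * (k + 1)"
  by (rule order_trans[OF size_enc_le mult_le_mono1])

text \<open>LK formulas contain no constants, so a fixed variable and its negation provide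
  them.\<close>

definition Top :: form where "Top = FOr (FLit (Pos 0)) (FLit (Neg 0))"
definition Bot :: form where "Bot = FAnd (FLit (Pos 0)) (FLit (Neg 0))"

definition Disj :: "form list \<Rightarrow> form" where "Disj fs = foldr FOr fs Bot"
definition Conj :: "form list \<Rightarrow> form" where "Conj fs = foldr FAnd fs Top"

lemma qp_Disj [qp_intros]: assumes "qp f" shows "qp (\<lambda>x. Disj (f x))"
  unfolding Disj_def
  by (rule qp_foldr[where s = "\<lambda>x. FOr" and b = "\<lambda>p. 5 + sz p"])
    (intro qp_intros assms qpb_add qpb_const qpb_size | simp)+

lemma qp_Conj [qp_intros]: assumes "qp f" shows "qp (\<lambda>x. Conj (f x))"
  unfolding Conj_def
  by (rule qp_foldr[where s = "\<lambda>x. FAnd" and b = "\<lambda>p. 5 + sz p"])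
    (intro qp_intros assms qpb_add qpb_const qpb_size | simp)+

text \<open>In preorder, since a topological order has to list a formula before the subformulas to
  which its edges lead.\<close>

fun subs :: "endt \<Rightarrow> endt list" where
  "subs (Dec A p B) = Dec A p B # subs A @ subs B"
| "subs (Or A B) = Or A B # subs A @ subs B"
| "subs A = [A]"

text \<open>Defined on eNDT formulas because the program meets DT formulas only in this guise; the
  empty list is a default for formulas that do not come from DT formulas.\<close>

fun Tms_list :: "endt \<Rightarrow> form list" where
  "Tms_list (Lit p) = [FLit p]"
| "Tms_list (Dec A p B) = map (FAnd (FLit (dual p))) (Tms_list A) @ map (FAnd (FLit p)) (Tms_list B)"
| "Tms_list A = []"

fun Cls_list :: "endt \<Rightarrow> form list" where
  "Cls_list (Lit p) = [FLit p]"
| "Cls_list (Dec A p B) = map (FOr (FLit p)) (Cls_list A) @ map (FOr (FLit (dual p))) (Cls_list B)"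
| "Cls_list A = []"

text \<open>In postorder, so that the identity sequents of the immediate subformulas are available
  when the lines of a formula are derived.\<close>

fun sforms :: "form \<Rightarrow> form list" where
  "sforms (FLit p) = [FLit p]"
| "sforms (FAnd A B) = sforms A @ sforms B @ [FAnd A B]"
| "sforms (FOr A B) = sforms A @ sforms B @ [FOr A B]"

text \<open>With these sequents, cut alone simulates the left and right rules of the connective.
  Their order matters: each one follows by a single LK rule from earlier ones and from the
  identities of the immediate subformulas.\<close>

fun ax_lines :: "form \<Rightarrow> form line list" where
  "ax_lines (FLit p) = [([FLit p], [FLit p]), ([FLit p, FLit (dual p)], []), ([], [FLit p, FLit (dual p)])]"
| "ax_lines (FAnd A B) = [([A, B], [A]), ([A, B], [B]), ([A, B], [FAnd A B]),
     ([FAnd A B], [A]), ([FAnd A B], [B]), ([FAnd A B], [FAnd A B])]"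
| "ax_lines (FOr A B) = [([A], [A, B]), ([B], [A, B]), ([FOr A B], [A, B]),
     ([A], [FOr A B]), ([B], [FOr A B]), ([FOr A B], [FOr A B])]"

lemma qp_ax_lines: "qp ax_lines"
proof (rule qp_cong)
  show "qp (\<lambda>x. case x of FLit p \<Rightarrow> [([FLit p], [FLit p]), ([FLit p, FLit (dual p)], []), ([], [FLit p, FLit (dual p)])]
    | FAnd A B \<Rightarrow> [([A, B], [A]), ([A, B], [B]), ([A, B], [FAnd A B]),
       ([FAnd A B], [A]), ([FAnd A B], [B]), ([FAnd A B], [FAnd A B])]
    | FOr A B \<Rightarrow> [([A], [A, B]), ([B], [A, B]), ([FOr A B], [A, B]),
       ([A], [FOr A B]), ([B], [FOr A B]), ([FOr A B], [FOr A B])])"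
    by (intro qp_form_case qp_intros)
qed (auto split: form.split)

lemma qp_endt_rec:
  fixes h :: "endt \<Rightarrow> 'b :: encodable"
  assumes c: "qp c" and a: "qp a" and g: "qp (\<lambda>p. g (fst p) (fst (snd p)) (snd (snd p)))"
    and h: "\<And>A. h A = (if c A then g A (h (sel1 A)) (h (sel2 A)) else a A)"
    and compound: "\<And>A. c A \<Longrightarrow> lft (enc A) \<in> {tag2, tag3}"
    and b: "qpb (\<lambda>A. sz (h A))"
  shows "qp h"
proof (rule qp_rec[where lf = "\<lambda>A. \<not> c A" and a = a and l = sel1 and r = sel2 and g = g and m = "\<lambda>A. sz A + 1"])
  show "h A = (if \<not> c A then a A else g A (h (sel1 A)) (h (sel2 A)))" for A
    using h[of A] by simp
  show "qpb (\<lambda>A :: endt. sz A + 1)" by (intro qpb_add qpb_const qpb_size)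
  fix A assume "\<not> \<not> c A"
  with compound have "lft (enc A) \<in> {tag2, tag3}" by simp
  then show "sz (sel1 A) + 1 + (sz (sel2 A) + 1) \<le> sz A + 1"
    "sz (sel1 A) \<le> sz A" "sz (sel2 A) \<le> sz A"
    by (cases A; simp)+
qed (intro qp_intros assms | simp)+

lemma qp_subs: "qp subs"
proof (rule qp_endt_rec[where c = "\<lambda>A. lft (enc A) = tag2 \<or> lft (enc A) = tag3" and a = "\<lambda>A. [A]" and
      g = "\<lambda>A u v. A # u @ v"])
  show "subs A = (if lft (enc A) = tag2 \<or> lft (enc A) = tag3 then A # subs (sel1 A) @ subs (sel2 A) else [A])" for A
    by (cases A) auto
  show "qpb (\<lambda>A. sz (subs A))"
  proof (rule qpb_le[OF qpb_mult[OF qpb_size qpb_add[OF qpb_size qpb_const[of 1]]]])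
    fix A
    have "length (subs A) \<le> sz A" by (induction A) auto
    moreover have "\<And>B. B \<in> set (subs A) \<Longrightarrow> sz B \<le> sz A"
      by (induction A) force+
    ultimately show "sz (subs A) \<le> sz A * (sz A + 1)"
      by (intro size_enc_list_le)
  qed
qed (simp | intro qp_intros)+

lemma size_enc_dual: "sz (dual p) \<le> sz p + 2"
  by (cases p) auto

lemma qp_Tms_list: "qp Tms_list"
proof (rule qp_endt_rec[where c = "\<lambda>A. lft (enc A) = tag2" and
      a = "\<lambda>A. if lft (enc A) = Leaf then [FLit (sel_lit A)] else []" and
      g = "\<lambda>A u v. map (FAnd (FLit (dual (sel_lit A)))) u @ map (FAnd (FLit (sel_lit A))) v"])
  show "Tms_list A = (if lft (enc A) = tag2 then map (FAnd (FLit (dual (sel_lit A)))) (Tms_list (sel1 A)) @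
      map (FAnd (FLit (sel_lit A))) (Tms_list (sel2 A)) else if lft (enc A) = Leaf then [FLit (sel_lit A)] else [])" for A
    by (cases A) auto
  show "qpb (\<lambda>A. sz (Tms_list A))"
  proof (rule qpb_le[OF qpb_mult[OF qpb_size qpb_add[OF qpb_mult[OF qpb_const[of 2] qpb_size] qpb_const[of 1]]]])
    fix A
    have "length (Tms_list A) \<le> sz A" by (induction A) auto
    moreover have "\<And>D. D \<in> set (Tms_list A) \<Longrightarrow> sz D \<le> 2 * sz A"
    proof (induction A)
      case (Dec A p B)
      then show ?case using size_enc_dual[of p] by (auto dest!: Dec.IH)
    qed auto
    ultimately show "sz (Tms_list A) \<le> sz A * (2 * sz A + 1)"
      by (intro size_enc_list_le)
  qed
qed (simp | intro qp_intros)+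

lemma qp_Cls_list: "qp Cls_list"
proof (rule qp_endt_rec[where c = "\<lambda>A. lft (enc A) = tag2" and
      a = "\<lambda>A. if lft (enc A) = Leaf then [FLit (sel_lit A)] else []" and
      g = "\<lambda>A u v. map (FOr (FLit (sel_lit A))) u @ map (FOr (FLit (dual (sel_lit A)))) v"])
  show "Cls_list A = (if lft (enc A) = tag2 then map (FOr (FLit (sel_lit A))) (Cls_list (sel1 A)) @
      map (FOr (FLit (dual (sel_lit A)))) (Cls_list (sel2 A)) else if lft (enc A) = Leaf then [FLit (sel_lit A)] else [])" for A
    by (cases A) auto
  show "qpb (\<lambda>A. sz (Cls_list A))"
  proof (rule qpb_le[OF qpb_mult[OF qpb_size qpb_add[OF qpb_mult[OF qpb_const[of 2] qpb_size] qpb_const[of 1]]]])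
    fix A
    have "length (Cls_list A) \<le> sz A" by (induction A) auto
    moreover have "\<And>D. D \<in> set (Cls_list A) \<Longrightarrow> sz D \<le> 2 * sz A"
    proof (induction A)
      case (Dec A p B)
      then show ?case using size_enc_dual[of p] by (auto dest!: Dec.IH)
    qed auto
    ultimately show "sz (Cls_list A) \<le> sz A * (2 * sz A + 1)"
      by (intro size_enc_list_le)
  qed
qed (simp | intro qp_intros)+

lemma qp_sforms: "qp sforms"
proof (rule qp_rec[where lf = "\<lambda>A. lft (enc A) = Leaf" and a = "\<lambda>A. [A]" and l = fsel1 and r = fsel2 and
      g = "\<lambda>A u v. u @ v @ [A]" and m = "\<lambda>A. sz A + 1"])
  show "sforms A = (if lft (enc A) = Leaf then [A] else sforms (fsel1 A) @ sforms (fsel2 A) @ [A])" for A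
    by (cases A) auto
  show "qpb (\<lambda>A :: form. sz A + 1)" by (intro qpb_add qpb_const qpb_size)
  show "qpb (\<lambda>A. sz (sforms A))"
  proof (rule qpb_le[OF qpb_mult[OF qpb_size qpb_add[OF qpb_size qpb_const[of 1]]]])
    fix A
    have "length (sforms A) \<le> sz A" by (induction A) auto
    moreover have "\<And>B. B \<in> set (sforms A) \<Longrightarrow> sz B \<le> sz A"
      by (induction A) force+
    ultimately show "sz (sforms A) \<le> sz A * (sz A + 1)"
      by (intro size_enc_list_le)
  qed
  fix A :: form assume "lft (enc A) \<noteq> Leaf"
  then show "sz (fsel1 A) + 1 + (sz (fsel2 A) + 1) \<le> sz A + 1"
    "sz (fsel1 A) \<le> sz A" "sz (fsel2 A) \<le> sz A"
    by (cases A; simp)+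
qed (intro qp_intros | simp)+

lemmas [qp_intros] = qp_comp[OF qp_ax_lines] qp_comp[OF qp_subs] qp_comp[OF qp_Tms_list]
  qp_comp[OF qp_Cls_list] qp_comp[OF qp_sforms]


text \<open>Outside of \<open>I\<close> the value is \<open>Bot\<close> rather than undefined, which makes the recursive formula uniform
  in the positions of \<open>u\<close> and \<open>v\<close>.\<close>

function reach :: "('n \<times> form \<times> 'n) list \<Rightarrow> 'n list \<Rightarrow> 'n \<Rightarrow> 'n \<Rightarrow> form" where
  "reach E I u v = (if u \<notin> set I \<or> v \<notin> set I then Bot else if length I < 2 then Top else
     FOr (FOr (reach E (fhalf I) u v) (reach E (shalf I) u v))
       (Disj (map (\<lambda>e. FAnd (reach E (fhalf I) u (fst e)) (FAnd (fst (snd e)) (reach E (shalf I) (snd (snd e)) v))) E)))"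
  by pat_completeness auto
termination
  by (relation "measure (\<lambda>(E, I, u, v). length I)") (auto simp: fhalf_def shalf_def)

declare reach.simps [simp del]

definition lookup :: "('k \<times> form) list \<Rightarrow> 'k \<Rightarrow> form" where
  "lookup t k = (case filter (\<lambda>e. fst e = k) t of [] \<Rightarrow> Bot | e # r \<Rightarrow> snd e)"

abbreviation crossings :: "('n \<times> form \<times> 'n) list \<Rightarrow> 'n list \<Rightarrow> 'n \<Rightarrow> 'n \<Rightarrow> form list" where
  "crossings E I u v \<equiv> map (\<lambda>e. FAnd (reach E (fhalf I) u (fst e)) (FAnd (fst (snd e)) (reach E (shalf I) (snd (snd e)) v))) E"

definition pairs :: "'a list \<Rightarrow> 'b list \<Rightarrow> ('a \<times> 'b) list" where
  "pairs xs ys = concat (map (\<lambda>x. map (\<lambda>y. (x, y)) ys) xs)"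

lemma set_pairs [simp]: "set (pairs xs ys) = set xs \<times> set ys"
  by (auto simp: pairs_def)

lemma length_pairs [simp]: "length (pairs xs ys) = length xs * length ys"
  by (induction xs) (auto simp: pairs_def)

lemma qp_pairs [qp_intros]: assumes "qp f" "qp g" shows "qp (\<lambda>x. pairs (f x) (g x))"
  unfolding pairs_def by (intro qp_intros qp_comp[OF assms(2)] assms)

lemma qp_lookup [qp_intros]: assumes "qp f" "qp g" shows "qp (\<lambda>x. lookup (f x) (g x))"
  unfolding lookup_def by (intro qp_list_case qp_intros qp_comp[OF assms(2)] assms)

text \<open>All values for an interval at once: a table needs only the tables of the two halves,
  which fits the binary recursion scheme, whereas a single formula would need recursive values for
  every edge.\<close>

definition table :: "('n \<times> form \<times> 'n) list \<Rightarrow> 'n list \<Rightarrow> (('n \<times> 'n) \<times> form) list" where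
  "table E I = map (\<lambda>p. (p, reach E I (fst p) (snd p))) (pairs I I)"

lemma lookup_map: "lookup (map (\<lambda>p. (p, f p)) ps) q = (if q \<in> set ps then f q else Bot)"
  unfolding lookup_def by (induction ps) auto

text \<open>A pair missing in the table yields \<open>Bot\<close>, which is also the value of
  \<open>reach\<close> outside of the interval, so membership need not be assumed.\<close>

lemma lookup_table: "lookup (table E I) (u, v) = reach E I u v"
  unfolding table_def lookup_map by (simp add: reach.simps)

lemma size_enc_Disj: "sz (Disj fs) \<le> 10 + (\<Sum>f\<leftarrow>fs. 5 + sz f)"
  by (induction fs) (auto simp: Disj_def Bot_def enc_nat_class_def enc_nat.simps)

text \<open>A formula for \<open>I\<close> contains two formulas for the halves and two more for
  every edge, so each halving costs a factor linear in \<open>sz E\<close>.\<close>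

lemma size_enc_reach:
  fixes E :: "('n :: encodable \<times> form \<times> 'n) list"
  shows "length I \<le> 2 ^ d \<Longrightarrow> sz (reach E I u v) \<le> (22 + 16 * sz E) ^ (d + 1)"
proof (induction d arbitrary: I u v)
  case 0
  then show ?case
    by (auto simp: reach.simps Top_def Bot_def enc_nat_class_def enc_nat.simps)
next
  case (Suc d)
  let ?s = "(22 + 16 * sz E) ^ (d + 1)"
  have "1 \<le> ?s" by (rule one_le_power) simp
  have IH: "sz (reach E (fhalf I) x y) \<le> ?s" "sz (reach E (shalf I) x y) \<le> ?s" for x y
  proof -
    have "length (fhalf I) \<le> 2 ^ d" "length (shalf I) \<le> 2 ^ d"
      using Suc.prems by (auto simp: fhalf_def shalf_def)
    from Suc.IH[OF this(1)] Suc.IH[OF this(2)]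
    show "sz (reach E (fhalf I) x y) \<le> ?s" "sz (reach E (shalf I) x y) \<le> ?s" by auto
  qed
  have "(\<Sum>e\<leftarrow>F. 5 + sz (FAnd (reach E (fhalf I) u (fst e)) (FAnd (fst (snd e)) (reach E (shalf I) (snd (snd e)) v))))
      \<le> (14 + 2 * ?s) * sz F" for F :: "('n \<times> form \<times> 'n) list"
  proof (induction F)
    case (Cons e F)
    have "sz (reach E (fhalf I) u (fst e)) + sz (reach E (shalf I) (snd (snd e)) v) \<le> 2 * ?s"
      using IH[of u "fst e"] IH[of "snd (snd e)" v] by linarith
    with Cons show ?case by (cases e) (simp add: algebra_simps)
  qed simp
  from this[of E] have sum: "(\<Sum>e\<leftarrow>E. 5 + sz (FAnd (reach E (fhalf I) u (fst e)) (FAnd (fst (snd e)) (reach E (shalf I) (snd (snd e)) v))))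
      \<le> (14 + 2 * ?s) * sz E" .
  have "sz (reach E I u v) \<le> 20 + 2 * ?s + (14 + 2 * ?s) * sz E"
  proof (cases "u \<notin> set I \<or> v \<notin> set I \<or> length I < 2")
    case True
    then show ?thesis
      by (subst reach.simps) (auto simp: Top_def Bot_def enc_nat_class_def enc_nat.simps)
  next
    case False
    then show ?thesis
      using IH(1)[of u v] IH(2)[of u v] sum
        size_enc_Disj[of "crossings E I u v"]
      by (subst reach.simps) (simp add: o_def)
  qed
  \<comment> \<open>The constants are multiplied by \<open>?s\<close>, which is at least 1; this is
    the origin of the base \<open>22 + 16 * sz E\<close>.\<close>
  also have "\<dots> \<le> 20 * ?s + 2 * ?s + (14 * ?s + 2 * ?s) * sz E"
    using \<open>1 \<le> ?s\<close> by (intro add_mono mult_right_mono) auto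
  also have "\<dots> = (22 + 16 * sz E) ^ (Suc d + 1)" by (simp add: algebra_simps)
  finally show ?case .
qed

text \<open>The recursion depth is logarithmic, so the formula has size \<open>n\<^bsup>O(log n)\<^esup>\<close>.\<close>

lemma qpb_table:
  "qpb (\<lambda>p :: ('n :: encodable \<times> form \<times> 'n) list \<times> 'n list. sz (table (fst p) (snd p)))"
proof (rule qpbI)
  have pos: "0 \<le> qbound k n" for k n using two_le_qbound[of k n] by simp
  show "quasi (\<lambda>n. real n * real n * (2 * real n + 3 + qbound 5 n))"
    by (intro quasi_add quasi_mult quasi_const quasi_ident quasi_qbound) (auto simp: pos add_nonneg_nonneg)
  fix p :: "('n \<times> form \<times> 'n) list \<times> 'n list"
  obtain E I where p: "p = (E, I)" by (cases p)
  let ?n = "sz p"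
  define d where "d = nat \<lceil>qlog ?n\<rceil>"
  have d: "qlog ?n \<le> real d" "real d \<le> qlog ?n + 1"
    using two_le_qlog[of ?n] by (auto simp: d_def)
  have "real (length I) \<le> 2 powr qlog ?n" using length_le_enc[of I] by (simp add: powr_qlog p)
  also have "\<dots> \<le> 2 powr real d" using d(1) by (intro powr_mono) auto
  finally have len: "length I \<le> 2 ^ d"
    by (simp add: powr_realpow)
  have "real (22 + 16 * sz E) \<le> 16 * 2 powr qlog ?n" by (simp add: powr_qlog p)
  also have "\<dots> = 2 powr (4 + qlog ?n)" by (simp add: powr_add)
  finally have "real (22 + 16 * sz E) ^ (d + 1) \<le> (2 powr (4 + qlog ?n)) ^ (d + 1)"
    by (intro power_mono) auto
  also have "\<dots> = 2 powr ((4 + qlog ?n) * real (d + 1))"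
    by (rule trans[OF powr_realpow[symmetric] powr_powr]) simp
  \<comment> \<open>With \<open>q = qlog ?n\<close> the exponent is at most
    \<open>3 * q * (2 * q)\<close>, and \<open>6 * q ^ 2 \<le> q ^ 5\<close> because
    \<open>q\<close> is at least 2.\<close>
  also have "\<dots> \<le> 2 powr (qlog ?n ^ 5)"
  proof (intro powr_mono)
    have "(4 + qlog ?n) * real (d + 1) \<le> (3 * qlog ?n) * (2 * qlog ?n)"
      using two_le_qlog[of ?n] d(2) by (intro mult_mono) auto
    also have "\<dots> \<le> qlog ?n ^ 3 * qlog ?n ^ 2"
      using power_mono[OF two_le_qlog[of ?n], of 3] two_le_qlog[of ?n]
      by (simp add: power2_eq_square mult_right_mono)
    also have "\<dots> = qlog ?n ^ 5" by (simp flip: power_add)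
    finally show "(4 + qlog ?n) * real (d + 1) \<le> qlog ?n ^ 5" .
  qed simp
  finally have *: "real (22 + 16 * sz E) ^ (d + 1) \<le> 2 powr (qlog ?n ^ 5)" .
  have R: "real (sz (reach E I u v)) \<le> qbound 5 ?n" for u v
  proof -
    have "real (sz (reach E I u v)) \<le> real ((22 + 16 * sz E) ^ (d + 1))"
      using size_enc_reach[OF len] by (rule of_nat_mono)
    also have "\<dots> \<le> qbound 5 ?n" using * unfolding qbound_def of_nat_power .
    finally show ?thesis .
  qed
  have entry: "sz e \<le> nat \<lfloor>2 * real ?n + 2 + qbound 5 ?n\<rfloor>" if e: "e \<in> set (table E I)" for e
  proof -
    obtain u v where uv: "e = ((u, v), reach E I u v)" "u \<in> set I" "v \<in> set I"
      using e by (auto simp: table_def)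
    then have "real (sz e) \<le> 2 * real ?n + 2 + qbound 5 ?n"
      using R[of u v] elem_le_enc[OF uv(2)] elem_le_enc[OF uv(3)] by (simp add: p)
    then show ?thesis by linarith
  qed
  have "length I \<le> ?n" using length_le_enc[of I] by (simp add: p)
  from mult_le_mono[OF this this] have "length (table E I) \<le> ?n * ?n"
    by (simp only: table_def length_map length_pairs)
  from size_enc_list_le[OF this entry]
  have "real (sz (table E I)) \<le> real (?n * ?n * (nat \<lfloor>2 * real ?n + 2 + qbound 5 ?n\<rfloor> + 1))"
    by (meson of_nat_mono)
  also have "\<dots> \<le> real ?n * real ?n * (2 * real ?n + 3 + qbound 5 ?n)"
  proof -
    have "0 \<le> 2 * real ?n + 2 + qbound 5 ?n" using pos[of 5 ?n] by linarith
    then have "real (nat \<lfloor>2 * real ?n + 2 + qbound 5 ?n\<rfloor> + 1) \<le> 2 * real ?n + 3 + qbound 5 ?n" by linarith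
    then show ?thesis by (simp only: of_nat_mult) (intro mult_left_mono; simp)
  qed
  finally show "real (sz (table (fst p) (snd p))) \<le> real ?n * real ?n * (2 * real ?n + 3 + qbound 5 ?n)"
    by (simp add: p)
qed

lemma qp_table [qp_intros]:
  fixes f :: "'a :: encodable \<Rightarrow> ('n :: encodable \<times> form \<times> 'n) list"
  assumes "qp f" "qp g" shows "qp (\<lambda>x. table (f x) (g x))"
proof -
  let ?h = "\<lambda>p :: ('n \<times> form \<times> 'n) list \<times> 'n list. table (fst p) (snd p)"
  have "qp ?h"
  proof (rule qp_rec[where lf = "\<lambda>p. snd p = [] \<or> tl (snd p) = []" and
        a = "\<lambda>p. map (\<lambda>q. (q, Top)) (pairs (snd p) (snd p))" and
        l = "\<lambda>p. (fst p, fhalf (snd p))" and r = "\<lambda>p. (fst p, shalf (snd p))" and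
        m = "\<lambda>p. max 1 (length (snd p))" and
        g = "\<lambda>p s t. map (\<lambda>q. (q, FOr (FOr (lookup s q) (lookup t q))
          (Disj (map (\<lambda>e. FAnd (lookup s (fst q, fst e)) (FAnd (fst (snd e)) (lookup t (snd (snd e), snd q)))) (fst p)))))
          (pairs (snd p) (snd p))"])
    fix p :: "('n \<times> form \<times> 'n) list \<times> 'n list"
    obtain E I where p: "p = (E, I)" by (cases p)
    have 1: "snd p = [] \<or> tl (snd p) = [] \<longleftrightarrow> length I < 2" by (cases I) (auto simp: p neq_Nil_conv)
    have lt: "lookup (table E J) q = reach E J (fst q) (snd q)" for J q
      using lookup_table[of E J "fst q" "snd q"] by simp
    show "?h p = (if snd p = [] \<or> tl (snd p) = [] then map (\<lambda>q. (q, Top)) (pairs (snd p) (snd p)) else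
        map (\<lambda>q. (q, FOr (FOr (lookup (?h (fst p, fhalf (snd p))) q) (lookup (?h (fst p, shalf (snd p))) q))
          (Disj (map (\<lambda>e. FAnd (lookup (?h (fst p, fhalf (snd p))) (fst q, fst e)) (FAnd (fst (snd e))
            (lookup (?h (fst p, shalf (snd p))) (snd (snd e), snd q)))) (fst p)))))
          (pairs (snd p) (snd p)))"
      unfolding 1 by (auto simp: p lt reach.simps[of E I] table_def[of E I])
    \<comment> \<open>\<open>max 1\<close> keeps the measure positive on the empty list; two or more
      elements split into nonempty halves, whose lengths add up.\<close>
    show "0 < max 1 (length (snd p))" by simp
    show "sz (fst p, fhalf (snd p)) \<le> sz p" "sz (fst p, shalf (snd p)) \<le> sz p"
      using size_enc_append[of "fhalf I" "shalf I"] by (auto simp: p fhalf_def shalf_def)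
    assume "\<not> (snd p = [] \<or> tl (snd p) = [])"
    then have "2 \<le> length I" unfolding 1 by simp
    then show "max 1 (length (snd (fst p, fhalf (snd p)))) + max 1 (length (snd (fst p, shalf (snd p))))
      \<le> max 1 (length (snd p))" by (auto simp: p fhalf_def shalf_def)
  next
    show "qpb (\<lambda>p :: ('n \<times> form \<times> 'n) list \<times> 'n list. max 1 (length (snd p)))"
    proof (rule qpb_le[OF qpb_add[OF qpb_size qpb_const[of 1]]])
      show "max 1 (length (snd p)) \<le> sz p + 1" for p :: "('n \<times> form \<times> 'n) list \<times> 'n list"
        using length_le_enc[of "snd p"] by (cases p) auto
    qed
    show "qpb (\<lambda>p. sz (?h p))" by (rule qpb_table)
  qed (intro qp_intros)+
  from qp_comp[OF this qp_pair[OF assms]] show ?thesis by simp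
qed

section \<open>The translating program\<close>

text \<open>The newest axiom comes first: its right-hand side refers only to smaller indices, so
  this order is topological.\<close>

definition ext_pairs :: "endt list \<Rightarrow> (endt \<times> endt) list" where
  "ext_pairs E = concat (map (\<lambda>s. case s of [] \<Rightarrow> [] | A # r \<Rightarrow> [(Ext (length r), A)]) (suffixes (rev E)))"

text \<open>Every edge leads from a node to a later one; \<open>remdups\<close> keeps last occurrences, which preserves
  this. \<open>None\<close> is the accepting sink.\<close>

definition nodes :: "ext_proof \<Rightarrow> endt list" where
  "nodes \<pi> = remdups (concat (map (\<lambda>l. concat (map subs (fst l @ snd l))) (snd \<pi>)) @
     concat (map (\<lambda>p. fst p # subs (snd p)) (ext_pairs (fst \<pi>))))"

type_synonym node = "endt option"

text \<open>The branching program: a label is the test passed along the edge, and \<open>Top\<close>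
  marks unconditional edges. At most two edges leave a node, which later keeps the sequents
  narrow.\<close>

definition out_edges :: "(endt \<times> endt) list \<Rightarrow> endt \<Rightarrow> (node \<times> form \<times> node) list" where
  "out_edges D A = (case A of
     Lit p \<Rightarrow> [(Some A, FLit p, None)]
   | Ext i \<Rightarrow> map (\<lambda>q. (Some A, Top, Some (snd q))) (filter (\<lambda>q. fst q = A) D)
   | Dec B p C \<Rightarrow> [(Some A, FLit (dual p), Some B), (Some A, FLit p, Some C)]
   | Or B C \<Rightarrow> [(Some A, Top, Some B), (Some A, Top, Some C)])"

definition edges :: "ext_proof \<Rightarrow> (node \<times> form \<times> node) list" where
  "edges \<pi> = concat (map (out_edges (ext_pairs (fst \<pi>))) (nodes \<pi>))"

definition interval :: "ext_proof \<Rightarrow> node list" where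
  "interval \<pi> = map Some (nodes \<pi>) @ [None]"

definition reach_table :: "ext_proof \<Rightarrow> ((node \<times> node) \<times> form) list" where
  "reach_table \<pi> = table (edges \<pi>) (interval \<pi>)"

definition translate :: "ext_proof \<Rightarrow> endt \<Rightarrow> form" where
  "translate \<pi> A = lookup (reach_table \<pi>) (Some A, None)"

text \<open>The reservoir of cut formulas. Applying \<open>sforms\<close> closes it under
  subformulas and puts it into an order in which the initial lines can be derived.\<close>

definition formulas :: "ext_proof \<Rightarrow> form list" where
  "formulas \<pi> = concat (map sforms (Top # Bot # map (\<lambda>e. fst (snd e)) (edges \<pi>) @
     map snd (reach_table \<pi>) @
     map (\<lambda>A. Disj (Tms_list A)) (nodes \<pi>) @ map (\<lambda>A. Conj (Cls_list A)) (nodes \<pi>)))"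

definition goal_line :: "ext_proof \<Rightarrow> form line" where
  "goal_line \<pi> = (let l = hd (rev (snd \<pi>)) in (concat (map Cls_list (fst l)), concat (map Tms_list (snd l))))"

definition translate_line :: "ext_proof \<Rightarrow> endt line \<Rightarrow> form line" where
  "translate_line \<pi> l = (map (translate \<pi>) (fst l), map (translate \<pi>) (snd l))"

text \<open>After the translated lines come the contexts of the steps that replace, one by one, the
  translations in the last line by \<open>Cls\<close> and \<open>Tms\<close>.\<close>

definition contexts :: "ext_proof \<Rightarrow> form line list" where
  "contexts \<pi> = (let L = map (translate_line \<pi>) (snd \<pi>); l = hd (rev L); g = goal_line \<pi> in L @
     map (\<lambda>s. (fst g @ s, snd g @ snd l)) (suffixes (fst l)) @
     map (\<lambda>s. (fst g, snd g @ s)) (suffixes (snd l)))"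

section \<open>Narrow sequents and their saturation under cut\<close>

primrec lists_upto :: "nat \<Rightarrow> 'a list \<Rightarrow> 'a list list" where
  "lists_upto 0 xs = [[]]"
| "lists_upto (Suc n) xs = [] # concat (map (\<lambda>x. map (\<lambda>l. x # l) (lists_upto n xs)) xs)"

text \<open>The derived rules for connectives allow six formulas on a side and add the principal
  formula and an auxiliary one.\<close>

definition width :: nat where "width = 8"

definition candidates :: "ext_proof \<Rightarrow> form line list" where
  "candidates \<pi> = concat (map (\<lambda>c. map (\<lambda>p. (fst c @ fst p, snd c @ snd p))
     (pairs (lists_upto width (formulas \<pi>)) (lists_upto width (formulas \<pi>)))) (contexts \<pi>))"

text \<open>As many rounds of all possible cuts as there are candidates; the variable
  \<open>c\<close> merely counts rounds.\<close>

definition jobs :: "ext_proof \<Rightarrow> (form line \<times> form) list" where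
  "jobs \<pi> = concat (map (\<lambda>c. pairs (candidates \<pi>) (formulas \<pi>)) (candidates \<pi>))"

definition subsumes :: "form line \<Rightarrow> form line \<Rightarrow> bool" where
  "subsumes k t \<longleftrightarrow> set (fst k) \<subseteq> set (fst t) \<and> set (snd k) \<subseteq> set (snd t)"

text \<open>A chain from \<open>k\<close> to \<open>t\<close>: the formulas of \<open>t\<close> are
  added one by one, then those of \<open>k\<close> are contracted away, on the left and afterwards
  on the right. It works whenever the cedents are included as sets, so multiplicities need not be
  tracked.\<close>

definition weakening :: "form line \<Rightarrow> form line \<Rightarrow> form line list" where
  "weakening k t =
     rev (map (\<lambda>s. (s @ fst k, snd k)) (suffixes (fst t))) @ map (\<lambda>s. (fst t @ s, snd k)) (suffixes (fst k)) @
     rev (map (\<lambda>s. (fst t, s @ snd k)) (suffixes (snd t))) @ map (\<lambda>s. (fst t, snd t @ s)) (suffixes (snd k))"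

text \<open>A derived line with the lines that derive it from earlier entries; the newest entry comes first.\<close>

type_synonym entry = "form line \<times> form line list"

definition known :: "entry list \<Rightarrow> form line \<Rightarrow> entry list" where
  "known st t = filter (\<lambda>e. subsumes (fst e) t) st"

definition cut_entry :: "form line \<Rightarrow> form line \<Rightarrow> form line \<times> form \<Rightarrow> entry" where
  "cut_entry k k' j = (fst j, weakening k (fst (fst j), snd j # snd (fst j)) @
     weakening k' (snd j # fst (fst j), snd (fst j)) @ [fst j])"

definition step :: "form line \<times> form \<Rightarrow> entry list \<Rightarrow> entry list" where
  "step j st =
    (if known st (fst j) \<noteq> [] \<or> known st (fst (fst j), snd j # snd (fst j)) = [] \<or>
        known st (snd j # fst (fst j), snd (fst j)) = [] then st
     else cut_entry (fst (hd (known st (fst (fst j), snd j # snd (fst j)))))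
        (fst (hd (known st (snd j # fst (fst j), snd (fst j))))) j # st)"

definition axiom_entries :: "ext_proof \<Rightarrow> entry list" where
  "axiom_entries \<pi> = rev (map (\<lambda>l. (l, [l])) (concat (map ax_lines (formulas \<pi>))))"

definition saturation :: "ext_proof \<Rightarrow> entry list" where
  "saturation \<pi> = foldr step (jobs \<pi>) (axiom_entries \<pi>)"

definition simulation :: "ext_proof \<Rightarrow> lk_proof" where
  "simulation \<pi> = concat (map snd (rev (saturation \<pi>))) @
     weakening (fst (hd (known (saturation \<pi>) (goal_line \<pi>)))) (goal_line \<pi>)"

section \<open>Running time of the translation and the search\<close>

lemma qp_ext_pairs: "qp ext_pairs"
  unfolding ext_pairs_def by (intro qp_list_case qp_intros)

lemma qp_nodes: "qp nodes"
  unfolding nodes_def by (intro qp_comp[OF qp_ext_pairs] qp_intros)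

lemma qp_out_edges: "qp D \<Longrightarrow> qp A \<Longrightarrow> qp (\<lambda>x. out_edges (D x) (A x))"
proof -
  have "qp (\<lambda>p. out_edges (fst p) (snd p))"
    unfolding out_edges_def by (intro qp_endt_case qp_intros)
  from qp_comp[OF this qp_pair] show "qp D \<Longrightarrow> qp A \<Longrightarrow> qp (\<lambda>x. out_edges (D x) (A x))" by simp
qed

lemma qp_edges: "qp edges"
  unfolding edges_def by (intro qp_out_edges qp_comp[OF qp_ext_pairs] qp_comp[OF qp_nodes] qp_intros)

lemma qp_interval: "qp interval"
  unfolding interval_def by (intro qp_comp[OF qp_nodes] qp_intros)

lemma qp_reach_table: "qp reach_table"
  unfolding reach_table_def by (intro qp_comp[OF qp_edges] qp_comp[OF qp_interval] qp_intros)

lemma qp_translate_line: assumes "qp l" "qp \<pi>" shows "qp (\<lambda>x. translate_line (\<pi> x) (l x))"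
  unfolding translate_line_def translate_def
  by (intro qp_comp[OF qp_reach_table] qp_intros qp_comp[OF assms(1)] qp_comp[OF assms(2)] assms)

lemma qp_formulas: "qp formulas"
  unfolding formulas_def
  by (intro qp_comp[OF qp_edges] qp_comp[OF qp_reach_table] qp_comp[OF qp_nodes] qp_intros)

lemma qp_goal_line: "qp goal_line"
  unfolding goal_line_def Let_def by (intro qp_intros)

lemma qp_contexts: "qp contexts"
  unfolding contexts_def Let_def by (intro qp_translate_line qp_comp[OF qp_goal_line] qp_intros)

text \<open>The length bound is fixed outside of the program, which contains one nested loop for
  each unit of it; the exponent of the time bound may grow with it.\<close>

lemma qp_lists_upto: "qp f \<Longrightarrow> qp (\<lambda>x. lists_upto n (f x))"
proof (induction n)
  case 0
  show ?case by (simp add: qp_const)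
next
  case (Suc n)
  show ?case unfolding lists_upto.simps
    by (intro qp_intros qp_comp[OF Suc.IH] Suc.prems)
qed

lemma qp_candidates: "qp candidates"
  unfolding candidates_def
  by (intro qp_lists_upto qp_comp[OF qp_formulas] qp_comp[OF qp_contexts] qp_intros)

lemma qp_jobs: "qp jobs"
  unfolding jobs_def by (intro qp_comp[OF qp_candidates] qp_comp[OF qp_formulas] qp_intros)

lemma qp_weakening:
  assumes "qp k" "qp t" shows "qp (\<lambda>x. weakening (k x) (t x))"
  unfolding weakening_def by (intro qp_intros qp_comp[OF assms(1)] qp_comp[OF assms(2)] assms)

lemma qp_known: assumes "qp s" "qp t" shows "qp (\<lambda>x. known (s x) (t x))"
  unfolding known_def subsumes_def by (intro qp_intros qp_comp[OF assms(2)] assms)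

lemma qp_cut_entry: assumes "qp k" "qp k'" "qp j" shows "qp (\<lambda>x. cut_entry (k x) (k' x) (j x))"
  unfolding cut_entry_def by (intro qp_weakening qp_intros assms)

lemma qp_axiom_entries: "qp axiom_entries"
  unfolding axiom_entries_def by (intro qp_comp[OF qp_formulas] qp_intros)

lemma known_subset: "set (known st t) \<subseteq> set st"
  by (auto simp: known_def)

text \<open>The lines stored in an entry are computed from two known lines and a job, never from
  stored derivations. A known line is an initial one or the target of a job and thus no larger than
  the input; hence all entries obey one bound and their sizes add up over the jobs.\<close>

lemma saturation_bound:
  "qpb (\<lambda>p :: entry list \<times> (form line \<times> form) list. sz (foldr step (snd p) (fst p)))"
proof -
  have "qp (\<lambda>q. cut_entry (fst q) (fst (snd q)) (snd (snd q)))" by (intro qp_cut_entry qp_intros)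
  from qp_size[OF this] obtain k where
    k: "\<And>q. real (sz (cut_entry (fst q) (fst (snd q)) (snd (snd q)))) \<le> qbound k (sz q)"
    unfolding qpb_def by blast
  show ?thesis
  proof (rule qpbI)
    have pos: "0 \<le> qbound k n" for n using two_le_qbound[of k n] by simp
    show "quasi (\<lambda>n. real n + real n * (1 + qbound k (nat \<lfloor>3 * real n + 2\<rfloor>)))"
      by (intro quasi_add quasi_mult quasi_const quasi_ident quasi_comp) (simp_all add: add_nonneg_nonneg pos)
    fix p :: "entry list \<times> (form line \<times> form) list"
    obtain K js where p: "p = (K, js)" by (cases p)
    let ?n = "sz p"
    let ?Q = "qbound k (nat \<lfloor>3 * real ?n + 2\<rfloor>)"
    have "real (sz (foldr step is K)) \<le> real ?n + real (length is) * (1 + ?Q) \<and>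
        (\<forall>e\<in>set (foldr step is K). sz (fst e) \<le> ?n)" if "set is \<subseteq> set js" for "is"
      using that
    proof (induction "is")
      case Nil
      have "sz (fst e) \<le> ?n" if "e \<in> set K" for e
        using elem_le_enc[OF that] by (cases e) (simp add: p)
      then show ?case by (simp add: p)
    next
      case (Cons j js')
      let ?st = "foldr step js' K"
      have IH: "real (sz ?st) \<le> real ?n + real (length js') * (1 + ?Q)"
        "\<And>e. e \<in> set ?st \<Longrightarrow> sz (fst e) \<le> ?n"
        using Cons by auto
      have j: "sz j \<le> ?n" using elem_le_enc[of j js] Cons.prems by (simp add: p)
      consider "step j ?st = ?st"
        | e e' where "e \<in> set ?st" "e' \<in> set ?st" "step j ?st = cut_entry (fst e) (fst e') j # ?st"
      proof (cases "step j ?st = ?st")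
        case False
        let ?t = "(fst (fst j), snd j # snd (fst j))" and ?t' = "(snd j # fst (fst j), snd (fst j))"
        from False have "known ?st ?t \<noteq> []" "known ?st ?t' \<noteq> []"
          "step j ?st = cut_entry (fst (hd (known ?st ?t))) (fst (hd (known ?st ?t'))) j # ?st"
          unfolding step_def by (auto split: if_splits)
        then show thesis using that(2) known_subset hd_in_set by blast
      qed
      then show ?case
      proof cases
        case 1
        have "0 \<le> 1 + ?Q" using pos by (simp add: add_nonneg_nonneg)
        with 1 IH show ?thesis by (simp add: algebra_simps)
      next
        case 2
        have "real (sz (fst e, fst e', j)) \<le> 3 * real ?n + 2"
          using IH(2)[OF 2(1)] IH(2)[OF 2(2)] j by simp
        then have "sz (fst e, fst e', j) \<le> nat \<lfloor>3 * real ?n + 2\<rfloor>" by linarith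
        from qbound_mono[OF order_refl this, of k] k[of "(fst e, fst e', j)"]
        have "real (sz (cut_entry (fst e) (fst e') j)) \<le> ?Q" by simp
        moreover have "sz (fst (cut_entry (fst e) (fst e') j)) \<le> ?n"
          using j by (cases j) (simp add: cut_entry_def)
        ultimately show ?thesis using IH 2(3) by (simp add: algebra_simps)
      qed
    qed
    from this[of js] have "real (sz (foldr step js K)) \<le> real ?n + real (length js) * (1 + ?Q)" by blast
    moreover have "length js \<le> ?n" using length_le_enc[of js] by (simp add: p)
    then have "real (length js) * (1 + ?Q) \<le> real ?n * (1 + ?Q)"
      using pos by (intro mult_right_mono) (simp_all add: add_nonneg_nonneg)
    ultimately show "real (sz (foldr step (snd p) (fst p))) \<le> real ?n + real ?n * (1 + ?Q)"
      by (simp add: p)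
  qed
qed

lemma qp_step: assumes "qp j" "qp st" shows "qp (\<lambda>x. step (j x) (st x))"
  unfolding step_def by (intro qp_cut_entry qp_known qp_intros assms)

lemma qp_saturation: "qp saturation"
proof -
  have "qp (\<lambda>p :: entry list \<times> (form line \<times> form) list. foldr step (snd p) (fst p))"
  proof (rule qp_foldr_gen[where s = "\<lambda>_. step" and l = snd and i = fst])
    show "qpb (\<lambda>q :: (entry list \<times> (form line \<times> form) list) \<times> (form line \<times> form) list.
        sz (foldr step (snd q) (fst (fst q))))"
      using qpb_comp[OF saturation_bound qp_pair[OF qp_fst[OF qp_fst[OF qp_id]] qp_snd[OF qp_id]]] by simp
  qed (intro qp_step qp_intros)+
  from qp_comp[OF this qp_pair[OF qp_axiom_entries qp_jobs]]
  show ?thesis unfolding saturation_def by simp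
qed

lemma qp_simulation: "qp simulation"
  unfolding simulation_def
  by (intro qp_weakening qp_known qp_comp[OF qp_saturation] qp_comp[OF qp_goal_line] qp_intros)

section \<open>Cut-closed families of sequents\<close>

lemma self_in_sforms: "f \<in> set (sforms f)"
  by (cases f) auto

lemma halves_append: "fhalf I @ shalf I = I"
  by (simp add: fhalf_def shalf_def)

lemma set_halves: "set I = set (fhalf I) \<union> set (shalf I)"
  by (metis halves_append set_append)

text \<open>Phrased by splits because halving is a split, and a split of a half extends to a split
  of the whole interval.\<close>

definition ordered :: "('n \<times> form \<times> 'n) list \<Rightarrow> 'n list \<Rightarrow> bool" where
  "ordered E I \<longleftrightarrow> (\<forall>P Q x l y. I = P @ Q \<longrightarrow> (x, l, y) \<in> set E \<longrightarrow> \<not> (x \<in> set Q \<and> y \<in> set P))"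

lemma ordered_halves:
  assumes "ordered E I"
  shows "ordered E (fhalf I)" "ordered E (shalf I)"
proof -
  have "P @ (Q @ shalf I) = I" if "fhalf I = P @ Q" for P Q
    using that halves_append[of I] by simp
  with assms show "ordered E (fhalf I)" unfolding ordered_def by (metis Un_iff set_append)
  have "(fhalf I @ P) @ Q = I" if "shalf I = P @ Q" for P Q
    using that halves_append[of I] by simp
  with assms show "ordered E (shalf I)" unfolding ordered_def by (metis Un_iff set_append)
qed

lemma orderedD: "ordered E I \<Longrightarrow> (x, l, y) \<in> set E \<Longrightarrow> y \<in> set (fhalf I) \<Longrightarrow> x \<notin> set (shalf I)"
  using halves_append[of I] unfolding ordered_def by metis

lemma reach_outside: "u \<notin> set I \<or> v \<notin> set I \<Longrightarrow> reach E I u v = Bot"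
  by (simp add: reach.simps)

lemma reach_inside:
  "u \<in> set I \<Longrightarrow> v \<in> set I \<Longrightarrow> 2 \<le> length I \<Longrightarrow> reach E I u v =
     FOr (FOr (reach E (fhalf I) u v) (reach E (shalf I) u v))
       (Disj (crossings E I u v))"
  by (subst reach.simps) auto

lemma Disj_simps: "Disj [] = Bot" "Disj (f # fs) = FOr f (Disj fs)"
  by (simp_all add: Disj_def)

lemma Conj_simps: "Conj [] = Top" "Conj (f # fs) = FAnd f (Conj fs)"
  by (simp_all add: Conj_def)

text \<open>\<open>kn X Y\<close> stands for: a subsequent of \<open>X \<longrightarrow> Y\<close>, up to a context, has been derived.\<close>

locale cut_closed =
  fixes F :: "form set" and kn :: "form set \<Rightarrow> form set \<Rightarrow> bool"
  assumes mono: "kn X Y \<Longrightarrow> X \<subseteq> X' \<Longrightarrow> Y \<subseteq> Y' \<Longrightarrow> kn X' Y'"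
    and ax: "f \<in> F \<Longrightarrow> l \<in> set (ax_lines f) \<Longrightarrow> kn (set (fst l)) (set (snd l))"
    and sub: "f \<in> F \<Longrightarrow> set (sforms f) \<subseteq> F"
    and Top: "Top \<in> F" and Bot: "Bot \<in> F"
    and cut_narrow: "f \<in> F \<Longrightarrow> X \<union> Y \<subseteq> F \<Longrightarrow> finite X \<Longrightarrow> card X \<le> width \<Longrightarrow> finite Y \<Longrightarrow> card Y \<le> width \<Longrightarrow>
      kn (insert f X) Y \<Longrightarrow> kn X (insert f Y) \<Longrightarrow> kn X Y"
begin

definition narrow :: "nat \<Rightarrow> form set \<Rightarrow> bool" where
  "narrow n X \<longleftrightarrow> X \<subseteq> F \<and> finite X \<and> card X \<le> n"

lemma narrow_empty [simp]: "narrow n {}"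
  by (simp add: narrow_def)

lemma narrow_insert [intro!]: "a \<in> F \<Longrightarrow> narrow (n - 1) X \<Longrightarrow> 0 < n \<Longrightarrow> narrow n (insert a X)"
  by (auto simp: narrow_def card_insert_if)

lemma narrow_mono: "narrow m X \<Longrightarrow> m \<le> n \<Longrightarrow> narrow n X"
  by (auto simp: narrow_def)

lemma narrow_subset: "narrow n Y \<Longrightarrow> X \<subseteq> Y \<Longrightarrow> narrow n X"
  unfolding narrow_def by (meson card_mono finite_subset order_trans)

lemma narrow_union: "narrow m X \<Longrightarrow> narrow n Y \<Longrightarrow> narrow (m + n) (X \<union> Y)"
  unfolding narrow_def using card_Un_le[of X Y] by auto

lemma and_sub: "FAnd A B \<in> F \<Longrightarrow> A \<in> F" "FAnd A B \<in> F \<Longrightarrow> B \<in> F"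
  and or_sub: "FOr A B \<in> F \<Longrightarrow> A \<in> F" "FOr A B \<in> F \<Longrightarrow> B \<in> F"
  using sub[of "FAnd A B"] sub[of "FOr A B"] self_in_sforms[of A] self_in_sforms[of B] by auto

lemma and_subE: "FAnd A B \<in> F \<Longrightarrow> (A \<in> F \<Longrightarrow> B \<in> F \<Longrightarrow> P) \<Longrightarrow> P"
  and or_subE: "FOr A B \<in> F \<Longrightarrow> (A \<in> F \<Longrightarrow> B \<in> F \<Longrightarrow> P) \<Longrightarrow> P"
  using and_sub or_sub by blast+

text \<open>Cut with weakening built in. The width restricts only the conclusion, so the cut formula
  may come on top of eight formulas.\<close>

lemma cut:
  assumes "f \<in> F" "kn X1 Y1" "kn X2 Y2"
    and "X1 \<subseteq> X" "Y1 \<subseteq> insert f Y" "X2 \<subseteq> insert f X" "Y2 \<subseteq> Y"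
    and "narrow 8 X" "narrow 8 Y"
  shows "kn X Y"
proof (rule cut_narrow[OF assms(1)])
  show "kn (insert f X) Y" by (rule mono[OF assms(3)]) (use assms in auto)
  show "kn X (insert f Y)" by (rule mono[OF assms(2)]) (use assms in auto)
qed (use assms in \<open>auto simp: narrow_def width_def\<close>)

lemma ident: "f \<in> F \<Longrightarrow> f \<in> X \<Longrightarrow> f \<in> Y \<Longrightarrow> kn X Y"
proof -
  assume "f \<in> F" "f \<in> X" "f \<in> Y"
  have "kn {f} {f}" using ax[OF \<open>f \<in> F\<close>, of "([f], [f])"] by (cases f) auto
  then show ?thesis by (rule mono) (use \<open>f \<in> X\<close> \<open>f \<in> Y\<close> in auto)
qed

section \<open>Derived rules for literals, connectives and lists\<close>

lemma lit_left: "FLit p \<in> F \<Longrightarrow> kn {FLit p, FLit (dual p)} {}"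
  and lit_right: "FLit p \<in> F \<Longrightarrow> kn {} {FLit p, FLit (dual p)}"
  using ax[of "FLit p" "([FLit p, FLit (dual p)], [])"] ax[of "FLit p" "([], [FLit p, FLit (dual p)])"] by auto

text \<open>Two cuts, against the projections from \<open>FAnd A B\<close> to \<open>A\<close> and
  to \<open>B\<close>. The inner conclusion has \<open>FAnd A B\<close> and \<open>A\<close> beside
  \<open>X\<close>: six formulas plus two. The other connective rules follow the same
  pattern.\<close>

lemma and_left:
  assumes F: "FAnd A B \<in> F" and X: "narrow 6 X" and Y: "narrow 6 Y"
    and kn: "kn (insert A (insert B X)) Y"
  shows "kn (insert (FAnd A B) X) Y"
proof (rule cut[where f = A and X = "insert (FAnd A B) X" and Y = Y])
  show "kn {FAnd A B} {A}" using ax[OF F, of "([FAnd A B], [A])"] by simp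
  show "kn (insert A (insert (FAnd A B) X)) Y"
  proof (rule cut[where f = B])
    show "kn {FAnd A B} {B}" using ax[OF F, of "([FAnd A B], [B])"] by simp
  qed (use kn and_sub[OF F] F narrow_mono[OF Y] narrow_mono[OF X] in auto)
qed (use and_sub[OF F] F narrow_mono[OF Y] narrow_mono[OF X] in auto)

lemma and_right:
  assumes F: "FAnd A B \<in> F" and X: "narrow 6 X" and Y: "narrow 6 Y"
    and kn: "kn X (insert A Y)" "kn X (insert B Y)"
  shows "kn X (insert (FAnd A B) Y)"
proof (rule cut[where f = A and X = X and Y = "insert (FAnd A B) Y"])
  show "kn X (insert A Y)" by (rule kn)
  show "kn (insert A X) (insert (FAnd A B) Y)"
  proof (rule cut[where f = B])
    show "kn X (insert B Y)" by (rule kn)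
    show "kn {A, B} {FAnd A B}" using ax[OF F, of "([A, B], [FAnd A B])"] by simp
  qed (use and_sub[OF F] F narrow_mono[OF Y] narrow_mono[OF X] in auto)
qed (use and_sub[OF F] F narrow_mono[OF Y] narrow_mono[OF X] in auto)

lemma or_left:
  assumes F: "FOr A B \<in> F" and X: "narrow 6 X" and Y: "narrow 6 Y"
    and kn: "kn (insert A X) Y" "kn (insert B X) Y"
  shows "kn (insert (FOr A B) X) Y"
proof (rule cut[where f = A and X = "insert (FOr A B) X" and Y = Y])
  show "kn (insert (FOr A B) X) (insert A Y)"
  proof (rule cut[where f = B])
    show "kn {FOr A B} {A, B}" using ax[OF F, of "([FOr A B], [A, B])"] by simp
    show "kn (insert B X) Y" by (rule kn)
  qed (use or_sub[OF F] F narrow_mono[OF Y] narrow_mono[OF X] in auto)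
  show "kn (insert A X) Y" by (rule kn)
qed (use or_sub[OF F] F narrow_mono[OF Y] narrow_mono[OF X] in auto)

lemma or_right:
  assumes F: "FOr A B \<in> F" and X: "narrow 6 X" and Y: "narrow 6 Y"
    and kn: "kn X (insert A (insert B Y))"
  shows "kn X (insert (FOr A B) Y)"
proof (rule cut[where f = A and X = X and Y = "insert (FOr A B) Y"])
  show "kn X (insert A (insert (FOr A B) Y))"
  proof (rule cut[where f = B])
    show "kn X (insert A (insert B Y))" by (rule kn)
    show "kn {B} {FOr A B}" using ax[OF F, of "([B], [FOr A B])"] by simp
  qed (use or_sub[OF F] F narrow_mono[OF Y] narrow_mono[OF X] in auto)
  show "kn {A} {FOr A B}" using ax[OF F, of "([A], [FOr A B])"] by simp
qed (use or_sub[OF F] F narrow_mono[OF Y] narrow_mono[OF X] in auto)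

lemma Bot_left: "Bot \<in> X \<Longrightarrow> kn X Y"
proof -
  assume "Bot \<in> X"
  have "kn {Bot} {}" unfolding Bot_def
  proof (rule and_left)
    show "kn {FLit (Pos 0), FLit (Neg 0)} {}"
      using lit_left[of "Pos 0"] and_sub[OF Bot[unfolded Bot_def]] by simp
  qed (use Bot in \<open>auto simp: Bot_def\<close>)
  then show ?thesis by (rule mono) (use \<open>Bot \<in> X\<close> in auto)
qed

lemma Top_right: "Top \<in> Y \<Longrightarrow> kn X Y"
proof -
  assume "Top \<in> Y"
  have "kn {} {Top}" unfolding Top_def
  proof (rule or_right)
    show "kn {} {FLit (Pos 0), FLit (Neg 0)}"
      using lit_right[of "Pos 0"] or_sub[OF Top[unfolded Top_def]] by simp
  qed (use Top in \<open>auto simp: Top_def\<close>)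
  then show ?thesis by (rule mono) (use \<open>Top \<in> Y\<close> in auto)
qed

lemma Disj_elem: "Disj fs \<in> F \<Longrightarrow> f \<in> set fs \<Longrightarrow> f \<in> F"
proof (induction fs)
  case (Cons g fs)
  from Cons.prems(1) have "FOr g (Disj fs) \<in> F" by (simp only: Disj_simps)
  from or_sub[OF this] Cons show ?case by auto
qed simp

lemma Conj_elem: "Conj fs \<in> F \<Longrightarrow> f \<in> set fs \<Longrightarrow> f \<in> F"
proof (induction fs)
  case (Cons g fs)
  from Cons.prems(1) have "FAnd g (Conj fs) \<in> F" by (simp only: Conj_simps)
  from and_sub[OF this] Cons show ?case by auto
qed simp

lemma Disj_left:
  assumes "Disj fs \<in> F" "narrow 6 X" "narrow 6 Y" "\<And>f. f \<in> set fs \<Longrightarrow> kn (insert f X) Y"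
  shows "kn (insert (Disj fs) X) Y"
  using assms(1,4)
proof (induction fs)
  case Nil
  then show ?case by (simp add: Disj_simps Bot_left)
next
  case (Cons f fs)
  have F: "FOr f (Disj fs) \<in> F" using Cons.prems(1) by (simp only: Disj_simps)
  show ?case unfolding Disj_simps
    by (rule or_left[OF F assms(2,3) Cons.prems(2) Cons.IH[OF or_sub(2)[OF F] Cons.prems(2)]]) simp_all
qed

lemma Disj_right:
  assumes "Disj fs \<in> F" "f \<in> set fs" "narrow 5 X" "narrow 5 Y" "kn X (insert f Y)"
  shows "kn X (insert (Disj fs) Y)"
  using assms(1,2)
proof (induction fs)
  case (Cons g fs)
  show ?case unfolding Disj_simps
  proof (rule or_right)
    show "kn X (insert g (insert (Disj fs) Y))"
    proof (cases "f = g")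
      case True
      then show ?thesis by (intro mono[OF assms(5)]) auto
    next
      case False
      then have "f \<in> set fs" using Cons.prems(2) by simp
      moreover have "Disj fs \<in> F" using Cons.prems(1) unfolding Disj_simps by (rule or_sub)
      ultimately show ?thesis by (intro mono[OF Cons.IH]) auto
    qed
  qed (use Cons.prems(1) narrow_mono[OF assms(3), of 6] narrow_mono[OF assms(4), of 6] in \<open>simp_all add: Disj_simps\<close>)
qed simp

lemma Conj_right:
  assumes "Conj fs \<in> F" "narrow 6 X" "narrow 6 Y" "\<And>f. f \<in> set fs \<Longrightarrow> kn X (insert f Y)"
  shows "kn X (insert (Conj fs) Y)"
  using assms(1,4)
proof (induction fs)
  case Nil
  then show ?case by (simp add: Conj_simps Top_right)
next
  case (Cons f fs)
  have F: "FAnd f (Conj fs) \<in> F" using Cons.prems(1) by (simp only: Conj_simps)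
  show ?case unfolding Conj_simps
    by (rule and_right[OF F assms(2,3) Cons.prems(2) Cons.IH[OF and_sub(2)[OF F] Cons.prems(2)]]) simp_all
qed

lemma Conj_left:
  assumes "Conj fs \<in> F" "f \<in> set fs" "narrow 5 X" "narrow 5 Y" "kn (insert f X) Y"
  shows "kn (insert (Conj fs) X) Y"
  using assms(1,2)
proof (induction fs)
  case (Cons g fs)
  show ?case unfolding Conj_simps
  proof (rule and_left)
    show "kn (insert g (insert (Conj fs) X)) Y"
    proof (cases "f = g")
      case True
      then show ?thesis by (intro mono[OF assms(5)]) auto
    next
      case False
      then have "f \<in> set fs" using Cons.prems(2) by simp
      moreover have "Conj fs \<in> F" using Cons.prems(1) unfolding Conj_simps by (rule and_sub)
      ultimately show ?thesis by (intro mono[OF Cons.IH]) auto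
    qed
  qed (use Cons.prems(1) narrow_mono[OF assms(3), of 6] narrow_mono[OF assms(4), of 6] in \<open>simp_all add: Conj_simps\<close>)
qed simp

text \<open>The elements of \<open>A\<close> are cut one after another; those still to be cut remain
  on the right, hence the width condition on \<open>A \<union> Y\<close>.\<close>

lemma multicut:
  assumes "finite A" "narrow 8 X" "narrow 8 (A \<union> Y)" "kn X (A \<union> Y)" "\<And>a. a \<in> A \<Longrightarrow> kn (insert a X) Y"
  shows "kn X Y"
  using assms(1,3,4,5)
proof (induction A)
  case (insert a A)
  have "A \<union> Y \<subseteq> insert a A \<union> Y" by auto
  then have n: "narrow 8 (A \<union> Y)" by (rule narrow_subset[OF insert.prems(1)])
  have a: "a \<in> F" using insert.prems(1) by (auto simp: narrow_def)
  show ?case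
  proof (rule insert.IH)
    show "kn X (A \<union> Y)"
      by (rule cut[OF a insert.prems(2) insert.prems(3)[of a]]) (use n assms(2) in auto)
    show "kn (insert b X) Y" if "b \<in> A" for b using that by (intro insert.prems(3)) simp
  qed (rule n)
qed simp

section \<open>Laws of the reachability formulas\<close>

definition block :: "('n \<times> form \<times> 'n) list \<Rightarrow> 'n list \<Rightarrow> bool" where
  "block E I \<longleftrightarrow> (\<forall>u v. reach E I u v \<in> F)"

lemma block_reach: "block E I \<Longrightarrow> reach E I u v \<in> F"
  by (simp add: block_def)

text \<open>For end points in the half, the formula is a subformula of one for \<open>I\<close>; for
  all others it is \<open>Bot\<close>.\<close>

lemma block_halves:
  assumes "block E I" "2 \<le> length I"
  shows "block E (fhalf I)" "block E (shalf I)"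
proof -
  have *: "reach E (fhalf I) u v \<in> F" "reach E (shalf I) u v \<in> F" if "u \<in> set I" "v \<in> set I" for u v
  proof -
    have "FOr (reach E (fhalf I) u v) (reach E (shalf I) u v) \<in> F"
      using block_reach[OF assms(1), of u v] unfolding reach_inside[OF that assms(2)] by (rule or_sub)
    then show "reach E (fhalf I) u v \<in> F" "reach E (shalf I) u v \<in> F" by (auto elim!: or_subE)
  qed
  have "reach E (fhalf I) u v \<in> F" for u v
  proof (cases "u \<in> set (fhalf I) \<and> v \<in> set (fhalf I)")
    case True
    then show ?thesis by (intro *) (simp_all add: set_halves[of I])
  next
    case False
    then have "reach E (fhalf I) u v = Bot" by (intro reach_outside) blast
    then show ?thesis using Bot by simp
  qed
  then show "block E (fhalf I)" by (simp add: block_def)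
  have "reach E (shalf I) u v \<in> F" for u v
  proof (cases "u \<in> set (shalf I) \<and> v \<in> set (shalf I)")
    case True
    then show ?thesis by (intro *) (simp_all add: set_halves[of I])
  next
    case False
    then have "reach E (shalf I) u v = Bot" by (intro reach_outside) blast
    then show ?thesis using Bot by simp
  qed
  then show "block E (shalf I)" by (simp add: block_def)
qed

lemma reach_lift:
  assumes "block E I" "2 \<le> length I"
  shows "kn {reach E (fhalf I) u v} {reach E I u v}" "kn {reach E (shalf I) u v} {reach E I u v}"
proof -
  have F: "reach E (fhalf I) u v \<in> F" "reach E (shalf I) u v \<in> F" "reach E I u v \<in> F"
    using assms block_halves[OF assms(1,2)] by (auto intro: block_reach)
  have 1: "kn X {reach E I u v}" if "X = {reach E (fhalf I) u v} \<or> X = {reach E (shalf I) u v}"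
    "u \<in> set I" "v \<in> set I" for X
  proof -
    note eq = reach_inside[OF that(2,3) assms(2), of E]
    have FF: "FOr (reach E (fhalf I) u v) (reach E (shalf I) u v) \<in> F"
      using F(3) unfolding eq by (rule or_sub)
    have X: "narrow 6 X" using that(1) F by auto
    have "kn X {reach E (fhalf I) u v, reach E (shalf I) u v}"
      using that(1) ident[OF F(1)] ident[OF F(2)] by auto
    from or_right[OF FF X narrow_empty this]
    have k: "kn X {FOr (reach E (fhalf I) u v) (reach E (shalf I) u v)}" .
    show ?thesis unfolding eq
      by (rule or_right[OF F(3)[unfolded eq] X narrow_empty], rule mono[OF k]) auto
  qed
  show "kn {reach E (fhalf I) u v} {reach E I u v}"
  proof (cases "u \<in> set (fhalf I) \<and> v \<in> set (fhalf I)")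
    case True
    then show ?thesis by (intro 1) (simp_all add: set_halves[of I])
  next
    case False
    then show ?thesis using reach_outside[of u "fhalf I" v E]
      by (intro Bot_left) auto
  qed
  show "kn {reach E (shalf I) u v} {reach E I u v}"
  proof (cases "u \<in> set (shalf I) \<and> v \<in> set (shalf I)")
    case True
    then show ?thesis by (intro 1) (simp_all add: set_halves[of I])
  next
    case False
    then show ?thesis using reach_outside[of u "shalf I" v E]
      by (intro Bot_left) auto
  qed
qed

lemma reach_disjunct:
  assumes "u \<in> set I" "v \<in> set I" "2 \<le> length I" "block E I" "(x, l, y) \<in> set E"
  shows "FAnd (reach E (fhalf I) u x) (FAnd l (reach E (shalf I) y v)) \<in> F"
    "Disj (crossings E I u v) \<in> F"
proof -
  show *: "Disj (crossings E I u v) \<in> F"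
    using block_reach[OF assms(4), of u v] unfolding reach_inside[OF assms(1-3)] by (auto elim!: or_subE)
  show "FAnd (reach E (fhalf I) u x) (FAnd l (reach E (shalf I) y v)) \<in> F"
    by (rule Disj_elem[OF *]) (use assms(5) in force)
qed

lemma reach_join:
  assumes "block E I" "2 \<le> length I" "(x, l, y) \<in> set E" "l \<in> F"
  shows "kn {reach E (fhalf I) u x, l, reach E (shalf I) y v} {reach E I u v}"
proof (cases "u \<in> set (fhalf I) \<and> v \<in> set (shalf I)")
  case True
  then have uv: "u \<in> set I" "v \<in> set I" using set_halves[of I] by auto
  note eq = reach_inside[OF uv assms(2), of E] and d = reach_disjunct[OF uv assms(2,1,3)]
  have F: "reach E (fhalf I) u x \<in> F" "reach E (shalf I) y v \<in> F" "reach E I u v \<in> F"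
    using assms block_halves[OF assms(1,2)] by (auto intro: block_reach)
  have conj: "kn {reach E (fhalf I) u x, l, reach E (shalf I) y v} {FAnd (reach E (fhalf I) u x) (FAnd l (reach E (shalf I) y v))}"
  proof (rule and_right[OF d(1)])
    show "narrow 6 {reach E (fhalf I) u x, l, reach E (shalf I) y v}"
      using F assms(4) by auto
    then show "kn {reach E (fhalf I) u x, l, reach E (shalf I) y v} {FAnd l (reach E (shalf I) y v)}"
      by (rule and_right[OF and_sub(2)[OF d(1)]]) (simp_all add: ident[OF F(2)] ident[OF assms(4)])
  qed (simp_all add: ident[OF F(1)])
  have "kn {reach E (fhalf I) u x, l, reach E (shalf I) y v} {Disj (crossings E I u v)}"
  proof (rule Disj_right[OF d(2) _ _ _ conj])
    show "FAnd (reach E (fhalf I) u x) (FAnd l (reach E (shalf I) y v)) \<in> set (crossings E I u v)"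
      using assms(3) by force
    show "narrow 5 {reach E (fhalf I) u x, l, reach E (shalf I) y v}"
      using F assms(4) by auto
  qed simp
  then have k: "kn {reach E (fhalf I) u x, l, reach E (shalf I) y v} {FOr (reach E (fhalf I) u v) (reach E (shalf I) u v),
      Disj (crossings E I u v)}"
    by (rule mono) auto
  show ?thesis unfolding eq
  proof (rule or_right[OF F(3)[unfolded eq] _ _ k])
    show "narrow 6 {reach E (fhalf I) u x, l, reach E (shalf I) y v}"
      using F assms(4) by auto
  qed simp
next
  case False
  then show ?thesis using reach_outside[of u "fhalf I" x E] reach_outside[of y "shalf I" v E]
    by (intro Bot_left) auto
qed

lemma reach_refl: "block E I \<Longrightarrow> u \<in> set I \<Longrightarrow> kn {} {reach E I u u}"
proof (induction "length I" arbitrary: I rule: less_induct)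
  case less
  show ?case
  proof (cases "length I < 2")
    case True
    then show ?thesis using less.prems by (subst reach.simps) (auto intro: Top_right)
  next
    case False
    then have 2: "2 \<le> length I" by simp
    have F: "reach E I u u \<in> F" "reach E (fhalf I) u u \<in> F" "reach E (shalf I) u u \<in> F"
      using less.prems block_halves[OF less.prems(1) 2] by (auto intro: block_reach)
    have lt: "length (fhalf I) < length I" "length (shalf I) < length I"
      using 2 by (auto simp: fhalf_def shalf_def)
    from less.prems(2) consider "u \<in> set (fhalf I)" | "u \<in> set (shalf I)" using set_halves[of I] by blast
    then show ?thesis
    proof cases
      case 1
      from less.hyps[OF lt(1) block_halves(1)[OF less.prems(1) 2] this]
      show ?thesis by (rule cut[OF F(2) _ reach_lift(1)[OF less.prems(1) 2, of u u]]) (use F in auto)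
    next
      case 2
      from less.hyps[OF lt(2) block_halves(2)[OF less.prems(1) \<open>2 \<le> length I\<close>] this]
      show ?thesis by (rule cut[OF F(3) _ reach_lift(2)[OF less.prems(1) \<open>2 \<le> length I\<close>, of u u]]) (use F in auto)
    qed
  qed
qed

text \<open>Elimination of the defining disjunction. If \<open>u\<close> lies outside of a half, the
  formula of that half is \<open>Bot\<close>, so each case may assume where \<open>u\<close>
  lies.\<close>

lemma reach_cases:
  assumes I: "block E I" "2 \<le> length I" and lF: "\<And>x l y. (x, l, y) \<in> set E \<Longrightarrow> l \<in> F"
    and X: "narrow 3 X" and Y: "narrow 5 Y"
    and 1: "u \<in> set (fhalf I) \<Longrightarrow> kn (insert (reach E (fhalf I) u v) X) Y"
    and 2: "u \<in> set (shalf I) \<Longrightarrow> kn (insert (reach E (shalf I) u v) X) Y"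
    and 3: "\<And>x l y. (x, l, y) \<in> set E \<Longrightarrow> u \<in> set (fhalf I) \<Longrightarrow>
      kn (insert (reach E (fhalf I) u x) (insert l (insert (reach E (shalf I) y v) X))) Y"
  shows "kn (insert (reach E I u v) X) Y"
proof (cases "u \<in> set I \<and> v \<in> set I")
  case True
  then have uv: "u \<in> set I" "v \<in> set I" by auto
  note eq = reach_inside[OF uv I(2), of E]
  have F: "reach E (fhalf I) a b \<in> F" "reach E (shalf I) a b \<in> F" "reach E I a b \<in> F" for a b
    using block_halves[OF I] I by (auto intro: block_reach)
  have FF: "FOr (reach E (fhalf I) u v) (reach E (shalf I) u v) \<in> F"
    using F(3)[of u v] unfolding eq by (rule or_sub)
  have DF: "Disj (crossings E I u v) \<in> F"
    using F(3)[of u v] unfolding eq by (rule or_sub)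
  have n: "narrow 6 X" "narrow 6 Y" using narrow_mono[OF X, of 6] narrow_mono[OF Y, of 6] by auto
  show ?thesis unfolding eq
  proof (intro or_left Disj_left)
    show "kn (insert (reach E (fhalf I) u v) X) Y"
      using 1 reach_outside[of u "fhalf I" v E] Bot_left by (cases "u \<in> set (fhalf I)") simp_all
    show "kn (insert (reach E (shalf I) u v) X) Y"
      using 2 reach_outside[of u "shalf I" v E] Bot_left by (cases "u \<in> set (shalf I)") simp_all
    fix f assume "f \<in> set (crossings E I u v)"
    then obtain x l y where e: "(x, l, y) \<in> set E" and f: "f = FAnd (reach E (fhalf I) u x) (FAnd l (reach E (shalf I) y v))"
      by auto
    have fF: "f \<in> F" unfolding f by (rule reach_disjunct(1)[OF uv I(2,1) e])
    have "kn (insert (reach E (fhalf I) u x) (insert l (insert (reach E (shalf I) y v) X))) Y"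
      using 3[OF e] reach_outside[of u "fhalf I" x E] Bot_left by (cases "u \<in> set (fhalf I)") simp_all
    then have "kn (insert (FAnd l (reach E (shalf I) y v)) (insert (reach E (fhalf I) u x) X)) Y"
    proof (intro and_left[OF and_sub(2)[OF fF[unfolded f]] _ n(2)])
      show "narrow 6 (insert (reach E (fhalf I) u x) X)"
        using F narrow_mono[OF X, of 5] by auto
    qed (simp add: insert_commute)
    then show "kn (insert f X) Y" unfolding f
      by (intro and_left[OF fF[unfolded f] n]) (simp add: insert_commute)
  qed (use F(3)[of u v, unfolded eq] FF DF n in auto)
next
  case False
  then show ?thesis using reach_outside[of u I v E]
    by (intro Bot_left) auto
qed

text \<open>Case distinction on the path from \<open>s\<close>. Since the edge does not lead back,
  \<open>s\<close> in the first half forces \<open>u\<close> into it, and the induction hypothesis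
  extends the part of the path in that half.\<close>

lemma reach_extend:
  assumes lF: "\<And>x l y. (x, l, y) \<in> set E \<Longrightarrow> l \<in> F" and e: "(u, l, s) \<in> set E"
  shows "block E I \<Longrightarrow> ordered E I \<Longrightarrow> u \<in> set I \<Longrightarrow> kn {l, reach E I s v} {reach E I u v}"
proof (induction "length I" arbitrary: I v rule: less_induct)
  case less
  note I = less.prems(1)
  have RF: "reach E I a b \<in> F" for a b using block_reach[OF I] .
  show ?case
  proof (cases "length I < 2")
    case True
    show ?thesis
    proof (cases "s \<in> set I \<and> v \<in> set I")
      case True
      then show ?thesis using \<open>length I < 2\<close> less.prems(3)
        by (intro ident[OF Top]) (auto simp: reach.simps[of E I])
    next
      case False
      then show ?thesis using reach_outside[of s I v E]
        by (intro Bot_left) auto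
    qed
  next
    case False
    then have 2: "2 \<le> length I" by simp
    note b = block_halves[OF I 2] and o = ordered_halves[OF less.prems(2)]
    have lt: "length (fhalf I) < length I" "length (shalf I) < length I"
      using 2 by (auto simp: fhalf_def shalf_def)
    have F: "reach E (fhalf I) a b \<in> F" "reach E (shalf I) a b \<in> F" for a b
      using b by (auto intro: block_reach)
    have l: "l \<in> F" using lF[OF e] .
    have first: "u \<in> set (fhalf I)" if "s \<in> set (fhalf I)"
      using orderedD[OF less.prems(2) e that] less.prems(3) set_halves[of I] by blast
    have "kn (insert (reach E I s v) {l}) {reach E I u v}"
    proof (rule reach_cases[OF I 2 lF])
      assume "s \<in> set (fhalf I)"
      from less.hyps[OF lt(1) b(1) o(1) first[OF this], of v]
      show "kn {reach E (fhalf I) s v, l} {reach E I u v}"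
        by (rule cut[OF F(1) _ reach_lift(1)[OF I 2, of u v]]) (use F l RF in auto)
    next
      assume s: "s \<in> set (shalf I)"
      show "kn {reach E (shalf I) s v, l} {reach E I u v}"
      proof (cases "u \<in> set (shalf I)")
        case True
        from less.hyps[OF lt(2) b(2) o(2) this, of v]
        show ?thesis
          by (rule cut[OF F(2) _ reach_lift(2)[OF I 2, of u v]]) (use F l RF in auto)
      next
        case False
        then have "u \<in> set (fhalf I)" using less.prems(3) set_halves[of I] by blast
        \<comment> \<open>Here the edge itself is the crossing; it is reached by the trivial path
          from \<open>u\<close> to \<open>u\<close>.\<close>
        from reach_refl[OF b(1) this]
        show ?thesis
          by (rule cut[OF F(1) _ reach_join[OF I 2 e l, of u v]]) (use F l RF in auto)
      qed
    next
      fix x l' y assume e': "(x, l', y) \<in> set E" and "s \<in> set (fhalf I)"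
      from less.hyps[OF lt(1) b(1) o(1) first[OF this(2)], of x]
      show "kn {reach E (fhalf I) s x, l', reach E (shalf I) y v, l} {reach E I u v}"
        by (rule cut[OF F(1) _ reach_join[OF I 2 e' lF[OF e'], of u v]])
          (use F l lF[OF e'] RF in auto)
    qed (use l RF in auto)
    then show ?thesis by (simp add: insert_commute)
  qed
qed

definition choice :: "(form \<times> 'n \<Rightarrow> bool) \<Rightarrow> ('n \<times> form \<times> 'n) list \<Rightarrow> 'n list \<Rightarrow> 'n \<Rightarrow> 'n \<Rightarrow> form set" where
  "choice c E I u v = (\<lambda>p. if c p then fst p else reach E I (snd p) v) ` {p. (u, fst p, snd p) \<in> set E}"

lemma choiceI: "(u, l, s) \<in> set E \<Longrightarrow> (if c (l, s) then l else reach E I s v) \<in> choice c E I u v"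
  unfolding choice_def by (rule image_eqI[where x = "(l, s)"]) auto

text \<open>The disjunction of \<open>l \<and> reach E I s v\<close> over the edges \<open>(u, l, s)\<close>, in conjunctive normal form:
  \<open>c\<close> chooses a conjunct from each disjunct.\<close>

lemma reach_first_step:
  assumes lF: "\<And>x l y. (x, l, y) \<in> set E \<Longrightarrow> l \<in> F"
    and deg: "card {p. (u, fst p, snd p) \<in> set E} \<le> 2"
  shows "block E I \<Longrightarrow> u \<in> set I \<Longrightarrow> u \<noteq> v \<Longrightarrow> kn {reach E I u v} (choice c E I u v)"
proof (induction "length I" arbitrary: I v rule: less_induct)
  case less
  note I = less.prems(1)
  have RF: "reach E I a b \<in> F" for a b using block_reach[OF I] .
  have fin: "finite {p. (u, fst p, snd p) \<in> set E}"
    by (rule finite_subset[of _ "snd ` set E"]) force+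
  \<comment> \<open>At most two edges leave \<open>u\<close>, so a choice set has at most two
    elements, and the two choice sets that meet in \<open>multicut\<close> stay within the
    width.\<close>
  have nc: "narrow 2 (choice c E J u w)" if "block E J" for J w
  proof -
    have "card (choice c E J u w) \<le> 2"
      unfolding choice_def by (rule order_trans[OF card_image_le[OF fin] deg])
    moreover have "choice c E J u w \<subseteq> F" using lF block_reach[OF that] by (auto simp: choice_def)
    ultimately show ?thesis using fin by (simp add: narrow_def choice_def)
  qed
  have fc: "finite (choice c E J u w)" for J w unfolding choice_def using fin by simp
  show ?case
  proof (cases "length I < 2")
    case True
    with less.prems have "v \<notin> set I" by (cases I) auto
    then show ?thesis using reach_outside[of u I v E] by (intro Bot_left) auto
  next
    case False
    then have 2: "2 \<le> length I" by simp
    note b = block_halves[OF I 2]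
    have lt: "length (fhalf I) < length I" "length (shalf I) < length I"
      using 2 by (auto simp: fhalf_def shalf_def)
    have F: "reach E (fhalf I) a b \<in> F" "reach E (shalf I) a b \<in> F" for a b
      using b by (auto intro: block_reach)
    have n8: "narrow 8 (choice c E I u v)" using narrow_mono[OF nc[OF I]] by simp
    have half: "kn {reach E J u v} (choice c E I u v)" if u: "u \<in> set J" and J: "J = fhalf I \<or> J = shalf I" for J
    proof (rule multicut[OF fc[of J v]])
      have J': "length J < length I" "block E J" using J lt b by auto
      show "kn {reach E J u v} (choice c E J u v \<union> choice c E I u v)"
        by (rule mono[OF less.hyps[OF J' u less.prems(3)]]) auto
      show "narrow 8 (choice c E J u v \<union> choice c E I u v)"
        using narrow_mono[OF narrow_union[OF nc[OF J'(2)] nc[OF I]], of 8] by simp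
      fix a assume "a \<in> choice c E J u v"
      then obtain l s where e: "(u, l, s) \<in> set E" and a: "a = (if c (l, s) then l else reach E J s v)"
        unfolding choice_def by auto
      show "kn {a, reach E J u v} (choice c E I u v)"
      proof (cases "c (l, s)")
        case True
        then show ?thesis using choiceI[OF e, of c I v] by (intro ident[OF lF[OF e]]) (simp_all add: a)
      next
        case False
        have "kn {reach E J s v} {reach E I s v}" using J reach_lift[OF I 2, of s v] by auto
        from mono[OF this] show ?thesis using choiceI[OF e, of c I v] False by (auto simp: a)
      qed
    qed (use J F in auto)
    show ?thesis
    proof (rule reach_cases[OF I 2 lF])
      show "kn {reach E (fhalf I) u v} (choice c E I u v)" if "u \<in> set (fhalf I)"
        using half[OF that] by simp
      show "kn {reach E (shalf I) u v} (choice c E I u v)" if "u \<in> set (shalf I)"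
        using half[OF that] by simp
      fix x l' y assume e': "(x, l', y) \<in> set E" and u: "u \<in> set (fhalf I)"
      show "kn {reach E (fhalf I) u x, l', reach E (shalf I) y v} (choice c E I u v)"
      \<comment> \<open>If the path crosses directly from \<open>u\<close>, the crossing edge is its
        first edge. Otherwise the first edge belongs to the part from \<open>u\<close> to
        \<open>x\<close> in the first half, where the induction hypothesis applies.\<close>
      proof (cases "u = x")
        case True
        have k: "kn {l', reach E (shalf I) y v} (choice c E I u v)"
        proof (cases "c (l', y)")
          case True
          then show ?thesis using choiceI[of u l' y E c I v] e' \<open>u = x\<close> by (intro ident[OF lF[OF e']]) simp_all
        next
          case False
          then show ?thesis using choiceI[of u l' y E c I v] e' \<open>u = x\<close>
            by (intro mono[OF reach_lift(2)[OF I 2, of y v]]) auto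
        qed
        show ?thesis by (rule mono[OF k]) auto
      next
        case False
        show ?thesis
        proof (rule multicut[OF fc[of "fhalf I" x]])
          show "kn {reach E (fhalf I) u x, l', reach E (shalf I) y v} (choice c E (fhalf I) u x \<union> choice c E I u v)"
            by (rule mono[OF less.hyps[OF lt(1) b(1) u False]]) auto
          show "narrow 8 (choice c E (fhalf I) u x \<union> choice c E I u v)"
            using narrow_mono[OF narrow_union[OF nc[OF b(1)] nc[OF I]], of 8] by simp
          fix a assume "a \<in> choice c E (fhalf I) u x"
          then obtain l s where e: "(u, l, s) \<in> set E" and a: "a = (if c (l, s) then l else reach E (fhalf I) s x)"
            unfolding choice_def by auto
          show "kn {a, reach E (fhalf I) u x, l', reach E (shalf I) y v} (choice c E I u v)"
          proof (cases "c (l, s)")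
            case True
            then show ?thesis using choiceI[OF e, of c I v] by (intro ident[OF lF[OF e]]) (simp_all add: a)
          next
            case False
            then show ?thesis using choiceI[OF e, of c I v]
              by (intro mono[OF reach_join[OF I 2 e' lF[OF e'], of s v]]) (auto simp: a)
          qed
        qed (use F lF[OF e'] in auto)
      qed
    qed (use narrow_mono[OF nc[OF I]] in auto)
  qed
qed

end

section \<open>Correctness of the generated lines\<close>

text \<open>A sequent already in \<open>K\<close> is accepted because a chain made by
  \<open>weakening\<close> starts with a known line.\<close>

definition justified :: "form sequent set \<Rightarrow> form sequent \<Rightarrow> bool" where
  "justified K S \<longleftrightarrow> S \<in> K \<or> (\<exists>ps. set ps \<subseteq> K \<and> lk_rule ps S)"

fun derives :: "form sequent set \<Rightarrow> form line list \<Rightarrow> bool" where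
  "derives K [] \<longleftrightarrow> True"
| "derives K (l # M) \<longleftrightarrow> justified K (sequent_of l) \<and> derives (insert (sequent_of l) K) M"

lemma justified_rule: "lk_rule ps S \<Longrightarrow> set ps \<subseteq> K \<Longrightarrow> justified K S"
  unfolding justified_def by blast

lemma derives_append: "derives K (M @ N) \<longleftrightarrow> derives K M \<and> derives (K \<union> sequent_of ` set M) N"
  by (induction M arbitrary: K) auto

text \<open>A repeated line is justified like its first occurrence.\<close>

lemma derives_derivation:
  assumes "derives {} ls" "ls \<noteq> []"
  shows "derivation lk_rule ls (sequent_of (last ls))"
proof -
  have "\<exists>ps. set ps \<subseteq> sequent_of ` set (take i ls) \<and> lk_rule ps (sequent_of (ls ! i))"
    if "derives {} ls" "i < length ls" for i ls
    using that
  proof (induction ls arbitrary: i rule: rev_induct)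
    case (snoc l ls)
    then have gd: "derives {} ls" and j: "justified (sequent_of ` set ls) (sequent_of l)"
      by (auto simp: derives_append)
    show ?case
    proof (cases "i < length ls")
      case True
      from snoc.IH[OF gd this] show ?thesis using True by (simp add: nth_append)
    next
      case False
      then have i: "i = length ls" using snoc.prems(2) by simp
      show ?thesis
      proof (cases "sequent_of l \<in> sequent_of ` set ls")
        case True
        then obtain k where k: "k < length ls" "sequent_of l = sequent_of (ls ! k)"
          by (auto simp: in_set_conv_nth)
        from snoc.IH[OF gd k(1)] obtain ps where
          ps: "set ps \<subseteq> sequent_of ` set (take k ls)" "lk_rule ps (sequent_of (ls ! k))" by blast
        have "set (take k ls) \<subseteq> set ls" by (rule set_take_subset)
        with ps k i show ?thesis by (auto intro!: exI[of _ ps])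
      next
        case False
        with j i show ?thesis by (auto simp: justified_def)
      qed
    qed
  qed simp
  with assms show ?thesis unfolding derivation_def by blast
qed

section \<open>Chains of weakenings and contractions\<close>

lemma suffixes_self: "xs \<in> set (suffixes xs)" "[] \<in> set (suffixes xs)"
  by (induction xs) auto

lemma last_suffixes: "suffixes xs \<noteq> []" "last (suffixes xs) = []"
proof (induction xs)
  case (Cons x xs)
  { case 1 show ?case by simp }
  { case 2 show ?case using Cons by simp }
qed auto

lemma derives_weak_left:
  "justified K (mset a, mset b) \<Longrightarrow> derives K (rev (map (\<lambda>s. (s @ a, b)) (suffixes c)))"
proof (induction c)
  case (Cons x c)
  define K' where "K' = K \<union> sequent_of ` set (rev (map (\<lambda>s. (s @ a, b)) (suffixes c)))"
  have "sequent_of (c @ a, b) \<in> K'" unfolding K'_def using suffixes_self(1)[of c] by force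
  moreover have "lk_rule [(mset (c @ a), mset b)] (add_mset x (mset (c @ a)), mset b)"
    by (intro lk_rule.base base_rule.weak_l)
  ultimately have "justified K' (sequent_of (x # c @ a, b))"
    by (intro justified_rule) auto
  with Cons show ?case by (simp add: derives_append K'_def)
qed simp

lemma derives_weak_right:
  "justified K (mset a, mset b) \<Longrightarrow> derives K (rev (map (\<lambda>s. (a, s @ b)) (suffixes c)))"
proof (induction c)
  case (Cons x c)
  define K' where "K' = K \<union> sequent_of ` set (rev (map (\<lambda>s. (a, s @ b)) (suffixes c)))"
  have "sequent_of (a, c @ b) \<in> K'" unfolding K'_def using suffixes_self(1)[of c] by force
  moreover have "lk_rule [(mset a, mset (c @ b))] (mset a, add_mset x (mset (c @ b)))"
    by (intro lk_rule.base base_rule.weak_r)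
  ultimately have "justified K' (sequent_of (a, x # c @ b))"
    by (intro justified_rule) auto
  with Cons show ?case by (simp add: derives_append K'_def)
qed simp

lemma derives_contr_left:
  "justified K (mset (c @ a), mset b) \<Longrightarrow> set a \<subseteq> set c \<Longrightarrow> derives K (map (\<lambda>s. (c @ s, b)) (suffixes a))"
proof (induction a arbitrary: K)
  case (Cons x a)
  let ?K = "insert (sequent_of (c @ x # a, b)) K"
  obtain c' where c': "mset c = add_mset x c'" using Cons.prems(2) by (metis list.set_intros(1) mset_add set_mset_mset subsetD)
  have "lk_rule [(add_mset x (add_mset x (c' + mset a)), mset b)] (add_mset x (c' + mset a), mset b)"
    by (intro lk_rule.base base_rule.contr_l)
  then have "justified ?K (mset (c @ a), mset b)"
    by (intro justified_rule) (auto simp: c')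
  with Cons show ?case by simp
qed simp

lemma derives_contr_right:
  "justified K (mset a, mset (c @ b)) \<Longrightarrow> set b \<subseteq> set c \<Longrightarrow> derives K (map (\<lambda>s. (a, c @ s)) (suffixes b))"
proof (induction b arbitrary: K)
  case (Cons x b)
  let ?K = "insert (sequent_of (a, c @ x # b)) K"
  obtain c' where c': "mset c = add_mset x c'" using Cons.prems(2) by (metis list.set_intros(1) mset_add set_mset_mset subsetD)
  have "lk_rule [(mset a, add_mset x (add_mset x (c' + mset b)))] (mset a, add_mset x (c' + mset b))"
    by (intro lk_rule.base base_rule.contr_r)
  then have "justified ?K (mset a, mset (c @ b))"
    by (intro justified_rule) (auto simp: c')
  with Cons show ?case by simp
qed simp

lemma derives_weakening:
  assumes "sequent_of k \<in> K" "subsumes k t"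
  shows "derives K (weakening k t)"
proof -
  obtain a b where k: "k = (a, b)" by (cases k)
  obtain c d where t: "t = (c, d)" by (cases t)
  have s: "set a \<subseteq> set c" "set b \<subseteq> set d" using assms(2) by (auto simp: subsumes_def k t)
  let ?L1 = "rev (map (\<lambda>s. (s @ a, b)) (suffixes c))" and ?L2 = "map (\<lambda>s. (c @ s, b)) (suffixes a)"
    and ?L3 = "rev (map (\<lambda>s. (c, s @ b)) (suffixes d))" and ?L4 = "map (\<lambda>s. (c, d @ s)) (suffixes b)"
  have "justified K (mset a, mset b)" using assms(1) by (simp add: justified_def k)
  then have 1: "derives K ?L1" by (rule derives_weak_left)
  have "sequent_of (c @ a, b) \<in> sequent_of ` set ?L1" using suffixes_self(1)[of c] by force
  then have "justified (K \<union> sequent_of ` set ?L1) (mset (c @ a), mset b)"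
    unfolding justified_def by simp
  then have 2: "derives (K \<union> sequent_of ` set ?L1) ?L2" using s(1) by (rule derives_contr_left)
  have "sequent_of (c, b) \<in> sequent_of ` set ?L2" using suffixes_self(2)[of a] by force
  then have "justified (K \<union> sequent_of ` set ?L1 \<union> sequent_of ` set ?L2) (mset c, mset b)"
    unfolding justified_def by simp
  then have 3: "derives (K \<union> sequent_of ` set ?L1 \<union> sequent_of ` set ?L2) ?L3" by (rule derives_weak_right)
  have "sequent_of (c, d @ b) \<in> sequent_of ` set ?L3" using suffixes_self(1)[of d] by force
  then have "justified (K \<union> sequent_of ` set ?L1 \<union> sequent_of ` set ?L2 \<union> sequent_of ` set ?L3) (mset c, mset (d @ b))"
    unfolding justified_def by simp
  then have 4: "derives (K \<union> sequent_of ` set ?L1 \<union> sequent_of ` set ?L2 \<union> sequent_of ` set ?L3) ?L4"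
    using s(2) by (rule derives_contr_right)
  have "weakening k t = ?L1 @ ?L2 @ ?L3 @ ?L4" by (simp add: weakening_def k t)
  then show ?thesis using 1 2 3 4 by (simp add: derives_append Un_assoc)
qed

lemma last_weakening: "last (weakening k t) = t" "weakening k t \<noteq> []"
  using last_suffixes[of "snd k"] by (simp_all add: weakening_def last_map)

lemma mem_weakening: "t \<in> set (weakening k t)"
  using last_weakening[of k t] last_in_set by metis

section \<open>Every entry is backed by a derivation\<close>

definition proof_lines :: "entry list \<Rightarrow> form line list" where
  "proof_lines st = concat (map snd (rev st))"

definition valid :: "entry list \<Rightarrow> bool" where
  "valid st \<longleftrightarrow> derives {} (proof_lines st) \<and>
     (\<forall>e\<in>set st. sequent_of (fst e) \<in> sequent_of ` set (proof_lines st))"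

lemma proof_lines_Cons: "proof_lines (e # st) = proof_lines st @ snd e"
  by (simp add: proof_lines_def)

lemma known_iff: "known st t \<noteq> [] \<longleftrightarrow> (\<exists>e\<in>set st. subsumes (fst e) t)"
  by (auto simp: known_def filter_empty_conv)

lemma hd_known: "known st t \<noteq> [] \<Longrightarrow> hd (known st t) \<in> set st \<and> subsumes (fst (hd (known st t))) t"
  using hd_in_set[of "known st t"] by (auto simp: known_def)

lemma valid_step:
  assumes "valid st"
  shows "valid (step j st)"
proof -
  obtain c d f where j: "j = ((c, d), f)" by (metis surj_pair)
  let ?t = "(c, f # d)" and ?t' = "(f # c, d)"
  show ?thesis
  proof (cases "known st (c, d) \<noteq> [] \<or> known st ?t = [] \<or> known st ?t' = []")
    case True
    then show ?thesis using assms by (auto simp: step_def j)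
  next
    case False
    let ?k = "fst (hd (known st ?t))" and ?k' = "fst (hd (known st ?t'))"
    from False have k: "hd (known st ?t) \<in> set st" "subsumes ?k ?t" "hd (known st ?t') \<in> set st" "subsumes ?k' ?t'"
      using hd_known by blast+
    let ?K = "sequent_of ` set (proof_lines st)"
    have K: "sequent_of ?k \<in> ?K" "sequent_of ?k' \<in> ?K" using assms k unfolding valid_def by blast+
    let ?W = "weakening ?k ?t" and ?W' = "weakening ?k' ?t'"
    have "derives ?K ?W" using K(1) k(2) by (rule derives_weakening)
    moreover have "derives (?K \<union> sequent_of ` set ?W) ?W'" using K(2) k(4) by (intro derives_weakening) auto
    moreover have "lk_rule [(mset c, add_mset f (mset d)), (add_mset f (mset c), mset d)] (mset c, mset d)"
      by (intro lk_rule.base base_rule.cut)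
    then have "justified (?K \<union> sequent_of ` set ?W \<union> sequent_of ` set ?W') (mset c, mset d)"
    proof (rule justified_rule)
      have "sequent_of ?t \<in> sequent_of ` set ?W" "sequent_of ?t' \<in> sequent_of ` set ?W'"
        using mem_weakening by blast+
      then show "set [(mset c, add_mset f (mset d)), (add_mset f (mset c), mset d)] \<subseteq>
          ?K \<union> sequent_of ` set ?W \<union> sequent_of ` set ?W'" by simp
    qed
    moreover have "step j st = ((c, d), ?W @ ?W' @ [(c, d)]) # st"
      using False by (simp add: step_def cut_entry_def j)
    ultimately show ?thesis using assms
      unfolding valid_def by (auto simp: proof_lines_Cons derives_append Un_assoc)
  qed
qed

lemma valid_foldr: "valid st \<Longrightarrow> valid (foldr step js st)"
  by (induction js) (auto intro: valid_step)

lemma ident_in_ax_lines: "([f], [f]) \<in> set (ax_lines f)"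
  by (cases f) auto

lemma derives_ax_lines:
  assumes "\<And>A B. f = FAnd A B \<or> f = FOr A B \<Longrightarrow> sequent_of ([A], [A]) \<in> K \<and> sequent_of ([B], [B]) \<in> K"
  shows "derives K (ax_lines f)"
proof (cases f)
  case (FLit p)
  have "lk_rule [] ({#FLit p#}, {#FLit p#})" "lk_rule [] ({#FLit p, FLit (dual p)#}, {#})"
    "lk_rule [] ({#}, {#FLit p, FLit (dual p)#})"
    by (rule lk_rule.base, rule base_rule.intros)+
  from this[THEN justified_rule] show ?thesis by (simp add: FLit)
next
  case (FAnd A B)
  have r1: "lk_rule [({#A#}, {#A#})] ({#A, B#}, {#A#})" "lk_rule [({#B#}, {#B#})] ({#A, B#}, {#B#})"
    using lk_rule.base[OF base_rule.weak_l, of "{#A#}" "{#A#}" B] lk_rule.base[OF base_rule.weak_l, of "{#B#}" "{#B#}" A]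
    by (simp_all only: add_mset_commute)
  have r2: "lk_rule [({#A, B#}, {#A#}), ({#A, B#}, {#B#})] ({#A, B#}, {#FAnd A B#})"
    by (rule lk_rule.and_r)
  have r3: "lk_rule [({#A, B#}, {#A#})] ({#FAnd A B#}, {#A#})" "lk_rule [({#A, B#}, {#B#})] ({#FAnd A B#}, {#B#})"
    "lk_rule [({#A, B#}, {#FAnd A B#})] ({#FAnd A B#}, {#FAnd A B#})"
    by (rule lk_rule.and_l)+
  show ?thesis using assms[of A B]
    by (simp add: FAnd justified_rule[OF r1(1)] justified_rule[OF r1(2)] justified_rule[OF r2]
        justified_rule[OF r3(1)] justified_rule[OF r3(2)] justified_rule[OF r3(3)])
next
  case (FOr A B)
  have r1: "lk_rule [({#A#}, {#A#})] ({#A#}, {#A, B#})" "lk_rule [({#B#}, {#B#})] ({#B#}, {#A, B#})"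
    using lk_rule.base[OF base_rule.weak_r, of "{#A#}" "{#A#}" B] lk_rule.base[OF base_rule.weak_r, of "{#B#}" "{#B#}" A]
    by (simp_all only: add_mset_commute)
  have r2: "lk_rule [({#A#}, {#A, B#}), ({#B#}, {#A, B#})] ({#FOr A B#}, {#A, B#})"
    by (rule lk_rule.or_l)
  have r3: "lk_rule [({#A#}, {#A, B#})] ({#A#}, {#FOr A B#})" "lk_rule [({#B#}, {#A, B#})] ({#B#}, {#FOr A B#})"
    "lk_rule [({#FOr A B#}, {#A, B#})] ({#FOr A B#}, {#FOr A B#})"
    by (rule lk_rule.or_r)+
  show ?thesis using assms[of A B]
    by (simp add: FOr justified_rule[OF r1(1)] justified_rule[OF r1(2)] justified_rule[OF r2]
        justified_rule[OF r3(1)] justified_rule[OF r3(2)] justified_rule[OF r3(3)])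
qed

lemma derives_sforms: "derives K (concat (map ax_lines (sforms f)))"
proof (induction f arbitrary: K)
  case (FLit p)
  show ?case using derives_ax_lines[of "FLit p" K] by simp
next
  case (FAnd A B)
  let ?L = "\<lambda>f. concat (map ax_lines (sforms f))"
  have "sequent_of ([C], [C]) \<in> sequent_of ` set (?L C)" for C
    using self_in_sforms[of C] ident_in_ax_lines[of C] by force
  then have "derives (K \<union> sequent_of ` set (?L A) \<union> sequent_of ` set (?L B)) (ax_lines (FAnd A B))"
    by (intro derives_ax_lines) auto
  with FAnd show ?case by (simp add: derives_append Un_assoc del: ax_lines.simps)
next
  case (FOr A B)
  let ?L = "\<lambda>f. concat (map ax_lines (sforms f))"
  have "sequent_of ([C], [C]) \<in> sequent_of ` set (?L C)" for C
    using self_in_sforms[of C] ident_in_ax_lines[of C] by force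
  then have "derives (K \<union> sequent_of ` set (?L A) \<union> sequent_of ` set (?L B)) (ax_lines (FOr A B))"
    by (intro derives_ax_lines) auto
  with FOr show ?case by (simp add: derives_append Un_assoc del: ax_lines.simps)
qed

lemma derives_concat_sforms: "derives K (concat (map ax_lines (concat (map sforms fs))))"
  by (induction fs arbitrary: K) (simp_all add: derives_append derives_sforms)

lemma valid_axiom_entries: "valid (axiom_entries \<pi>)"
proof -
  have "concat (map (\<lambda>x. [x]) ls) = ls" for ls :: "form line list" by (induction ls) auto
  then have "proof_lines (axiom_entries \<pi>) = concat (map ax_lines (formulas \<pi>))"
    by (simp add: proof_lines_def axiom_entries_def o_def)
  moreover have "derives {} (concat (map ax_lines (formulas \<pi>)))"
    unfolding formulas_def by (rule derives_concat_sforms)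
  ultimately show ?thesis by (auto simp: valid_def axiom_entries_def)
qed

lemma valid_saturation: "valid (saturation \<pi>)"
  unfolding saturation_def by (intro valid_foldr valid_axiom_entries)

section \<open>The search reaches a set closed under narrow cuts\<close>

definition knows :: "entry list \<Rightarrow> form set \<Rightarrow> form set \<Rightarrow> bool" where
  "knows st X Y \<longleftrightarrow> (\<exists>e\<in>set st. set (fst (fst e)) \<subseteq> X \<and> set (snd (fst e)) \<subseteq> Y)"

lemma known_knows: "known st t \<noteq> [] \<longleftrightarrow> knows st (set (fst t)) (set (snd t))"
  by (simp add: known_iff knows_def subsumes_def)

lemma known_knows': "known st t = [] \<longleftrightarrow> \<not> knows st (set (fst t)) (set (snd t))"
  using known_knows by blast

lemma knows_mono: "knows st X Y \<Longrightarrow> set st \<subseteq> set st' \<Longrightarrow> X \<subseteq> X' \<Longrightarrow> Y \<subseteq> Y' \<Longrightarrow> knows st' X' Y'"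
  unfolding knows_def by (meson order_trans subsetD)

definition enabled :: "entry list \<Rightarrow> form line \<times> form \<Rightarrow> bool" where
  "enabled st j \<longleftrightarrow> knows st (set (fst (fst j))) (insert (snd j) (set (snd (fst j)))) \<and>
     knows st (insert (snd j) (set (fst (fst j)))) (set (snd (fst j)))"

lemma step_eq:
  "step j st = (if \<not> knows st (set (fst (fst j))) (set (snd (fst j))) \<and> enabled st j
     then cut_entry (fst (hd (known st (fst (fst j), snd j # snd (fst j)))))
        (fst (hd (known st (snd j # fst (fst j), snd (fst j))))) j # st else st)"
  by (auto simp: step_def known_knows' enabled_def)

lemma step_mono: "set st \<subseteq> set (step j st)"
  by (auto simp: step_eq)

lemma foldr_step_mono: "set st \<subseteq> set (foldr step js st)"
proof (induction js)
  case (Cons j js)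
  from order_trans[OF Cons step_mono[of "foldr step js st" j]] show ?case by simp
qed simp

lemma knows_step: "enabled st j \<Longrightarrow> knows (step j st) (set (fst (fst j))) (set (snd (fst j)))"
  by (auto simp: step_eq) (auto simp: knows_def cut_entry_def)

lemma enabled_mono: "enabled st j \<Longrightarrow> set st \<subseteq> set st' \<Longrightarrow> enabled st' j"
  unfolding enabled_def by (meson knows_mono order_refl)

lemma knows_foldr_step:
  "j \<in> set js \<Longrightarrow> enabled st j \<Longrightarrow> knows (foldr step js st) (set (fst (fst j))) (set (snd (fst j)))"
proof (induction js)
  case (Cons i js)
  show ?case
  proof (cases "i = j")
    case True
    have "enabled (foldr step js st) j" by (rule enabled_mono[OF Cons.prems(2) foldr_step_mono])
    from knows_step[OF this] True show ?thesis by simp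
  next
    case False
    with Cons have "knows (foldr step js st) (set (fst (fst j))) (set (snd (fst j)))" by simp
    from knows_mono[OF this step_mono] show ?thesis by simp
  qed
qed simp

definition saturated :: "form line list \<Rightarrow> form list \<Rightarrow> entry list \<Rightarrow> bool" where
  "saturated C F st \<longleftrightarrow> (\<forall>j\<in>set (pairs C F). enabled st j \<longrightarrow> knows st (set (fst (fst j))) (set (snd (fst j))))"

lemma foldr_step_saturated:
  "saturated C F st \<Longrightarrow> set js \<subseteq> set (pairs C F) \<Longrightarrow> foldr step js st = st"
  by (induction js) (auto simp: step_eq saturated_def simp del: set_pairs)

text \<open>Each round adds a candidate to the known ones unless they are saturated already, so there
  are enough rounds.\<close>

lemma saturated_rounds: "saturated C F (foldr step (concat (map (\<lambda>c. pairs C F) C)) K)"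
proof -
  let ?N = "\<lambda>st. {t \<in> set C. knows st (set (fst t)) (set (snd t))}"
  \<comment> \<open>\<open>D\<close> only counts rounds, for the sake of the induction; each round
    runs through all of \<open>pairs C F\<close>.\<close>
  have "saturated C F (foldr step (concat (map (\<lambda>c. pairs C F) D)) K) \<or>
      length D \<le> card (?N (foldr step (concat (map (\<lambda>c. pairs C F) D)) K))" for D
  proof (induction D)
    case (Cons d D)
    let ?st = "foldr step (concat (map (\<lambda>c. pairs C F) D)) K"
    let ?st' = "foldr step (pairs C F) ?st"
    show ?case
    proof (cases "saturated C F ?st")
      case True
      then show ?thesis using foldr_step_saturated[OF True order_refl] by simp
    next
      case False
      then obtain j where j: "j \<in> set (pairs C F)" "enabled ?st j" "\<not> knows ?st (set (fst (fst j))) (set (snd (fst j)))"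
        unfolding saturated_def by blast
      have "fst j \<in> ?N ?st'" using knows_foldr_step[OF j(1,2)] j(1) by auto
      moreover have "fst j \<notin> ?N ?st" using j(3) by simp
      moreover have "?N ?st \<subseteq> ?N ?st'" using knows_mono[OF _ foldr_step_mono] by blast
      ultimately have "?N ?st \<subset> ?N ?st'" by blast
      then have "card (?N ?st) < card (?N ?st')" by (intro psubset_card_mono) auto
      with Cons False show ?thesis by simp
    qed
  qed simp
  from this[of C] show ?thesis
  proof
    \<comment> \<open>In this case all candidates are known, and the set is saturated for that
      reason.\<close>
    assume *: "length C \<le> card (?N (foldr step (concat (map (\<lambda>c. pairs C F) C)) K))"
    have "?N (foldr step (concat (map (\<lambda>c. pairs C F) C)) K) = set C"
      by (rule card_subset_eq) (use * card_length[of C] card_mono[of "set C" "?N (foldr step (concat (map (\<lambda>c. pairs C F) C)) K)"] in auto)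
    then show ?thesis unfolding saturated_def by auto
  qed
qed

lemma saturated_saturation: "saturated (candidates \<pi>) (formulas \<pi>) (saturation \<pi>)"
  unfolding saturation_def jobs_def by (rule saturated_rounds)

lemma set_lists_upto: "set (lists_upto n xs) = {l. set l \<subseteq> set xs \<and> length l \<le> n}"
proof (induction n)
  case (Suc n)
  show ?case
  proof (intro set_eqI)
    fix l show "l \<in> set (lists_upto (Suc n) xs) \<longleftrightarrow> l \<in> {l. set l \<subseteq> set xs \<and> length l \<le> Suc n}"
      using Suc by (cases l) auto
  qed
qed auto

lemma sforms_trans: "f \<in> set (sforms g) \<Longrightarrow> set (sforms f) \<subseteq> set (sforms g)"
  by (induction g) auto

lemma sforms_closed: "f \<in> set (concat (map sforms gs)) \<Longrightarrow> set (sforms f) \<subseteq> set (concat (map sforms gs))"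
  using sforms_trans[of f] by fastforce

text \<open>The bridge from the program to the abstract reasoning: a cut with a narrow conclusion
  beside \<open>c\<close> is one of the jobs, once its sets of formulas are listed without
  repetition, so that \<open>lists_upto\<close> covers them.\<close>

lemma cut_closed_saturation:
  assumes c: "c \<in> set (contexts \<pi>)"
  shows "cut_closed (set (formulas \<pi>)) (\<lambda>X Y. knows (saturation \<pi>) (set (fst c) \<union> X) (set (snd c) \<union> Y))"
proof
  let ?F = "set (formulas \<pi>)" and ?st = "saturation \<pi>"
  show "knows ?st (set (fst c) \<union> X') (set (snd c) \<union> Y')"
    if "knows ?st (set (fst c) \<union> X) (set (snd c) \<union> Y)" "X \<subseteq> X'" "Y \<subseteq> Y'" for X Y X' Y'
    using that(2,3) by (intro knows_mono[OF that(1)]) auto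
  show "knows ?st (set (fst c) \<union> set (fst l)) (set (snd c) \<union> set (snd l))"
    if "f \<in> ?F" "l \<in> set (ax_lines f)" for f l
  proof -
    have "(l, [l]) \<in> set (axiom_entries \<pi>)" using that by (auto simp: axiom_entries_def)
    then have "(l, [l]) \<in> set ?st" using foldr_step_mono unfolding saturation_def by blast
    then show ?thesis unfolding knows_def by force
  qed
  show "set (sforms f) \<subseteq> ?F" if "f \<in> ?F" for f
    using that unfolding formulas_def by (rule sforms_closed)
  show "Top \<in> ?F" "Bot \<in> ?F" using self_in_sforms[of Top] self_in_sforms[of Bot] by (auto simp: formulas_def)
  fix f X Y
  assume f: "f \<in> ?F" and X: "X \<union> Y \<subseteq> ?F" "finite X" "card X \<le> width" "finite Y" "card Y \<le> width"
    and kn: "knows ?st (set (fst c) \<union> insert f X) (set (snd c) \<union> Y)" "knows ?st (set (fst c) \<union> X) (set (snd c) \<union> insert f Y)"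
  obtain xs ys where xs: "set xs = X" "length xs = card X" and ys: "set ys = Y" "length ys = card Y"
    using X(2,4) finite_distinct_list distinct_card by metis
  let ?t = "(fst c @ xs, snd c @ ys)"
  have "(xs, ys) \<in> set (pairs (lists_upto width (formulas \<pi>)) (lists_upto width (formulas \<pi>)))"
    using X xs ys by (auto simp: set_lists_upto)
  then have "?t \<in> set (candidates \<pi>)" unfolding candidates_def using c by force
  then have "(?t, f) \<in> set (pairs (candidates \<pi>) (formulas \<pi>))" using f by simp
  moreover have "enabled ?st (?t, f)" using kn by (simp add: enabled_def xs ys)
  ultimately have "knows ?st (set (fst ?t)) (set (snd ?t))"
    using saturated_saturation[of \<pi>] unfolding saturated_def by fastforce
  then show "knows ?st (set (fst c) \<union> X) (set (snd c) \<union> Y)" by (simp add: xs ys)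
qed

section \<open>Translations of eNDT formulas\<close>

definition succs :: "(endt \<times> endt) list \<Rightarrow> endt \<Rightarrow> endt set" where
  "succs X A = {B. \<exists>l. (Some A, l, Some B) \<in> set (out_edges X A)}"

lemma succs_simps [simp]:
  "succs X (Lit p) = {}" "succs X (Dec B p C) = {B, C}" "succs X (Or B C) = {B, C}"
  by (auto simp: succs_def out_edges_def)

lemma succs_Ext: "succs X (Ext i) = {B. (Ext i, B) \<in> set X}"
  by (auto simp: succs_def out_edges_def) force

lemma self_in_subs: "A \<in> set (subs A)"
  by (cases A) auto

lemma exts_subs: "Ext i \<in> set (subs A) \<Longrightarrow> i \<in> exts A"
  by (induction A) auto

fun topological :: "(endt \<times> endt) list \<Rightarrow> endt list \<Rightarrow> bool" where
  "topological X [] \<longleftrightarrow> True"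
| "topological X (A # As) \<longleftrightarrow> succs X A \<subseteq> set As \<and> topological X As"

text \<open>Decisions and disjunctions point to their own subformulas, which follow them in
  preorder; only extension variables point into \<open>Bs\<close>.\<close>

lemma topological_subs:
  "topological X Bs \<Longrightarrow> (\<And>i. Ext i \<in> set (subs A) \<Longrightarrow> succs X (Ext i) \<subseteq> set Bs) \<Longrightarrow> topological X (subs A @ Bs)"
proof (induction A arbitrary: Bs)
  case (Dec A p B)
  have B: "topological X (subs B @ Bs)" by (rule Dec.IH(2)[OF Dec.prems(1)], rule Dec.prems(2)) simp
  have "topological X (subs A @ subs B @ Bs)"
    by (rule Dec.IH(1)[OF B]) (use Dec.prems(2) in fastforce)
  then show ?case using self_in_subs[of A] self_in_subs[of B] by simp
next
  case (Or A B)
  have B: "topological X (subs B @ Bs)" by (rule Or.IH(2)[OF Or.prems(1)], rule Or.prems(2)) simp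
  have "topological X (subs A @ subs B @ Bs)"
    by (rule Or.IH(1)[OF B]) (use Or.prems(2) in fastforce)
  then show ?case using self_in_subs[of A] self_in_subs[of B] by simp
qed (auto simp: succs_Ext)

lemma topological_succs: "topological X As \<Longrightarrow> A \<in> set As \<Longrightarrow> succs X A \<subseteq> set As"
  by (induction As) auto

lemma topological_remdups: "topological X As \<Longrightarrow> topological X (remdups As)"
  by (induction As) auto

lemma ext_pairs_snoc: "ext_pairs (E @ [A]) = (Ext (length E), A) # ext_pairs E"
  by (simp add: ext_pairs_def)

lemma ext_pairs_Nil: "ext_pairs [] = []"
  by (simp add: ext_pairs_def)

lemma set_ext_pairs: "(B, A) \<in> set (ext_pairs E) \<longleftrightarrow> (\<exists>i<length E. B = Ext i \<and> A = E ! i)"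
proof (induction E rule: rev_induct)
  case (snoc C E)
  then show ?case by (auto simp: ext_pairs_snoc nth_append less_Suc_eq)
qed (simp add: ext_pairs_Nil)

definition ext_nodes :: "endt list \<Rightarrow> endt list" where
  "ext_nodes E = concat (map (\<lambda>p. fst p # subs (snd p)) (ext_pairs E))"

text \<open>Induction on the number of axioms listed. A new right-hand side mentions only extension
  variables of smaller index, and their definitions are already in the list.\<close>

lemma topological_ext_nodes:
  assumes "extension_axioms E" "n \<le> length E"
  shows "topological (ext_pairs E) (ext_nodes (take n E)) \<and> (\<forall>i<n. E ! i \<in> set (ext_nodes (take n E)))"
  using assms(2)
proof (induction n)
  case 0
  show ?case by (simp add: ext_nodes_def ext_pairs_Nil)
next
  case (Suc n)
  then have IH: "topological (ext_pairs E) (ext_nodes (take n E))" "\<forall>i<n. E ! i \<in> set (ext_nodes (take n E))"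
    and n: "n < length E" by auto
  have eq: "ext_nodes (take (Suc n) E) = Ext n # subs (E ! n) @ ext_nodes (take n E)"
    using n by (simp add: take_Suc_conv_app_nth ext_nodes_def ext_pairs_snoc)
  have "exts (E ! n) \<subseteq> {..<n}" using assms(1) n by (simp add: extension_axioms_def)
  then have "succs (ext_pairs E) (Ext i) \<subseteq> set (ext_nodes (take n E))" if "Ext i \<in> set (subs (E ! n))" for i
    using exts_subs[OF that] IH(2) by (auto simp: succs_Ext set_ext_pairs)
  from topological_subs[OF IH(1) this]
  have "topological (ext_pairs E) (subs (E ! n) @ ext_nodes (take n E))" .
  moreover have "succs (ext_pairs E) (Ext n) \<subseteq> set (subs (E ! n))"
    using self_in_subs[of "E ! n"] by (auto simp: succs_Ext set_ext_pairs)
  ultimately have "topological (ext_pairs E) (ext_nodes (take (Suc n) E))" unfolding eq by auto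
  moreover have "\<forall>i<Suc n. E ! i \<in> set (ext_nodes (take (Suc n) E))"
    using IH(2) self_in_subs[of "E ! n"] unfolding eq by (auto simp: less_Suc_eq)
  ultimately show ?case by blast
qed

lemma nodes_eq:
  "nodes (E, ls) = remdups (concat (map subs (concat (map (\<lambda>l. fst l @ snd l) ls))) @ ext_nodes E)"
proof -
  have "concat (map (\<lambda>l. concat (map subs (fst l @ snd l))) ls) = concat (map subs (concat (map (\<lambda>l. fst l @ snd l) ls)))"
    by (induction ls) auto
  then show ?thesis by (simp add: nodes_def ext_nodes_def)
qed

lemma line_in_nodes: "l \<in> set ls \<Longrightarrow> A \<in> set (fst l) \<union> set (snd l) \<Longrightarrow> A \<in> set (nodes (E, ls))"
  using self_in_subs[of A] by (auto simp: nodes_def)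

lemma topological_nodes:
  assumes "extension_axioms E"
  shows "topological (ext_pairs E) (nodes (E, ls))"
proof -
  have E: "topological (ext_pairs E) (ext_nodes E)" "\<forall>i<length E. E ! i \<in> set (ext_nodes E)"
    using topological_ext_nodes[OF assms order_refl] by auto
  have "topological (ext_pairs E) (concat (map subs As) @ ext_nodes E)" for As
  proof (induction As)
    case (Cons A As)
    have "succs (ext_pairs E) (Ext i) \<subseteq> set (concat (map subs As) @ ext_nodes E)" for i
      using E(2) by (auto simp: succs_Ext set_ext_pairs)
    from topological_subs[OF Cons this] show ?case by simp
  qed (simp add: E)
  then show ?thesis unfolding nodes_eq by (rule topological_remdups)
qed

lemma fst_out_edges: "(x, l, y) \<in> set (out_edges X A) \<Longrightarrow> x = Some A"
  by (cases A) (auto simp: out_edges_def)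

lemma ordered_Cons:
  assumes "ordered D J" "\<And>y l. (y, l, x) \<in> set D \<Longrightarrow> y \<notin> set J"
  shows "ordered D (x # J)"
  unfolding ordered_def
proof (intro allI impI notI)
  fix P Q y l z assume *: "x # J = P @ Q" "(y, l, z) \<in> set D" "y \<in> set Q \<and> z \<in> set P"
  then obtain P' where P: "P = x # P'" "J = P' @ Q" by (cases P) auto
  then show False using * assms unfolding ordered_def by (cases "z = x") auto
qed

text \<open>An edge from the tail into the head would put the head among the successors of a tail
  node, hence into the tail, against distinctness. The sink \<open>None\<close> has no outgoing
  edges.\<close>

lemma ordered_topological:
  assumes D: "\<And>x l y. (x, l, y) \<in> set D \<Longrightarrow> \<exists>A. x = Some A \<and> (y = None \<or> (\<exists>B\<in>succs X A. y = Some B))"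
  shows "topological X As \<Longrightarrow> distinct As \<Longrightarrow> ordered D (map Some As @ [None])"
proof (induction As)
  case Nil
  show ?case by (auto simp: ordered_def append_eq_Cons_conv Cons_eq_append_conv)
next
  case (Cons A As)
  have "y \<notin> set (map Some As @ [None])" if e: "(y, l, Some A) \<in> set D" for y l
  proof
    assume "y \<in> set (map Some As @ [None])"
    moreover obtain B where B: "y = Some B" "A \<in> succs X B" using D[OF e] by auto
    ultimately have "B \<in> set As" by auto
    with topological_succs[of X As B] Cons.prems B(2) show False by auto
  qed
  with Cons show ?case by (simp add: ordered_Cons)
qed

section \<open>Defining equivalences of the translated formulas\<close>

locale translated = cut_closed "set (formulas \<pi>)" kn for \<pi> kn +
  assumes ext: "extension_axioms (fst \<pi>)"
begin

abbreviation "D \<equiv> edges \<pi>"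
abbreviation "I \<equiv> interval \<pi>"
abbreviation "tr \<equiv> translate \<pi>"
abbreviation "F \<equiv> set (formulas \<pi>)"

lemma tr_reach: "tr A = reach D I (Some A) None"
  by (simp add: translate_def reach_table_def lookup_table)

lemma block_I: "block D I"
proof -
  have "reach D I u v \<in> F" for u v
  proof (cases "u \<in> set I \<and> v \<in> set I")
    case True
    then have "((u, v), reach D I u v) \<in> set (reach_table \<pi>)"
      by (auto simp: reach_table_def table_def)
    then show ?thesis using self_in_sforms[of "reach D I u v"] unfolding formulas_def by force
  next
    case False
    then have "reach D I u v = Bot" by (intro reach_outside) blast
    then show ?thesis using Bot by simp
  qed
  then show ?thesis by (simp add: block_def)
qed

lemma reach_F: "reach D I u v \<in> F"
  using block_I by (rule block_reach)

lemma tr_F: "tr A \<in> F"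
  unfolding tr_reach by (rule reach_F)

lemma label_F: "(x, l, y) \<in> set D \<Longrightarrow> l \<in> F"
  using self_in_sforms[of l] unfolding formulas_def by force

lemma Disj_F: "A \<in> set (nodes \<pi>) \<Longrightarrow> Disj (Tms_list A) \<in> F"
  using self_in_sforms[of "Disj (Tms_list A)"] unfolding formulas_def by force

lemma Conj_F: "A \<in> set (nodes \<pi>) \<Longrightarrow> Conj (Cls_list A) \<in> F"
  using self_in_sforms[of "Conj (Cls_list A)"] unfolding formulas_def by force

lemma edge_iff: "A \<in> set (nodes \<pi>) \<Longrightarrow> (Some A, l, y) \<in> set D \<longleftrightarrow> (Some A, l, y) \<in> set (out_edges (ext_pairs (fst \<pi>)) A)"
  unfolding edges_def by (auto dest: fst_out_edges)

lemma topological_nodes_pi: "topological (ext_pairs (fst \<pi>)) (nodes \<pi>)"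
  using topological_nodes[OF ext, of "snd \<pi>"] by simp

lemma ordered_I: "ordered D I"
  unfolding interval_def
proof (rule ordered_topological[OF _ topological_nodes_pi])
  fix x l y assume "(x, l, y) \<in> set D"
  then obtain A where A: "(x, l, y) \<in> set (out_edges (ext_pairs (fst \<pi>)) A)" by (auto simp: edges_def)
  from A fst_out_edges[OF A] show "\<exists>A. x = Some A \<and> (y = None \<or> (\<exists>B\<in>succs (ext_pairs (fst \<pi>)) A. y = Some B))"
    by (cases y) (auto simp: succs_def)
qed (simp add: nodes_def)

lemma node_I: "A \<in> set (nodes \<pi>) \<Longrightarrow> Some A \<in> set I" "None \<in> set I"
  by (auto simp: interval_def)

lemma extend:
  assumes "A \<in> set (nodes \<pi>)" "(Some A, l, y) \<in> set (out_edges (ext_pairs (fst \<pi>)) A)"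
  shows "kn {l, reach D I y None} {tr A}"
  unfolding tr_reach
  by (rule reach_extend[OF label_F _ block_I ordered_I node_I(1)[OF assms(1)]])
    (simp_all add: edge_iff[OF assms(1)] assms(2))

lemma degree: "card {p. (Some A, fst p, snd p) \<in> set (out_edges (ext_pairs E) A)} \<le> 2"
proof (cases A)
  case (Lit p)
  have "{q. (Some A, fst q, snd q) \<in> set (out_edges (ext_pairs E) A)} \<subseteq> set [(FLit p, None)]"
    by (auto simp: Lit out_edges_def)
  from card_mono[OF _ this] show ?thesis by simp
next
  case (Ext i)
  have "{q. (Some A, fst q, snd q) \<in> set (out_edges (ext_pairs E) A)} \<subseteq> set [(Top, Some (E ! i))]"
    by (auto simp: Ext out_edges_def set_ext_pairs)
  from card_mono[OF _ this] show ?thesis by simp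
next
  case (Dec B p C)
  have "{q. (Some A, fst q, snd q) \<in> set (out_edges (ext_pairs E) A)} \<subseteq> set [(FLit (dual p), Some B), (FLit p, Some C)]"
    by (auto simp: Dec out_edges_def)
  from card_mono[OF _ this] card_length[of "[(FLit (dual p), Some B), (FLit p, Some C)]"] show ?thesis by simp
next
  case (Or B C)
  have "{q. (Some A, fst q, snd q) \<in> set (out_edges (ext_pairs E) A)} \<subseteq> set [(Top, Some B), (Top, Some C)]"
    by (auto simp: Or out_edges_def)
  from card_mono[OF _ this] card_length[of "[(Top, Some B), (Top, Some C)]"] show ?thesis by simp
qed

text \<open>Each \<open>c\<close> yields one clause of the expansion by the first edge; the
  connectives below are obtained by suitable choices of \<open>c\<close>.\<close>

lemma first_step:
  assumes A: "A \<in> set (nodes \<pi>)"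
    and Y: "\<And>l y. (Some A, l, y) \<in> set (out_edges (ext_pairs (fst \<pi>)) A) \<Longrightarrow> (if c (l, y) then l else reach D I y None) \<in> Y"
  shows "kn {tr A} Y"
proof -
  have eq: "{p. (Some A, fst p, snd p) \<in> set D} = {p. (Some A, fst p, snd p) \<in> set (out_edges (ext_pairs (fst \<pi>)) A)}"
    using edge_iff[OF A] by auto
  have "kn {tr A} (choice c D I (Some A) None)"
    unfolding tr_reach
    by (rule reach_first_step[OF label_F _ block_I node_I(1)[OF A]]) (use degree eq in auto)
  then show ?thesis
  proof (rule mono)
    show "choice c D I (Some A) None \<subseteq> Y"
    proof
      fix f assume "f \<in> choice c D I (Some A) None"
      then obtain l y where "(Some A, l, y) \<in> set (out_edges (ext_pairs (fst \<pi>)) A)"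
        "f = (if c (l, y) then l else reach D I y None)"
        unfolding choice_def eq by auto
      with Y show "f \<in> Y" by simp
    qed
  qed simp
qed

lemma Lit_F: "Lit p \<in> set (nodes \<pi>) \<Longrightarrow> FLit p \<in> F"
  by (rule label_F[of "Some (Lit p)" _ None]) (simp add: edge_iff out_edges_def)

lemma tr_Lit:
  assumes A: "Lit p \<in> set (nodes \<pi>)"
  shows "kn {tr (Lit p)} {FLit p}" "kn {FLit p} {tr (Lit p)}"
proof -
  show "kn {tr (Lit p)} {FLit p}"
    by (rule first_step[OF A, of "\<lambda>_. True"]) (auto simp: out_edges_def)
  have "kn {FLit p, reach D I None None} {tr (Lit p)}"
    by (rule extend[OF A]) (simp add: out_edges_def)
  then show "kn {FLit p} {tr (Lit p)}"
    by (rule cut[OF reach_F reach_refl[OF block_I node_I(2)]]) (use Lit_F[OF A] tr_F in auto)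
qed

lemma dual_neq: "dual p \<noteq> p"
  by (cases p) auto

lemma Dec_F: "Dec A p B \<in> set (nodes \<pi>) \<Longrightarrow> FLit p \<in> F" "Dec A p B \<in> set (nodes \<pi>) \<Longrightarrow> FLit (dual p) \<in> F"
  by (rule label_F[of "Some (Dec A p B)" _ "Some B"], simp add: edge_iff out_edges_def)
    (rule label_F[of "Some (Dec A p B)" _ "Some A"], simp add: edge_iff out_edges_def)

text \<open>The sequents with the decision on the left are clauses of the first-step expansion, the
  others come from single edges. The literal \<open>dual p\<close> is moved to the other side as
  \<open>p\<close>, to match the premises of \<open>dec_l\<close> and \<open>dec_r\<close>.\<close>

lemma tr_Dec:
  assumes N: "Dec A p B \<in> set (nodes \<pi>)"
  shows "kn {tr (Dec A p B), FLit p} {tr B}" "kn {tr (Dec A p B)} {FLit p, tr A}"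
    "kn {FLit p, tr B} {tr (Dec A p B)}" "kn {tr A} {FLit p, tr (Dec A p B)}"
proof -
  note F = Dec_F[OF N] tr_F
  \<comment> \<open>The label is chosen from the edge to \<open>B\<close> and the target from the
    edge to \<open>A\<close>.\<close>
  show "kn {tr (Dec A p B)} {FLit p, tr A}"
    by (rule first_step[OF N, of "\<lambda>q. fst q = FLit p"]) (use dual_neq[of p] in \<open>auto simp: out_edges_def tr_reach\<close>)
  have "kn {tr (Dec A p B)} {FLit (dual p), tr B}"
    by (rule first_step[OF N, of "\<lambda>q. fst q = FLit (dual p)"]) (use dual_neq[of p] in \<open>auto simp: out_edges_def tr_reach\<close>)
  then show "kn {tr (Dec A p B), FLit p} {tr B}"
    by (rule cut[OF F(2) _ lit_left[OF F(1)]]) (use F in auto)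
  show "kn {FLit p, tr B} {tr (Dec A p B)}"
    using extend[OF N, of "FLit p" "Some B"] by (simp add: out_edges_def tr_reach)
  have "kn {FLit (dual p), tr A} {tr (Dec A p B)}"
    using extend[OF N, of "FLit (dual p)" "Some A"] by (simp add: out_edges_def tr_reach)
  then show "kn {tr A} {FLit p, tr (Dec A p B)}"
    by (rule cut[OF F(2) lit_right[OF F(1)]]) (use F in auto)
qed

lemma top_edge:
  assumes N: "A \<in> set (nodes \<pi>)" and e: "(Some A, Top, Some B) \<in> set (out_edges (ext_pairs (fst \<pi>)) A)"
  shows "kn {tr B} {tr A}"
proof -
  have k: "kn {Top, tr B} {tr A}" using extend[OF N e] by (simp add: tr_reach)
  have "kn {} {Top}" by (rule Top_right) simp
  show ?thesis by (rule cut[OF Top \<open>kn {} {Top}\<close> k]) (use tr_F in auto)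
qed

lemma tr_Or:
  assumes N: "Or A B \<in> set (nodes \<pi>)"
  shows "kn {tr (Or A B)} {tr A, tr B}" "kn {tr A} {tr (Or A B)}" "kn {tr B} {tr (Or A B)}"
proof -
  show "kn {tr (Or A B)} {tr A, tr B}"
    by (rule first_step[OF N, of "\<lambda>q. False"]) (auto simp: out_edges_def tr_reach)
  show "kn {tr A} {tr (Or A B)}" "kn {tr B} {tr (Or A B)}"
    by (rule top_edge[OF N], simp add: out_edges_def)+
qed

lemma tr_Ext:
  assumes N: "Ext i \<in> set (nodes \<pi>)" and i: "i < length (fst \<pi>)"
  shows "kn {tr (Ext i)} {tr (fst \<pi> ! i)}" "kn {tr (fst \<pi> ! i)} {tr (Ext i)}"
proof -
  show "kn {tr (Ext i)} {tr (fst \<pi> ! i)}"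
    by (rule first_step[OF N, of "\<lambda>q. False"]) (auto simp: out_edges_def tr_reach set_ext_pairs)
  have "(Ext i, fst \<pi> ! i) \<in> set (ext_pairs (fst \<pi>))" using i by (auto simp: set_ext_pairs)
  then have "(Some (Ext i), Top, Some (fst \<pi> ! i)) \<in> set (out_edges (ext_pairs (fst \<pi>)) (Ext i))"
    by (force simp: out_edges_def)
  then show "kn {tr (fst \<pi> ! i)} {tr (Ext i)}" by (rule top_edge[OF N])
qed

lemma Dec_nodes: "Dec A p B \<in> set (nodes \<pi>) \<Longrightarrow> A \<in> set (nodes \<pi>) \<and> B \<in> set (nodes \<pi>)"
  using topological_succs[OF topological_nodes_pi] by fastforce

text \<open>\<open>Cls\<close> stands on the left of the goal, hence this direction. In the presence
  of \<open>p\<close> the clauses of a decision yield those of \<open>B\<close>, in its absence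
  those of \<open>A\<close>; \<open>tr_Dec\<close> leads to the decision in both cases, and a cut on
  \<open>p\<close> combines them.\<close>

lemma Cls_tr: "endt_of_dt T \<in> set (nodes \<pi>) \<Longrightarrow> kn {Conj (Cls_list (endt_of_dt T))} {tr (endt_of_dt T)}"
proof (induction T)
  case (DLit p)
  then have N: "Lit p \<in> set (nodes \<pi>)" by simp
  have "kn {Conj (Cls_list (Lit p))} {tr (Lit p)}"
    by (rule Conj_left[where f = "FLit p"]) (use Conj_F[OF N] tr_Lit(2)[OF N] tr_F in auto)
  then show ?case by simp
next
  case (DDec T p U)
  define A where "A = endt_of_dt T"
  define B where "B = endt_of_dt U"
  let ?C = "\<lambda>A. Conj (Cls_list A)" and ?A = "Dec A p B"
  have N: "?A \<in> set (nodes \<pi>)" using DDec.prems by (simp add: A_def B_def)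
  have AB: "A \<in> set (nodes \<pi>)" "B \<in> set (nodes \<pi>)" using Dec_nodes[OF N] by simp_all
  have IH: "kn {?C A} {tr A}" "kn {?C B} {tr B}" using DDec.IH(1)[folded A_def] DDec.IH(2)[folded B_def] AB by blast+
  note F = Dec_F[OF N] tr_F Conj_F[OF N] Conj_F[OF AB(1)] Conj_F[OF AB(2)]
  have fF: "f \<in> F" if "f \<in> set (Cls_list A) \<union> set (Cls_list B)" for f
    using that Conj_elem[OF F(5), of f] Conj_elem[OF F(6), of f] by blast
  have 1: "kn {FLit p, ?C ?A} {?C B}"
  proof (rule Conj_right[OF F(6)])
    fix f assume f: "f \<in> set (Cls_list B)"
    then have O: "FOr (FLit (dual p)) f \<in> set (Cls_list ?A)" by simp
    have OF: "FOr (FLit (dual p)) f \<in> F" using Conj_elem[OF F(4) O] .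
    have g: "f \<in> F" using fF f by blast
    have k: "kn {FOr (FLit (dual p)) f, FLit p} {f}"
    proof (rule or_left[OF OF])
      show "kn {FLit (dual p), FLit p} {f}" by (rule mono[OF lit_left[OF F(1)]]) auto
      show "kn {f, FLit p} {f}" by (rule ident[OF g]) auto
    qed (use F g in auto)
    have "kn {?C ?A, FLit p} {f}"
      by (rule Conj_left[OF F(4) O _ _ k]) (use F g in auto)
    then show "kn {FLit p, ?C ?A} {f}" by (simp add: insert_commute)
  qed (use F in auto)
  have 2: "kn {?C ?A} {?C A, FLit p}"
  proof (rule Conj_right[OF F(5)])
    fix f assume f: "f \<in> set (Cls_list A)"
    then have O: "FOr (FLit p) f \<in> set (Cls_list ?A)" by simp
    have OF: "FOr (FLit p) f \<in> F" using Conj_elem[OF F(4) O] .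
    have g: "f \<in> F" using fF f by blast
    have k: "kn {FOr (FLit p) f} {f, FLit p}"
    proof (rule or_left[OF OF])
      show "kn {FLit p} {f, FLit p}" by (rule ident[OF F(1)]) auto
      show "kn {f} {f, FLit p}" by (rule ident[OF g]) auto
    qed (use F g in auto)
    show "kn {?C ?A} {f, FLit p}"
      by (rule Conj_left[OF F(4) O _ _ k]) (use F g in auto)
  qed (use F in auto)
  have 3: "kn {FLit p, ?C ?A} {tr B}"
    by (rule cut[OF F(6) 1 IH(2)]) (use F in auto)
  have 4: "kn {FLit p, ?C ?A} {tr ?A}"
    by (rule cut[OF tr_F 3 tr_Dec(3)[OF N]]) (use F in auto)
  have 5: "kn {?C ?A} {tr A, FLit p}"
    by (rule cut[OF F(5) 2 IH(1)]) (use F in auto)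
  have 6: "kn {?C ?A} {FLit p, tr ?A}"
    by (rule cut[OF tr_F 5 tr_Dec(4)[OF N]]) (use F in auto)
  have "kn {?C ?A} {tr ?A}"
    by (rule cut[OF F(1) 6 4]) (use F in auto)
  then show ?case by (simp add: A_def B_def)
qed

text \<open>The dual of \<open>Cls_tr\<close>, with terms on the right: from a term of a branch and
  its test a term of the decision is formed.\<close>

lemma tr_Tms: "endt_of_dt T \<in> set (nodes \<pi>) \<Longrightarrow> kn {tr (endt_of_dt T)} {Disj (Tms_list (endt_of_dt T))}"
proof (induction T)
  case (DLit p)
  then have N: "Lit p \<in> set (nodes \<pi>)" by simp
  have "kn {tr (Lit p)} {Disj (Tms_list (Lit p))}"
    by (rule Disj_right[where f = "FLit p"]) (use Disj_F[OF N] tr_Lit(1)[OF N] tr_F in auto)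
  then show ?case by simp
next
  case (DDec T p U)
  define A where "A = endt_of_dt T"
  define B where "B = endt_of_dt U"
  let ?C = "\<lambda>A. Disj (Tms_list A)" and ?A = "Dec A p B"
  have N: "?A \<in> set (nodes \<pi>)" using DDec.prems by (simp add: A_def B_def)
  have AB: "A \<in> set (nodes \<pi>)" "B \<in> set (nodes \<pi>)" using Dec_nodes[OF N] by simp_all
  have IH: "kn {tr A} {?C A}" "kn {tr B} {?C B}" using DDec.IH(1)[folded A_def] DDec.IH(2)[folded B_def] AB by blast+
  note F = Dec_F[OF N] tr_F Disj_F[OF N] Disj_F[OF AB(1)] Disj_F[OF AB(2)]
  have fF: "f \<in> F" if "f \<in> set (Tms_list A) \<union> set (Tms_list B)" for f
    using that Disj_elem[OF F(5), of f] Disj_elem[OF F(6), of f] by blast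
  have 1: "kn {?C B, FLit p} {?C ?A}"
  proof (rule Disj_left[OF F(6)])
    fix f assume f: "f \<in> set (Tms_list B)"
    then have O: "FAnd (FLit p) f \<in> set (Tms_list ?A)" by simp
    have OF: "FAnd (FLit p) f \<in> F" using Disj_elem[OF F(4) O] .
    have g: "f \<in> F" using fF f by blast
    have k: "kn {f, FLit p} {FAnd (FLit p) f}"
    proof (rule and_right[OF OF])
      show "kn {f, FLit p} {FLit p}" by (rule ident[OF F(1)]) auto
      show "kn {f, FLit p} {f}" by (rule ident[OF g]) auto
    qed (use F g in auto)
    show "kn {f, FLit p} {?C ?A}"
      by (rule Disj_right[OF F(4) O _ _ k]) (use F g in auto)
  qed (use F in auto)
  have 2: "kn {?C A} {FLit p, ?C ?A}"
  proof (rule Disj_left[OF F(5)])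
    fix f assume f: "f \<in> set (Tms_list A)"
    then have O: "FAnd (FLit (dual p)) f \<in> set (Tms_list ?A)" by simp
    have OF: "FAnd (FLit (dual p)) f \<in> F" using Disj_elem[OF F(4) O] .
    have g: "f \<in> F" using fF f by blast
    have k: "kn {f} {FAnd (FLit (dual p)) f, FLit p}"
    proof (rule and_right[OF OF])
      show "kn {f} {FLit (dual p), FLit p}" by (rule mono[OF lit_right[OF F(1)]]) auto
      show "kn {f} {f, FLit p}" by (rule ident[OF g]) auto
    qed (use F g in auto)
    have "kn {f} {?C ?A, FLit p}"
      by (rule Disj_right[OF F(4) O _ _ k]) (use F g in auto)
    then show "kn {f} {FLit p, ?C ?A}" by (simp add: insert_commute)
  qed (use F in auto)
  have 3: "kn {tr B, FLit p} {?C ?A}"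
    by (rule cut[OF F(6) IH(2) 1]) (use F in auto)
  have 4: "kn {tr ?A, FLit p} {?C ?A}"
    by (rule cut[OF tr_F tr_Dec(1)[OF N] 3]) (use F in auto)
  have 5: "kn {tr A} {FLit p, ?C ?A}"
    by (rule cut[OF F(5) IH(1) 2]) (use F in auto)
  have 6: "kn {tr ?A} {FLit p, ?C ?A}"
    by (rule cut[OF tr_F tr_Dec(2)[OF N] 5]) (use F in auto)
  have "kn {tr ?A} {?C ?A}"
    by (rule cut[OF F(1) 6 4]) (use F in auto)
  then show ?case by (simp add: A_def B_def)
qed

end

section \<open>The simulation\<close>

locale translated_context = translated +
  fixes G H :: "form set"
  assumes absorb: "kn X Y \<Longrightarrow> X \<subseteq> G \<union> X' \<Longrightarrow> Y \<subseteq> H \<union> Y' \<Longrightarrow> kn X' Y'"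
begin

text \<open>With the translated conclusion as the context, side formulas and principal formulas are
  absorbed. What remains is a cut argument about the active formulas, whose number does not depend
  on the length of the line.\<close>

lemma rule_sound:
  assumes rule: "elndt_rule (fst \<pi>) ps S"
    and GH: "tr ` set_mset (fst S) \<subseteq> G" "tr ` set_mset (snd S) \<subseteq> H"
    and N: "\<And>P A. P \<in> insert S (set ps) \<Longrightarrow> A \<in> set_mset (fst P) \<union> set_mset (snd P) \<Longrightarrow> A \<in> set (nodes \<pi>)"
    and prem: "\<And>P. P \<in> set ps \<Longrightarrow> kn (tr ` set_mset (fst P)) (tr ` set_mset (snd P))"
  shows "kn {} {}"
proof -
  have premise: "kn X Y" if "(\<Gamma>, \<Delta>) \<in> set ps" "tr ` set_mset \<Gamma> \<subseteq> G \<union> X" "tr ` set_mset \<Delta> \<subseteq> H \<union> Y" for \<Gamma> \<Delta> X Y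
    using absorb[OF prem[OF that(1)]] that(2,3) by simp
  note cut_rule = cut
  from rule show ?thesis
  proof cases
    case eldt
    then show ?thesis
    proof cases
      case base
      then show ?thesis
      proof cases
        case (init_id p)
        have "kn {tr (Lit p)} {tr (Lit p)}" by (rule ident[OF tr_F]) auto
        then show ?thesis by (rule absorb) (use GH init_id in auto)
      next
        case (init_l p)
        have L: "Lit p \<in> set (nodes \<pi>)" "Lit (dual p) \<in> set (nodes \<pi>)"
          by (rule N[of S]; simp add: init_l)+
        note F = Lit_F[OF L(1)] Lit_F[OF L(2)] tr_F
        have "kn {tr (Lit p), FLit (dual p)} {}"
          by (rule cut[OF F(1) tr_Lit(1)[OF L(1)] lit_left[OF F(1)]]) (use F in auto)
        then have "kn {tr (Lit p), tr (Lit (dual p))} {}"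
          by (rule cut[OF F(2) tr_Lit(1)[OF L(2)]]) (use F in auto)
        then show ?thesis by (rule absorb) (use GH init_l in auto)
      next
        case (init_r p)
        have L: "Lit p \<in> set (nodes \<pi>)" "Lit (dual p) \<in> set (nodes \<pi>)"
          by (rule N[of S]; simp add: init_r)+
        note F = Lit_F[OF L(1)] Lit_F[OF L(2)] tr_F
        have "kn {} {tr (Lit p), FLit (dual p)}"
          by (rule cut[OF F(1) lit_right[OF F(1)] tr_Lit(2)[OF L(1)]]) (use F in auto)
        then have "kn {} {tr (Lit p), tr (Lit (dual p))}"
          by (rule cut[OF F(2) _ tr_Lit(2)[OF L(2)]]) (use F in auto)
        then show ?thesis by (rule absorb) (use GH init_r in auto)
      next
        case (weak_l \<Gamma> \<Delta> A)
        show ?thesis by (rule premise[of \<Gamma> \<Delta>]) (use GH weak_l in auto)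
      next
        case (weak_r \<Gamma> \<Delta> A)
        show ?thesis by (rule premise[of \<Gamma> \<Delta>]) (use GH weak_r in auto)
      next
        case (contr_l A \<Gamma> \<Delta>)
        show ?thesis by (rule premise[of "add_mset A (add_mset A \<Gamma>)" \<Delta>]) (use GH contr_l in auto)
      next
        case (contr_r \<Gamma> A \<Delta>)
        show ?thesis by (rule premise[of \<Gamma> "add_mset A (add_mset A \<Delta>)"]) (use GH contr_r in auto)
      next
        case (cut \<Gamma> A \<Delta>)
        have 1: "kn {} {tr A}" by (rule premise[of \<Gamma> "add_mset A \<Delta>"]) (use GH cut in auto)
        have 2: "kn {tr A} {}" by (rule premise[of "add_mset A \<Gamma>" \<Delta>]) (use GH cut in auto)
        show ?thesis by (rule cut_rule[OF tr_F 1 2]) auto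
      qed
    next
      case (ext_l i)
      have "Ext i \<in> set (nodes \<pi>)" by (rule N[of S]) (simp_all add: ext_l)
      from tr_Ext(1)[OF this ext_l(3)] show ?thesis by (rule absorb) (use GH ext_l in auto)
    next
      case (ext_r i)
      have "Ext i \<in> set (nodes \<pi>)" by (rule N[of S]) (simp_all add: ext_r)
      from tr_Ext(2)[OF this ext_r(3)] show ?thesis by (rule absorb) (use GH ext_r in auto)
    next
      case (dec_l A \<Gamma> p \<Delta> B)
      have D: "Dec A p B \<in> set (nodes \<pi>)" by (rule N[of S]) (simp_all add: dec_l)
      have L: "Lit p \<in> set (nodes \<pi>)"
        by (rule N[of "(add_mset A \<Gamma>, add_mset (Lit p) \<Delta>)"]) (simp_all add: dec_l)
      note F = Lit_F[OF L] tr_F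
      \<comment> \<open>\<open>tr (Lit p)\<close> is a reachability formula and not the literal
        itself, so \<open>tr_Lit\<close> has to mediate between the premises and the sequents of
        \<open>tr_Dec\<close>.\<close>
      have p1: "kn {tr A} {tr (Lit p)}"
        by (rule premise[of "add_mset A \<Gamma>" "add_mset (Lit p) \<Delta>"]) (use GH dec_l in auto)
      have p2: "kn {tr (Lit p), tr B} {}"
        by (rule premise[of "add_mset (Lit p) (add_mset B \<Gamma>)" \<Delta>]) (use GH dec_l in auto)
      have d1: "kn {} {FLit p, tr A}" by (rule absorb[OF tr_Dec(2)[OF D]]) (use GH dec_l in auto)
      have d2: "kn {FLit p} {tr B}" by (rule absorb[OF tr_Dec(1)[OF D]]) (use GH dec_l in auto)
      have "kn {tr A} {FLit p}" by (rule cut[OF tr_F p1 tr_Lit(1)[OF L]]) (use F in auto)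
      then have 1: "kn {} {FLit p}" by (rule cut[OF tr_F d1]) (use F in auto)
      have "kn {tr (Lit p), FLit p} {}" by (rule cut[OF tr_F d2 p2]) (use F in auto)
      then have "kn {FLit p} {}" by (rule cut[OF tr_F tr_Lit(2)[OF L]]) (use F in auto)
      then show ?thesis by (rule cut[OF F(1) 1]) auto
    next
      case (dec_r \<Gamma> A p \<Delta> B)
      have D: "Dec A p B \<in> set (nodes \<pi>)" by (rule N[of S]) (simp_all add: dec_r)
      have L: "Lit p \<in> set (nodes \<pi>)"
        by (rule N[of "(\<Gamma>, add_mset A (add_mset (Lit p) \<Delta>))"]) (simp_all add: dec_r)
      note F = Lit_F[OF L] tr_F
      have p1: "kn {} {tr A, tr (Lit p)}"
        by (rule premise[of \<Gamma> "add_mset A (add_mset (Lit p) \<Delta>)"]) (use GH dec_r in auto)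
      have p2: "kn {tr (Lit p)} {tr B}"
        by (rule premise[of "add_mset (Lit p) \<Gamma>" "add_mset B \<Delta>"]) (use GH dec_r in auto)
      have d1: "kn {tr A} {FLit p}" by (rule absorb[OF tr_Dec(4)[OF D]]) (use GH dec_r in auto)
      have d2: "kn {FLit p, tr B} {}" by (rule absorb[OF tr_Dec(3)[OF D]]) (use GH dec_r in auto)
      have "kn {} {FLit p, tr (Lit p)}" by (rule cut[OF tr_F p1 d1]) (use F in auto)
      then have 1: "kn {} {FLit p}" by (rule cut[OF tr_F _ tr_Lit(1)[OF L]]) (use F in auto)
      have "kn {FLit p} {tr B}" by (rule cut[OF tr_F tr_Lit(2)[OF L] p2]) (use F in auto)
      then have "kn {FLit p} {}" by (rule cut[OF tr_F _ d2]) (use F in auto)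
      then show ?thesis by (rule cut[OF F(1) 1]) auto
    qed
  next
    case (or_l A \<Gamma> \<Delta> B)
    have O: "Or A B \<in> set (nodes \<pi>)" by (rule N[of S]) (simp_all add: or_l)
    have p1: "kn {tr A} {}" by (rule premise[of "add_mset A \<Gamma>" \<Delta>]) (use GH or_l in auto)
    have p2: "kn {tr B} {}" by (rule premise[of "add_mset B \<Gamma>" \<Delta>]) (use GH or_l in auto)
    have "kn {} {tr A, tr B}" by (rule absorb[OF tr_Or(1)[OF O]]) (use GH or_l in auto)
    then have "kn {} {tr B}" by (rule cut[OF tr_F _ p1]) (use tr_F in auto)
    then show ?thesis by (rule cut[OF tr_F _ p2]) auto
  next
    case (or_r \<Gamma> A B \<Delta>)
    have O: "Or A B \<in> set (nodes \<pi>)" by (rule N[of S]) (simp_all add: or_r)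
    have p1: "kn {} {tr A, tr B}" by (rule premise[of \<Gamma> "add_mset A (add_mset B \<Delta>)"]) (use GH or_r in auto)
    have a: "kn {tr A} {}" by (rule absorb[OF tr_Or(2)[OF O]]) (use GH or_r in auto)
    have b: "kn {tr B} {}" by (rule absorb[OF tr_Or(3)[OF O]]) (use GH or_r in auto)
    have "kn {} {tr B}" by (rule cut[OF tr_F p1 a]) (use tr_F in auto)
    then show ?thesis by (rule cut[OF tr_F _ b]) auto
  qed
qed

lemma Cls_known:
  assumes N: "endt_of_dt T \<in> set (nodes \<pi>)" and G: "set (Cls_list (endt_of_dt T)) \<subseteq> G"
  shows "kn {} {tr (endt_of_dt T)}"
proof -
  have "kn {} {Conj (Cls_list (endt_of_dt T))}"
  proof (rule Conj_right[OF Conj_F[OF N]])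
    fix f assume f: "f \<in> set (Cls_list (endt_of_dt T))"
    have "kn {f} {f}" by (rule ident[OF Conj_elem[OF Conj_F[OF N] f]]) auto
    then show "kn {} {f}" by (rule absorb) (use f G in auto)
  qed auto
  then show ?thesis
    by (rule cut[OF Conj_F[OF N] _ Cls_tr[OF N]]) (use tr_F in auto)
qed

lemma Tms_known:
  assumes N: "endt_of_dt T \<in> set (nodes \<pi>)" and H: "set (Tms_list (endt_of_dt T)) \<subseteq> H"
  shows "kn {tr (endt_of_dt T)} {}"
proof -
  have "kn {Disj (Tms_list (endt_of_dt T))} {}"
  proof (rule Disj_left[OF Disj_F[OF N]])
    fix f assume f: "f \<in> set (Tms_list (endt_of_dt T))"
    have "kn {f} {f}" by (rule ident[OF Disj_elem[OF Disj_F[OF N] f]]) auto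
    then show "kn {f} {}" by (rule absorb) (use f H in auto)
  qed auto
  then show ?thesis
    by (rule cut[OF Disj_F[OF N] tr_Tms[OF N]]) (use tr_F in auto)
qed

end

abbreviation "holds \<pi> X Y \<equiv> knows (saturation \<pi>) X Y"
abbreviation "holds_in \<pi> c X Y \<equiv> holds \<pi> (set (fst c) \<union> X) (set (snd c) \<union> Y)"

lemma translated_contextI:
  assumes "extension_axioms (fst \<pi>)" "c \<in> set (contexts \<pi>)"
  shows "translated_context \<pi> (holds_in \<pi> c) (set (fst c)) (set (snd c))"
proof -
  interpret cut_closed "set (formulas \<pi>)" "holds_in \<pi> c"
    by (rule cut_closed_saturation[OF assms(2)])
  show ?thesis
  proof
    show "extension_axioms (fst \<pi>)" by (rule assms)
    show "holds_in \<pi> c X' Y'"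
      if "holds_in \<pi> c X Y" "X \<subseteq> set (fst c) \<union> X'" "Y \<subseteq> set (snd c) \<union> Y'" for X Y X' Y'
      using that(2,3) by (intro knows_mono[OF that(1)]) auto
  qed
qed

text \<open>By induction each premise is known without any context, hence by monotonicity also
  relative to the translation of line \<open>i\<close>, where \<open>rule_sound\<close>
  applies.\<close>

lemma line_holds:
  assumes ext: "extension_axioms E" and der: "derivation (elndt_rule E) ls S" and i: "i < length ls"
  shows "holds (E, ls) (translate (E, ls) ` set (fst (ls ! i))) (translate (E, ls) ` set (snd (ls ! i)))"
  using i
proof (induction i rule: less_induct)
  case (less i)
  let ?tr = "translate (E, ls)"
  let ?c = "translate_line (E, ls) (ls ! i)"
  have c: "?c \<in> set (contexts (E, ls))" using less.prems by (auto simp: contexts_def Let_def)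
  interpret translated_context "(E, ls)" "holds_in (E, ls) ?c" "set (fst ?c)" "set (snd ?c)"
    by (rule translated_contextI[OF _ c]) (simp add: ext)
  obtain ps where ps: "set ps \<subseteq> sequent_of ` set (take i ls)" "elndt_rule E ps (sequent_of (ls ! i))"
    using der less.prems unfolding derivation_def by blast
  have seq: "set_mset (fst (sequent_of l)) = set (fst l)" "set_mset (snd (sequent_of l)) = set (snd l)" for l :: "endt line"
    by (cases l; simp)+
  have "holds_in (E, ls) ?c {} {}"
  proof (rule rule_sound[of ps "sequent_of (ls ! i)"])
    show "elndt_rule (fst (E, ls)) ps (sequent_of (ls ! i))" using ps(2) by simp
    show "?tr ` set_mset (fst (sequent_of (ls ! i))) \<subseteq> set (fst ?c)" "?tr ` set_mset (snd (sequent_of (ls ! i))) \<subseteq> set (snd ?c)"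
      by (simp_all add: seq translate_line_def)
    fix P assume "P \<in> set ps"
    then obtain l where l: "l \<in> set (take i ls)" "P = sequent_of l" using ps(1) by auto
    then obtain j where j: "j < i" "l = ls ! j" using less.prems by (auto simp: in_set_conv_nth)
    have "holds (E, ls) (?tr ` set_mset (fst P)) (?tr ` set_mset (snd P))"
      using less.IH[OF j(1)] j less.prems by (simp add: l(2) seq)
    then show "holds_in (E, ls) ?c (?tr ` set_mset (fst P)) (?tr ` set_mset (snd P))"
      by (rule knows_mono) auto
  next
    fix P A assume P: "P \<in> insert (sequent_of (ls ! i)) (set ps)" "A \<in> set_mset (fst P) \<union> set_mset (snd P)"
    have "sequent_of ` set (take i ls) \<subseteq> sequent_of ` set ls" by (intro image_mono set_take_subset)
    moreover have "sequent_of (ls ! i) \<in> sequent_of ` set ls" using less.prems by simp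
    ultimately have "P \<in> sequent_of ` set ls" using P(1) ps(1) by blast
    then obtain l where "l \<in> set ls" "P = sequent_of l" by blast
    with P(2) show "A \<in> set (nodes (E, ls))" by (intro line_in_nodes) (simp_all add: seq)
  qed
  then show ?case by (simp add: translate_line_def)
qed

lemma suffixes_iff: "s \<in> set (suffixes xs) \<longleftrightarrow> (\<exists>p. xs = p @ s)"
  by (induction xs) (auto simp: Cons_eq_append_conv)

text \<open>Each translation in the last line is removed by one cut in its own context: on the left
  against its derivation from the clauses, then on the right against its refutation by the terms.
  Clauses and terms are all present from the start, so these contexts differ only in the remaining
  translations.\<close>

lemma goal_holds:
  assumes ext: "extension_axioms E" and der: "derivation (elndt_rule E) ls S"
    and l: "last ls = (xs, ys)" and xs: "set xs \<subseteq> range endt_of_dt" and ys: "set ys \<subseteq> range endt_of_dt"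
  shows "holds (E, ls) (set (fst (goal_line (E, ls)))) (set (snd (goal_line (E, ls))))"
proof -
  have ne: "ls \<noteq> []" using der by (simp add: derivation_def)
  let ?tr = "translate (E, ls)"
  let ?G = "concat (map Cls_list xs)" and ?H = "concat (map Tms_list ys)"
  have g: "goal_line (E, ls) = (?G, ?H)" using ne l by (simp add: goal_line_def Let_def hd_rev)
  have c: "contexts (E, ls) = map (translate_line (E, ls)) ls @
      map (\<lambda>s. (?G @ s, ?H @ map ?tr ys)) (suffixes (map ?tr xs)) @ map (\<lambda>s. (?G, ?H @ s)) (suffixes (map ?tr ys))"
    using ne l by (simp add: contexts_def Let_def g hd_rev last_map translate_line_def)
  have N: "A \<in> set (nodes (E, ls))" if "A \<in> set xs \<union> set ys" for A
    using line_in_nodes[OF last_in_set[OF ne], of A E] that by (simp add: l)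
  have last: "holds (E, ls) (?tr ` set xs) (?tr ` set ys)"
    using line_holds[OF ext der, of "length ls - 1"] ne l by (simp add: last_conv_nth)
  \<comment> \<open>\<open>p\<close> consists of the translations already removed and
    \<open>s\<close> of those that remain; \<open>s\<close> empty completes the left side.\<close>
  have left: "holds (E, ls) (set ?G \<union> set s) (set ?H \<union> set (map ?tr ys))" if "map ?tr xs = p @ s" for p s
    using that
  proof (induction p arbitrary: s rule: rev_induct)
    case Nil
    then have "set s = ?tr ` set xs" by (metis append_Nil list.set_map)
    then show ?case by (intro knows_mono[OF last]) auto
  next
    case (snoc a p)
    then have prev: "holds (E, ls) (set ?G \<union> set (a # s)) (set ?H \<union> set (map ?tr ys))" by simp
    have "a \<in> ?tr ` set xs" using snoc.prems by (metis append_assoc in_set_conv_decomp list.set_map append_Cons)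
    then obtain A where A: "A \<in> set xs" "a = ?tr A" by auto
    then obtain T where T: "A = endt_of_dt T" using xs by auto
    let ?c = "(?G @ s, ?H @ map ?tr ys)"
    have "?c \<in> set (contexts (E, ls))" unfolding c using snoc.prems by (auto simp: suffixes_iff)
    then interpret translated_context "(E, ls)" "holds_in (E, ls) ?c" "set (fst ?c)" "set (snd ?c)"
      by (intro translated_contextI) (simp_all add: ext)
    have 1: "holds_in (E, ls) ?c {} ({?tr A})"
      unfolding T by (rule Cls_known) (use A N T in auto)
    have 2: "holds_in (E, ls) ?c ({?tr A}) {}"
      by (rule knows_mono[OF prev]) (auto simp: A(2))
    have "holds_in (E, ls) ?c {} {}"
      by (rule cut[OF tr_F 1 2]) auto
    then show ?case by simp
  qed
  have "holds (E, ls) (set ?G) (set ?H \<union> set s)" if "map ?tr ys = p @ s" for p s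
    using that
  proof (induction p arbitrary: s rule: rev_induct)
    case Nil
    then show ?case using left[of "map ?tr xs" "[]"] by simp
  next
    case (snoc a p)
    then have prev: "holds (E, ls) (set ?G) (set ?H \<union> set (a # s))" by simp
    have "a \<in> ?tr ` set ys" using snoc.prems by (metis append_assoc in_set_conv_decomp list.set_map append_Cons)
    then obtain A where A: "A \<in> set ys" "a = ?tr A" by auto
    then obtain T where T: "A = endt_of_dt T" using ys by auto
    let ?c = "(?G, ?H @ s)"
    have "?c \<in> set (contexts (E, ls))" unfolding c using snoc.prems by (auto simp: suffixes_iff)
    then interpret translated_context "(E, ls)" "holds_in (E, ls) ?c" "set (fst ?c)" "set (snd ?c)"
      by (intro translated_contextI) (simp_all add: ext)
    have 1: "holds_in (E, ls) ?c ({?tr A}) {}"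
      unfolding T by (rule Tms_known) (use A N T in auto)
    have 2: "holds_in (E, ls) ?c {} ({?tr A})"
      by (rule knows_mono[OF prev]) (auto simp: A(2))
    have "holds_in (E, ls) ?c {} {}"
      by (rule cut[OF tr_F 2 1]) auto
    then show ?case by simp
  qed
  from this[of "map ?tr ys" "[]"] show ?thesis by (simp add: g)
qed

lemma simulation_correct:
  assumes "holds \<pi> (set (fst (goal_line \<pi>))) (set (snd (goal_line \<pi>)))"
  shows "is_lk_proof (simulation \<pi>) (sequent_of (goal_line \<pi>))"
proof -
  let ?k = "hd (known (saturation \<pi>) (goal_line \<pi>))"
  have "known (saturation \<pi>) (goal_line \<pi>) \<noteq> []" using assms by (simp add: known_knows)
  from hd_known[OF this] have k: "?k \<in> set (saturation \<pi>)" "subsumes (fst ?k) (goal_line \<pi>)" by auto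
  have "derives {} (simulation \<pi>)"
    using valid_saturation[of \<pi>] k derives_weakening[OF _ k(2)]
    unfolding simulation_def valid_def proof_lines_def by (simp add: derives_append)
  from derives_derivation[OF this] show ?thesis
    using last_weakening[of "fst ?k" "goal_line \<pi>"] by (simp add: is_lk_proof_def simulation_def)
qed

lemma mset_Cls_list: "mset (Cls_list (endt_of_dt T)) = Cls T"
  by (induction T) simp_all

lemma mset_Tms_list: "mset (Tms_list (endt_of_dt T)) = Tms T"
  by (induction T) simp_all

lemma mset_concat_map_cong:
  assumes "mset xs = mset (map g As)" "\<And>A. mset (f (g A)) = h A"
  shows "mset (concat (map f xs)) = sum_list (map h As)"
proof -
  have "mset (concat (map f zs)) = \<Sum>\<^sub># (image_mset (\<lambda>x. mset (f x)) (mset zs))" for zs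
    by (induction zs) auto
  then have "mset (concat (map f xs)) = \<Sum>\<^sub># (image_mset (\<lambda>x. mset (f x)) (mset (map g As)))"
    using assms(1) by simp
  also have "\<dots> = sum_list (map h As)" by (induction As) (simp_all add: assms(2))
  finally show ?thesis .
qed

lemma elndt_simulation:
  assumes "is_elndt_proof \<pi> (mset (map endt_of_dt As), mset (map endt_of_dt Bs))"
  shows "is_lk_proof (simulation \<pi>) (sum_list (map Cls As), sum_list (map Tms Bs))"
proof -
  obtain E ls where \<pi>: "\<pi> = (E, ls)" by (cases \<pi>)
  obtain xs ys where l: "last ls = (xs, ys)" by (cases "last ls")
  have ext: "extension_axioms E" and der: "derivation (elndt_rule E) ls (mset (map endt_of_dt As), mset (map endt_of_dt Bs))"
    using assms by (simp_all add: \<pi>)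
  have ms: "mset xs = mset (map endt_of_dt As)" "mset ys = mset (map endt_of_dt Bs)" and ne: "ls \<noteq> []"
    using der l by (simp_all add: derivation_def)
  have "set xs \<subseteq> range endt_of_dt" "set ys \<subseteq> range endt_of_dt"
    using ms[THEN mset_eq_setD] by auto
  from simulation_correct[OF goal_holds[OF ext der l this]]
  have "is_lk_proof (simulation \<pi>) (sequent_of (goal_line \<pi>))" by (simp add: \<pi>)
  also have "goal_line \<pi> = (concat (map Cls_list xs), concat (map Tms_list ys))"
    using ne l by (simp add: \<pi> goal_line_def Let_def hd_rev)
  also have "sequent_of \<dots> = (sum_list (map Cls As), sum_list (map Tms Bs))"
    using mset_concat_map_cong[OF ms(1), of Cls_list Cls] mset_concat_map_cong[OF ms(2), of Tms_list Tms]
    by (simp only: sequent_of.simps mset_Cls_list mset_Tms_list)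
  finally show ?thesis .
qed

section \<open>From the time calculus to the stated notion of simulation\<close>

lemma quasipolynomial_qbound: "quasipolynomial (\<lambda>n. nat \<lfloor>qbound k n\<rfloor>)"
  unfolding quasipolynomial_def
proof (intro exI)
  show "\<forall>\<^sub>F n in sequentially. real (nat \<lfloor>qbound k n\<rfloor>) \<le> 2 powr (log 2 (real n) ^ (2 * k))"
  \<comment> \<open>From 4 on, \<open>n + 4 \<le> n * n\<close>, so \<open>qlog n\<close> is at most
    twice the logarithm of \<open>n\<close> and thus at most its square; this turns the exponent
    \<open>k\<close> into \<open>2 * k\<close>.\<close>
  proof (rule eventually_sequentiallyI[of 4])
    fix n :: nat assume n: "4 \<le> n"
    let ?l = "log 2 (real n)"
    have l: "2 \<le> ?l" using n by (subst le_log_iff) simp_all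
    have "4 * real n \<le> real n * real n" using n by (intro mult_right_mono) auto
    then have "real n + 4 \<le> real n * real n" using n by linarith
    also have "2 powr ?l = real n" using n by simp
    then have "real n * real n = 2 powr (2 * ?l)" by (simp only: mult_2 powr_add)
    finally have "qlog n \<le> 2 * ?l" by (rule qlog_le)
    also have "\<dots> \<le> ?l * ?l" using l by (intro mult_right_mono) auto
    also have "\<dots> = ?l ^ 2" by (simp add: power2_eq_square)
    finally have "qlog n ^ k \<le> (?l ^ 2) ^ k" using two_le_qlog[of n] by (intro power_mono) auto
    then have "qbound k n \<le> 2 powr (?l ^ (2 * k))"
      unfolding qbound_def power_mult by (intro powr_mono) auto
    moreover have "real (nat \<lfloor>qbound k n\<rfloor>) \<le> qbound k n" using two_le_qbound[of k n] by linarith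
    ultimately show "real (nat \<lfloor>qbound k n\<rfloor>) \<le> 2 powr (?l ^ (2 * k))" by linarith
  qed
qed

lemma qp_runs:
  fixes f :: "ext_proof \<Rightarrow> lk_proof"
  assumes "qp f"
  shows "\<exists>P T. quasipolynomial T \<and>
    (\<forall>\<pi>. \<exists>t. runs P (enc_ext_proof \<pi>) (enc_lk_proof (f \<pi>)) t \<and> t \<le> T (size (enc_ext_proof \<pi>)))"
proof -
  have e: "enc_ext_proof = enc" "enc_lk_proof = enc"
    by (simp_all add: enc_ext_proof_def enc_lk_proof_def enc_lines_def enc_prod_class_def
        enc_list_class_def enc_endt_class_def enc_form_class_def)
  obtain k where "\<And>n. \<exists>R e. impl k n R e f" using assms unfolding qp_def by blast
  \<comment> \<open>Position 0 belongs to the main function, whose body is \<open>e\<close>, so the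
    auxiliary functions start at position 1.\<close>
  then obtain R e where R: "impl k 1 R e f" by blast
  have "\<exists>t. runs (e # R) (enc \<pi>) (enc (f \<pi>)) t \<and> t \<le> nat \<lfloor>qbound k (sz \<pi>)\<rfloor>" for \<pi>
  proof -
    obtain t where t: "eval ([e] @ R @ []) [enc \<pi>] e (enc (f \<pi>)) t" "real t \<le> qbound k (sz \<pi>)"
      using R[unfolded impl_def, rule_format, of "[e]" "[]" \<pi> "[]"] by auto
    then have "runs (e # R) (enc \<pi>) (enc (f \<pi>)) t" "t \<le> nat \<lfloor>qbound k (sz \<pi>)\<rfloor>"
      by (simp_all add: runs_def) linarith
    then show ?thesis by blast
  qed
  then show ?thesis unfolding e using quasipolynomial_qbound by blast
qed

lemma derivation_mono: "derivation r ls S \<Longrightarrow> (\<And>ps S. r ps S \<Longrightarrow> r' ps S) \<Longrightarrow> derivation r' ls S"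
  unfolding derivation_def by blast

lemma eldt_is_elndt: "is_eldt_proof \<pi> S \<Longrightarrow> is_elndt_proof \<pi> S"
proof (cases \<pi>)
  case (Pair E ls)
  assume "is_eldt_proof \<pi> S"
  then have "extension_axioms E" "derivation (eldt_rule E) ls S" by (simp_all add: Pair)
  from this(1) derivation_mono[OF this(2), of "elndt_rule E"] show ?thesis
    by (simp add: Pair elndt_rule.eldt)
qed

theorem theorem6p2:
  "lk_quasipolynomially_simulates is_elndt_proof \<and> lk_quasipolynomially_simulates is_eldt_proof"
proof -
  obtain P T where PT: "quasipolynomial T"
    "\<And>\<pi>. \<exists>t. runs P (enc_ext_proof \<pi>) (enc_lk_proof (simulation \<pi>)) t \<and> t \<le> T (size (enc_ext_proof \<pi>))"
    using qp_runs[OF qp_simulation] by blast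
  have "lk_quasipolynomially_simulates is_proof" if sub: "\<And>\<pi> S. is_proof \<pi> S \<Longrightarrow> is_elndt_proof \<pi> S" for is_proof
    unfolding lk_quasipolynomially_simulates_def
  proof (intro exI[of _ P] exI[of _ T] conjI PT(1) allI impI)
    fix \<pi> As Bs assume "is_proof \<pi> (mset (map endt_of_dt As), mset (map endt_of_dt Bs))"
    with sub have "is_lk_proof (simulation \<pi>) (sum_list (map Cls As), sum_list (map Tms Bs))"
      by (intro elndt_simulation) blast
    with PT(2)[of \<pi>] show "\<exists>\<rho> t. runs P (enc_ext_proof \<pi>) (enc_lk_proof \<rho>) t \<and> t \<le> T (size (enc_ext_proof \<pi>)) \<and>
        is_lk_proof \<rho> (sum_list (map Cls As), sum_list (map Tms Bs))" by blast
  qed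
  then show ?thesis using eldt_is_elndt by blast
qed

end
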